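(* Let $(X_t)_{t\geq 0}$ be a spectrally negative Lévy process with $X_0=0$ that is not a pure drift, with Laplace exponent $$\psi(\theta)=c\theta+\tfrac12\sigma^2\theta^2+\int_{(0,\infty)}\left(e^{-\theta y}-1+\theta y\,\mathbf 1_{\{y<1\}}\right)\Pi(\mathrm dy),\qquad\theta\ge 0,$$ and assume $\psi'(0+)\geq 0$. For $x\ge 0$ let $\tau_x^+=\inf\{t>0: X_t>x\}$. Define a killed subordinator $(Y_t)_{t\geq 0}$, independent of $(\tau_x^+)_{x\geq 0}$, through its Laplace exponent $\varphi(\theta)=-t^{-1}\log\mathbb{E}[e^{-\theta Y_t}]$ by setting $$\varphi(\theta):=\psi'(0+)+\frac{\sigma^2}{2}\theta+\int_0^\infty\big(1-e^{-\theta y}\big)\,\Pi((y,\infty))\,\mathrm dy,\qquad\theta>0.$$ Then $(\tau_{Y_t}^+)_{t\geq 0}$ is a killed subordinator with Laplace exponent $$-\frac1t\log\mathbb{E}\left[e^{-q\,\tau_{Y_t}^+}\right]=\eta(q),\qquad q\geq 0,$$ where $\eta(q)=\frac{q}{\Phi(q)}$ for $q>0$, $\eta(0):=\lim_{q\downarrow0}\eta(q)=\psi'(0+)$, and $\Phi(q)=\sup\{\theta\ge 0:\psi(\theta)=q\}$.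
   Context: A Lévy process is spectrally negative if it has no positive jumps. Its Laplace exponent is $\psi(\theta)=\frac1t\log\mathbb{E}[e^{\theta X_t}]$, where $c\in\mathbb{R}$, $\sigma^2\ge0$, and $\Pi$ is a measure on $(0,\infty)$ with $\int_{(0,\infty)}(1\wedge y^2)\,\Pi(\mathrm dy)<\infty$; $\psi'(0+)=\lim_{\theta\downarrow0}\psi'(\theta)=\mathbb{E}[X_1]$. A pure drift is a process $X_t=ct$, $c\in\mathbb R$. When $\psi'(0+)\ge0$ it is known that $(\tau_x^+)_{x\ge0}$ is a subordinator with Laplace exponent $\Phi$, i.e. $\mathbb{E}[e^{-q\tau_x^+}]=e^{-\Phi(q)x}$. A subordinator is a Lévy process with non-decreasing paths. A killed subordinator is a process $Y$ with $Y_t=\tilde Y_t$ for $t<\mathbf e_\beta$ and $Y_t=\zeta$ for $t\ge\mathbf e_\beta$, where $\tilde Y$ is a subordinator, $\mathbf e_\beta$ is an independent $\mathrm{Exp}(\beta)$-distributed time with $\beta\ge 0$ ($\beta=0$ meaning $\mathbf e_\beta=\infty$, i.e. no killing), and $\zeta$ is a cemetery state. In expectations, the killed event contributes $0$: $\mathbb{E}[e^{-\theta Y_t}]:=\mathbb{E}[e^{-\theta\tilde Y_t}\mathbf 1_{\{t<\mathbf e_\beta\}}]$, so that the Laplace exponent of $Y$ is $\beta$ plus the Laplace exponent of $\tilde Y$. The time-changed process $\tau^+_{Y_t}$ equals the cemetery state whenever $Y_t=\zeta$, with the same convention for its expectations (also at $q=0$). *)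

theory Defs
  imports "HOL-Probability.Probability"
begin

text \<open>
  Processes are indexed by real times, of which only \<open>t \<ge> 0\<close> matter. All paths are
  cadlag, so that first passage times are measurable without completing \<open>M\<close>; the other
  path properties are only required almost surely.
\<close>

definition cadlag :: "(real \<Rightarrow> real) \<Rightarrow> bool" where
  "cadlag f \<longleftrightarrow>
     (\<forall>t\<ge>0. continuous (at_right t) f) \<and> (\<forall>t>0. \<exists>l. (f \<longlongrightarrow> l) (at_left t))"

locale levy_process = prob_space M
  for M :: "'a measure" and X :: "real \<Rightarrow> 'a \<Rightarrow> real" +
  assumes rv: "t \<ge> 0 \<Longrightarrow> X t \<in> borel_measurable M"
    and start: "AE \<omega> in M. X 0 \<omega> = 0"
    and cadlag_paths: "\<omega> \<in> space M \<Longrightarrow> cadlag (\<lambda>t. X t \<omega>)"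
    and indep_increments:
      "\<lbrakk>0 \<le> s 0; \<And>i. i < n \<Longrightarrow> s i \<le> s (Suc i)\<rbrakk> \<Longrightarrow>
        indep_vars (\<lambda>_. borel) (\<lambda>i \<omega>. X (s (Suc i)) \<omega> - X (s i) \<omega>) {..<n}"
    and stationary_increments:
      "\<lbrakk>0 \<le> r; 0 \<le> t\<rbrakk> \<Longrightarrow>
        distr M borel (\<lambda>\<omega>. X (r + t) \<omega> - X r \<omega>) = distr M borel (X t)"

text \<open>Every jump \<open>X t \<omega> - l\<close>, with \<open>l\<close> the left limit at \<open>t\<close>, is nonpositive.\<close>

locale spectrally_negative_levy_process = levy_process +
  assumes no_positive_jumps:
    "AE \<omega> in M. \<forall>t>0. \<forall>l. ((\<lambda>s. X s \<omega>) \<longlongrightarrow> l) (at_left t) \<longrightarrow> X t \<omega> \<le> l"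

locale subordinator = levy_process +
  assumes nondecreasing_paths: "AE \<omega> in M. mono_on {0..} (\<lambda>t. X t \<omega>)"

definition pure_drift :: "'a measure \<Rightarrow> (real \<Rightarrow> 'a \<Rightarrow> real) \<Rightarrow> bool" where
  "pure_drift M X \<longleftrightarrow> (\<exists>c. AE \<omega> in M. \<forall>t\<ge>0. X t \<omega> = c * t)"

definition levy_measure :: "real measure \<Rightarrow> bool" where
  "levy_measure \<nu> \<longleftrightarrow> sets \<nu> = sets borel \<and> emeasure \<nu> {..0} = 0 \<and>
     (\<integral>\<^sup>+y\<in>{0<..}. ennreal (min 1 (y\<^sup>2)) \<partial>\<nu>) < \<infinity>"

definition levy_exponent :: "real \<Rightarrow> real \<Rightarrow> real measure \<Rightarrow> real \<Rightarrow> real" where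
  "levy_exponent c \<sigma> \<nu> \<theta> = c * \<theta> + \<sigma>\<^sup>2 * \<theta>\<^sup>2 / 2 +
     (LINT y:{0<..}|\<nu>. exp (- \<theta> * y) - 1 + \<theta> * y * indicator {..<1} y)"

text \<open>Integrability is part of the definition since a divergent Bochner integral is \<open>0\<close>.\<close>

definition has_laplace_exponent ::
  "'a measure \<Rightarrow> (real \<Rightarrow> 'a \<Rightarrow> real) \<Rightarrow> (real \<Rightarrow> real) \<Rightarrow> bool" where
  "has_laplace_exponent M X \<psi> \<longleftrightarrow>
     (\<forall>t>0. \<forall>\<theta>\<ge>0. integrable M (\<lambda>\<omega>. exp (\<theta> * X t \<omega>)) \<and>
        \<psi> \<theta> = 1 / t * ln (\<integral>\<omega>. exp (\<theta> * X t \<omega>) \<partial>M))"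

definition first_passage :: "(real \<Rightarrow> 'a \<Rightarrow> real) \<Rightarrow> real \<Rightarrow> 'a \<Rightarrow> ereal" where
  "first_passage X x \<omega> = (INF t\<in>{t. 0 < t \<and> x < X t \<omega>}. ereal t)"

definition right_inverse_exponent :: "(real \<Rightarrow> real) \<Rightarrow> real \<Rightarrow> real" where
  "right_inverse_exponent \<psi> q = Sup {\<theta>. 0 \<le> \<theta> \<and> \<psi> \<theta> = q}"

definition eta :: "(real \<Rightarrow> real) \<Rightarrow> real \<Rightarrow> real" where
  "eta \<psi> q = (if q = 0 then Lim (at_right 0) (\<lambda>r. r / right_inverse_exponent \<psi> r)
             else q / right_inverse_exponent \<psi> q)"

definition process_sigma ::
  "'a measure \<Rightarrow> real set \<Rightarrow> (real \<Rightarrow> 'a \<Rightarrow> 'b::topological_space) \<Rightarrow> 'a set set" where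
  "process_sigma M T Z =
     sigma_sets (space M) {Z t -` B \<inter> space M | t B. t \<in> T \<and> B \<in> sets borel}"

definition rv_sigma :: "'a measure \<Rightarrow> ('a \<Rightarrow> 'b::topological_space) \<Rightarrow> 'a set set" where
  "rv_sigma M Z = {Z -` B \<inter> space M | B. B \<in> sets borel}"

definition exponential_time :: "'a measure \<Rightarrow> real \<Rightarrow> ('a \<Rightarrow> ereal) \<Rightarrow> bool" where
  "exponential_time M \<beta> e \<longleftrightarrow> 0 \<le> \<beta> \<and> e \<in> borel_measurable M \<and>
     (if \<beta> = 0 then AE \<omega> in M. e \<omega> = \<infinity>
      else (AE \<omega> in M. \<bar>e \<omega>\<bar> \<noteq> \<infinity>) \<and>
           distributed M lborel (\<lambda>\<omega>. real_of_ereal (e \<omega>)) (exponential_density \<beta>))"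

text \<open>
  The cemetery state is \<open>\<infinity>\<close>. In \<open>killed_subordinator_via M \<beta> V e Y\<close>, the process \<open>Y\<close> is
  the subordinator \<open>V\<close> killed at the independent exponential time \<open>e\<close> of rate \<open>\<beta>\<close>.
\<close>

definition killed_subordinator_via ::
  "'a measure \<Rightarrow> real \<Rightarrow> (real \<Rightarrow> 'a \<Rightarrow> real) \<Rightarrow> ('a \<Rightarrow> ereal) \<Rightarrow>
    (real \<Rightarrow> 'a \<Rightarrow> ereal) \<Rightarrow> bool" where
  "killed_subordinator_via M \<beta> V e Y \<longleftrightarrow>
     subordinator M V \<and> exponential_time M \<beta> e \<and>
     prob_space.indep_set M (process_sigma M {0..} V) (rv_sigma M e) \<and>
     (\<forall>t\<ge>0. Y t \<in> borel_measurable M) \<and>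
     (AE \<omega> in M. \<forall>t\<ge>0. Y t \<omega> = (if ereal t < e \<omega> then ereal (V t \<omega>) else \<infinity>))"

definition killed_subordinator :: "'a measure \<Rightarrow> (real \<Rightarrow> 'a \<Rightarrow> ereal) \<Rightarrow> bool" where
  "killed_subordinator M Y \<longleftrightarrow> (\<exists>\<beta> V e. killed_subordinator_via M \<beta> V e Y)"

text \<open>The cemetery contributes \<open>0\<close> to the expectation, also for \<open>\<theta> = 0\<close>.\<close>

definition killed_laplace_exponent ::
  "'a measure \<Rightarrow> (real \<Rightarrow> 'a \<Rightarrow> ereal) \<Rightarrow> real \<Rightarrow> real \<Rightarrow> real" where
  "killed_laplace_exponent M Y t \<theta> =
     - (1 / t) * ln (\<integral>\<omega>. (if Y t \<omega> = \<infinity> then 0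
                        else exp (- \<theta> * real_of_ereal (Y t \<omega>))) \<partial>M)"

definition time_change ::
  "(real \<Rightarrow> 'a \<Rightarrow> ereal) \<Rightarrow> (real \<Rightarrow> 'a \<Rightarrow> ereal) \<Rightarrow> real \<Rightarrow> 'a \<Rightarrow> ereal" where
  "time_change T Y t \<omega> = (if Y t \<omega> = \<infinity> then \<infinity> else T (real_of_ereal (Y t \<omega>)) \<omega>)"

text \<open>The argument \<open>m\<close> stands for the right limit of \<open>\<psi>'\<close> at \<open>0\<close>.\<close>

definition phi :: "real \<Rightarrow> real \<Rightarrow> real measure \<Rightarrow> real \<Rightarrow> real" where
  "phi m \<sigma> \<nu> \<theta> = m + \<sigma>\<^sup>2 / 2 * \<theta> +
     (LINT y:{0<..}|lborel. (1 - exp (- \<theta> * y)) * measure \<nu> {y<..})"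

end

theory Submission
  imports Defs
begin

text \<open>
  Integrating by parts, \<open>\<psi> \<theta> = \<theta> * phi \<theta>\<close>, where finiteness of the large-jump mean and the value of
  the drift are read off from the limit of \<open>deriv \<psi>\<close> at \<open>0\<close> by monotone convergence. So \<open>\<psi>\<close> is an
  increasing bijection of \<open>(0, \<infinity>)\<close>.

  Optional stopping of \<open>exp (\<theta> * X t - \<psi> \<theta> * t)\<close> at \<open>\<tau> x\<close> and \<open>\<tau> y\<close>, where \<open>X\<close> equals \<open>x\<close> and \<open>y\<close> since it
  does not jump upwards, shows \<open>E [exp (- \<psi> \<theta> * (\<tau> y - \<tau> x)) | F] = exp (- \<theta> * (y - x))\<close> with \<open>F\<close> the past
  of \<open>\<tau> x\<close>; uniqueness of Laplace transforms then gives stationary independent increments of \<open>\<tau>\<close>.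
  By Fubini, \<open>\<tau>\<close> evaluated at an independent subordinator \<open>V\<close> inherits them from \<open>\<tau>\<close> and \<open>V\<close>, and
  killing is not affected. The exponent at \<open>q = \<psi> \<theta>\<close> is \<open>phi \<theta> = \<psi> \<theta> / \<theta> = q / \<theta>\<close>.
\<close>

section \<open>Uniqueness of Laplace transforms\<close>

text \<open>Several obstacles shape the proof. The event \<open>\<tau> x < t\<close> lies in the
  past of \<open>t\<close> only with strict inequality, so \<open>F\<close> looks infinitesimally
  beyond \<open>\<tau> x\<close>, and \<open>\<tau> x\<close> is approximated by strictly later grid
  times. There the path may overshoot \<open>x\<close> without bound; it is truncated at
  \<open>x\<close>, which costs nothing in the limit because \<open>X\<close> equals
  \<open>x\<close> at \<open>\<tau> x\<close>. Finiteness of \<open>\<tau> x\<close> is a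
  consequence of its transform, hence an indicator of finiteness accompanies the early formulas
  until \<open>\<theta>\<close> tends to \<open>0\<close>. Fubini needs two coordinates, one for
  \<open>(V, e)\<close> and one for the passages, and therefore joint measurability in level and
  outcome with respect to the \<sigma>-algebra of \<open>\<tau>\<close>; right continuity in the
  level provides it. That \<open>X\<close> is not a pure drift excludes \<open>\<sigma> = 0\<close>
  with \<open>\<nu>\<close> null and makes \<open>phi\<close> positive even when
  \<open>m = 0\<close>. Surjectivity of \<open>\<psi>\<close> lets the uniqueness theorem see every
  \<open>q > 0\<close>, whereas \<open>q = 0\<close> is reached through the survival probability of
  \<open>Y\<close>, a limit of its transforms.\<close>

lemma laplace_transform_unique:
  fixes \<mu> \<nu> :: "real measure"
  assumes fin: "finite_measure \<mu>" "finite_measure \<nu>"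
    and sets[measurable_cong]: "sets \<mu> = sets borel" "sets \<nu> = sets borel"
    and nonneg: "AE x in \<mu>. 0 \<le> x" "AE x in \<nu>. 0 \<le> x"
    and eq: "\<And>q. q > 0 \<Longrightarrow> (\<integral>x. exp (- q * x) \<partial>\<mu>) = (\<integral>x. exp (- q * x) \<partial>\<nu>)"
  shows "\<mu> = \<nu>"
proof -
  interpret m: finite_measure \<mu> by fact
  interpret n: finite_measure \<nu> by fact
  have lim0: "(\<lambda>i. \<integral>x. exp (- (1 / real (Suc i)) * x) \<partial>\<kappa>) \<longlonglongrightarrow> (\<integral>x. exp (- 0 * x) \<partial>\<kappa>)"
    if "finite_measure \<kappa>" "AE x in \<kappa>. 0 \<le> x" "sets \<kappa> = sets borel" for \<kappa> :: "real measure"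
  proof (rule integral_dominated_convergence[where w="\<lambda>_. 1"])
    note [measurable_cong] = that(3)
    show "(\<lambda>x. exp (- 0 * x)) \<in> borel_measurable \<kappa>"
      "\<And>i. (\<lambda>x. exp (- (1 / real (Suc i)) * x)) \<in> borel_measurable \<kappa>" by measurable
    show "integrable \<kappa> (\<lambda>_. 1::real)" using that(1) by (simp add: finite_measure.integrable_const)
    have "(\<lambda>i. exp (- (1 / real (Suc i)) * x)) \<longlonglongrightarrow> exp (- 0 * x)" for x
      by (intro tendsto_intros LIMSEQ_Suc[OF lim_1_over_n])
    then show "AE x in \<kappa>. (\<lambda>i. exp (- (1 / real (Suc i)) * x)) \<longlonglongrightarrow> exp (- 0 * x)" by auto
    show "AE x in \<kappa>. norm (exp (- (1 / real (Suc i)) * x)) \<le> 1" for i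
      using that(2) by eventually_elim (simp add: divide_nonneg_nonneg)
  qed
  \<comment> \<open>The constant term of a polynomial needs the total masses, \<open>q = 0\<close>,
    which the hypothesis leaves out; they agree in the limit along
    \<open>1 / (i + 1)\<close>.\<close>
  have eq0: "(\<integral>x. exp (- q * x) \<partial>\<mu>) = (\<integral>x. exp (- q * x) \<partial>\<nu>)" if "q \<ge> 0" for q
  proof (cases "q = 0")
    case True
    have "(\<lambda>i. \<integral>x. exp (- (1 / real (Suc i)) * x) \<partial>\<mu>) = (\<lambda>i. \<integral>x. exp (- (1 / real (Suc i)) * x) \<partial>\<nu>)"
      by (intro ext eq) simp
    with lim0[OF fin(1) nonneg(1) sets(1)] lim0[OF fin(2) nonneg(2) sets(2)] show ?thesis
      unfolding True by (metis LIMSEQ_unique)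
  qed (use that eq in auto)
  have bound_int: "integrable \<mu> f" "integrable \<nu> f"
    if [measurable]: "f \<in> borel_measurable borel" and "\<And>x. x \<ge> 0 \<Longrightarrow> \<bar>f x\<bar> \<le> B" for f :: "real \<Rightarrow> real" and B
    using nonneg that(2)
    by (auto intro!: m.integrable_const_bound[where B=B] n.integrable_const_bound[where B=B])
  \<comment> \<open>In the variable \<open>u = exp (- x)\<close> the transforms at natural numbers
    are moments on \<open>(0, 1]\<close>, so polynomials in \<open>u\<close> have equal integrals.
    Stone-Weierstrass extends this to continuous functions, and a limit to indicators.\<close>
  have eqp: "(\<integral>x. p (exp (- x)) \<partial>\<mu>) = (\<integral>x. p (exp (- x)) \<partial>\<nu>)"
    if rp: "real_polynomial_function p" for p :: "real \<Rightarrow> real"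
  proof -
    obtain a N where p: "p = (\<lambda>x. \<Sum>i\<le>N. a i * x ^ i)"
      using rp unfolding real_polynomial_function_iff_sum by blast
    have 1: "p (exp (- x)) = (\<Sum>i\<le>N. a i * exp (- real i * x))" for x
      unfolding p by (simp flip: exp_of_nat_mult)
    have 2: "integrable \<mu> (\<lambda>x. exp (- real i * x))" "integrable \<nu> (\<lambda>x. exp (- real i * x))" for i
      by (rule bound_int[where B=1]; simp)+
    show ?thesis unfolding 1 using 2 eq0 by (simp add: Bochner_Integration.integral_sum)
  qed
  have eqc: "(\<integral>x. f (exp (- x)) \<partial>\<mu>) = (\<integral>x. f (exp (- x)) \<partial>\<nu>)"
    if f: "continuous_on UNIV f" for f :: "real \<Rightarrow> real"
  proof -
    have [measurable]: "f \<in> borel_measurable borel" using f by (rule borel_measurable_continuous_onI)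
    have "compact (f ` {0..1})"
      using f by (intro compact_continuous_image) (auto intro: continuous_on_subset)
    then obtain B where B: "\<And>u. 0 \<le> u \<Longrightarrow> u \<le> 1 \<Longrightarrow> \<bar>f u\<bar> \<le> B"
      by (fastforce dest!: compact_imp_bounded simp: bounded_iff)
    have If: "integrable \<mu> (\<lambda>x. f (exp (- x)))" "integrable \<nu> (\<lambda>x. f (exp (- x)))"
      by (rule bound_int[where B=B]; use B in simp)+
    let ?C = "measure \<mu> UNIV + measure \<nu> UNIV"
    have "\<bar>(\<integral>x. f (exp (- x)) \<partial>\<mu>) - (\<integral>x. f (exp (- x)) \<partial>\<nu>)\<bar> \<le> 0 + e" if "e > 0" for e
    proof -
      \<comment> \<open>The summand \<open>1\<close> keeps the denominator positive when both
        measures are zero.\<close>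
      define d where "d = e / (?C + 1)"
      have C0: "?C \<ge> 0" by simp
      have d: "d > 0" using that C0 unfolding d_def by (intro divide_pos_pos) linarith+
      obtain p where p: "real_polynomial_function p" and ap: "\<And>u. u \<in> {0..1} \<Longrightarrow> \<bar>f u - p u\<bar> < d"
        using Stone_Weierstrass_real_polynomial_function[of "{0..1::real}" f d] d f
        by (metis compact_Icc continuous_on_subset subset_UNIV)
      have pc: "continuous_on UNIV p"
        using p by (simp add: continuous_on_polymonial_function real_polynomial_function_eq)
      then have [measurable]: "p \<in> borel_measurable borel" by (rule borel_measurable_continuous_onI)
      have Ip: "integrable \<mu> (\<lambda>x. p (exp (- x)))" "integrable \<nu> (\<lambda>x. p (exp (- x)))"
      proof -
        have "\<bar>p (exp (- x))\<bar> \<le> B + d" if "x \<ge> 0" for x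
          using ap[of "exp (-x)"] B[of "exp (-x)"] that by simp
        then show "integrable \<mu> (\<lambda>x. p (exp (- x)))" "integrable \<nu> (\<lambda>x. p (exp (- x)))"
          by (intro bound_int[where B="B+d"]; simp)+
      qed
      have bd: "\<bar>(\<integral>x. f (exp (- x)) \<partial>\<kappa>) - (\<integral>x. p (exp (- x)) \<partial>\<kappa>)\<bar> \<le> d * measure \<kappa> UNIV"
        if k: "finite_measure \<kappa>" "AE x in \<kappa>. 0 \<le> x" "sets \<kappa> = sets borel"
         "integrable \<kappa> (\<lambda>x. p (exp (- x)))" "integrable \<kappa> (\<lambda>x. f (exp (- x)))" for \<kappa> :: "real measure"
      proof -
        interpret k: finite_measure \<kappa> by fact
        have "\<bar>\<integral>x. f (exp (- x)) - p (exp (- x)) \<partial>\<kappa>\<bar> \<le> (\<integral>x. \<bar>f (exp (- x)) - p (exp (- x))\<bar> \<partial>\<kappa>)"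
          by (rule integral_abs_bound)
        also have "\<dots> \<le> (\<integral>x. d \<partial>\<kappa>)"
        proof (rule integral_mono_AE)
          show "AE x in \<kappa>. \<bar>f (exp (- x)) - p (exp (- x))\<bar> \<le> d"
            using k(2) by eventually_elim (use ap in \<open>auto intro!: less_imp_le\<close>)
        qed (use k in auto)
        finally show ?thesis using k sets_eq_imp_space_eq[OF k(3)] by (simp add: mult.commute)
      qed
      have "\<bar>(\<integral>x. f (exp (- x)) \<partial>\<mu>) - (\<integral>x. f (exp (- x)) \<partial>\<nu>)\<bar> \<le> d * measure \<mu> UNIV + d * measure \<nu> UNIV"
        using bd[OF fin(1) nonneg(1) sets(1) Ip(1) If(1)] bd[OF fin(2) nonneg(2) sets(2) Ip(2) If(2)]
          eqp[OF p] by linarith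
      also have "\<dots> = d * ?C" by (simp add: algebra_simps)
      also have "\<dots> \<le> d * (?C + 1)" using d by (simp add: algebra_simps)
      also have "\<dots> = e" using C0 unfolding d_def by (simp add: add_nonneg_eq_0_iff)
      finally show ?thesis by simp
    qed
    then have "\<bar>(\<integral>x. f (exp (- x)) \<partial>\<mu>) - (\<integral>x. f (exp (- x)) \<partial>\<nu>)\<bar> \<le> 0"
      by (rule field_le_epsilon)
    then show ?thesis by simp
  qed
  have tail: "measure \<mu> {a<..} = measure \<nu> {a<..}" for a
  proof -
    \<comment> \<open>Continuous ramps in \<open>u\<close> that vanish for
      \<open>u \<ge> exp (- a)\<close> and tend to \<open>1\<close> below that point, which is where
      \<open>x > a\<close>.\<close>
    define f where "f i u = min 1 (max 0 (real i * (exp (- a) - u)))" for i :: nat and u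
    have lim: "(\<lambda>i. f i (exp (- x))) \<longlonglongrightarrow> indicator {a<..} x" for x
    proof (cases "a < x")
      case True
      have "filterlim (\<lambda>i. real i * (exp (-a) - exp (-x))) at_top sequentially"
        using True by (intro filterlim_at_top_mult_tendsto_pos[where c = "exp (-a) - exp (-x)", OF tendsto_const] filterlim_real_sequentially) auto
      then have "eventually (\<lambda>i. 1 \<le> real i * (exp (-a) - exp (-x))) sequentially"
        by (simp add: filterlim_at_top)
      then have "eventually (\<lambda>i. f i (exp (- x)) = 1) sequentially"
        by eventually_elim (simp add: f_def)
      then show ?thesis using True by (simp add: tendsto_eventually)
    next
      case False
      then have "f i (exp (-x)) = 0" for i by (auto simp: f_def mult_nonneg_nonpos)
      then show ?thesis using False by simp
    qed
    have fm[measurable]: "(\<lambda>x. f i (exp (- x))) \<in> borel_measurable borel" for i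
      unfolding f_def by measurable
    have l: "(\<lambda>i. \<integral>x. f i (exp (- x)) \<partial>\<kappa>) \<longlonglongrightarrow> (\<integral>x. indicator {a<..} x \<partial>\<kappa>)"
      if k: "finite_measure \<kappa>" "sets \<kappa> = sets borel" for \<kappa> :: "real measure"
    proof (rule integral_dominated_convergence[where w="\<lambda>_. 1"])
      note [measurable_cong] = that(2)
      show "indicator {a<..} \<in> borel_measurable \<kappa>"
      "\<And>i. (\<lambda>x. f i (exp (- x))) \<in> borel_measurable \<kappa>" by measurable
      show "integrable \<kappa> (\<lambda>_. 1::real)" using that(1) by (simp add: finite_measure.integrable_const)
    qed (use lim in \<open>auto simp: f_def\<close>)
    have "(\<lambda>i. \<integral>x. f i (exp (- x)) \<partial>\<mu>) = (\<lambda>i. \<integral>x. f i (exp (- x)) \<partial>\<nu>)"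
      by (intro ext eqc) (auto simp: f_def intro!: continuous_intros)
    with l[OF fin(1) sets(1)] l[OF fin(2) sets(2)]
    have "(\<integral>x. indicator {a<..} x \<partial>\<mu>) = (\<integral>x. indicator {a<..} x \<partial>\<nu> :: real)"
      by (metis LIMSEQ_unique)
    then show ?thesis using sets_eq_imp_space_eq[OF sets(1)] sets_eq_imp_space_eq[OF sets(2)] by simp
  qed
  show ?thesis
    using sets tail by (intro measure_eqI_lessThan) (auto simp: m.emeasure_eq_measure n.emeasure_eq_measure)
qed

section \<open>The past of a process\<close>

text \<open>The \<sigma>-algebra \<open>process_sigma\<close> packaged as a measure space, so that
  measurability of functions with respect to it can be expressed.\<close>

definition process_algebra ::
  "'a measure \<Rightarrow> real set \<Rightarrow> (real \<Rightarrow> 'a \<Rightarrow> 'b::topological_space) \<Rightarrow> 'a measure" where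
  "process_algebra M T Z =
     sigma (space M) {Z t -` B \<inter> space M | t B. t \<in> T \<and> B \<in> sets borel}"

lemma space_process_algebra [simp]: "space (process_algebra M T Z) = space M"
  by (simp add: process_algebra_def space_measure_of_conv)

lemma sets_process_algebra: "sets (process_algebra M T Z) = process_sigma M T Z"
  unfolding process_algebra_def process_sigma_def by (rule sets_measure_of) auto

lemma measurable_process_algebra:
  assumes "t \<in> T" shows "Z t \<in> borel_measurable (process_algebra M T Z)"
proof (rule measurableI)
  fix B :: "'b set" assume "B \<in> sets borel"
  then show "Z t -` B \<inter> space (process_algebra M T Z) \<in> sets (process_algebra M T Z)"
    using assms unfolding sets_process_algebra process_sigma_def by auto
qed simp

lemma process_sigma_least:
  assumes "space N = space M" "\<And>t. t \<in> T \<Longrightarrow> Z t \<in> borel_measurable N"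
  shows "process_sigma M T Z \<subseteq> sets N"
proof -
  have "{Z t -` B \<inter> space M | t B. t \<in> T \<and> B \<in> sets borel} \<subseteq> sets N"
    using assms by (auto simp flip: assms(1) intro: measurable_sets)
  then show ?thesis unfolding process_sigma_def by (simp flip: assms(1) add: sets.sigma_sets_subset)
qed

lemma process_sigma_mono: "S \<subseteq> T \<Longrightarrow> process_sigma M S Z \<subseteq> process_sigma M T Z"
  unfolding process_sigma_def by (intro sigma_sets_mono') auto

text \<open>An intersection-stable generator of \<open>process_sigma\<close>. The sets
  \<open>A r\<close> are Borel for every \<open>r\<close>, also outside \<open>J\<close>, so that
  two index sets merge by taking \<open>UNIV\<close> where only one of them constrains.\<close>

definition cylinders :: "'a measure \<Rightarrow> real set \<Rightarrow> (real \<Rightarrow> 'a \<Rightarrow> 'b::topological_space) \<Rightarrow> 'a set set" where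
  "cylinders M T Z =
     {{\<omega> \<in> space M. \<forall>r\<in>J. Z r \<omega> \<in> A r} | J A. finite J \<and> J \<subseteq> T \<and> (\<forall>r. A r \<in> sets borel)}"

lemma Int_stable_cylinders: "Int_stable (cylinders M T Z)"
proof (rule Int_stableI)
  fix a b assume "a \<in> cylinders M T Z" "b \<in> cylinders M T Z"
  then obtain J1 A1 J2 A2 where
    a: "a = {\<omega> \<in> space M. \<forall>r\<in>J1. Z r \<omega> \<in> A1 r}" "finite J1" "J1 \<subseteq> T" "\<forall>r. A1 r \<in> sets borel" and
    b: "b = {\<omega> \<in> space M. \<forall>r\<in>J2. Z r \<omega> \<in> A2 r}" "finite J2" "J2 \<subseteq> T" "\<forall>r. A2 r \<in> sets borel"
    unfolding cylinders_def by blast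
  show "a \<inter> b \<in> cylinders M T Z"
    unfolding cylinders_def using a b
    by (intro CollectI exI[of _ "J1 \<union> J2"]
        exI[of _ "\<lambda>r. (if r \<in> J1 then A1 r else UNIV) \<inter> (if r \<in> J2 then A2 r else UNIV)"]) auto
qed

lemma process_sigma_eq_cylinders: "process_sigma M T Z = sigma_sets (space M) (cylinders M T Z)"
proof
  have "{Z t -` B \<inter> space M | t B. t \<in> T \<and> B \<in> sets borel} \<subseteq> cylinders M T Z"
  proof clarify
    fix t and B :: "'b set" assume "t \<in> T" "B \<in> sets borel"
    then show "Z t -` B \<inter> space M \<in> cylinders M T Z"
      unfolding cylinders_def by (intro CollectI exI[of _ "{t}"] exI[of _ "\<lambda>_. B"]) auto
  qed
  then show "process_sigma M T Z \<subseteq> sigma_sets (space M) (cylinders M T Z)"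
    unfolding process_sigma_def by (rule sigma_sets_mono')
  have "cylinders M T Z \<subseteq> sets (process_algebra M T Z)"
  proof
    fix a assume "a \<in> cylinders M T Z"
    then obtain J A where a: "a = {\<omega> \<in> space M. \<forall>r\<in>J. Z r \<omega> \<in> A r}" "finite J" "J \<subseteq> T" "\<forall>r. A r \<in> sets borel"
      unfolding cylinders_def by blast
    have "{\<omega> \<in> space (process_algebra M T Z). \<forall>r\<in>J. Z r \<omega> \<in> A r} \<in> sets (process_algebra M T Z)"
    proof (rule sets.sets_Collect_finite_All)
      fix r assume "r \<in> J"
      then have "Z r \<in> borel_measurable (process_algebra M T Z)"
        using a(3) by (intro measurable_process_algebra) auto
      from measurable_sets[OF this] a(4)
      show "{\<omega> \<in> space (process_algebra M T Z). Z r \<omega> \<in> A r} \<in> sets (process_algebra M T Z)"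
        by (auto simp: vimage_def Int_def conj_commute)
    qed fact
    then show "a \<in> sets (process_algebra M T Z)" using a(1) by simp
  qed
  then show "sigma_sets (space M) (cylinders M T Z) \<subseteq> process_sigma M T Z"
    using sets.sigma_sets_subset[of _ "process_algebra M T Z"] by (simp add: sets_process_algebra)
qed

lemma rv_sigma_eq_vimage_algebra: "rv_sigma M Z = sets (vimage_algebra (space M) Z borel)"
  by (auto simp: rv_sigma_def sets_vimage_algebra2)

text \<open>Besides real variables, this is applied to the identity map into \<open>F\<close> and
  into \<open>G\<close>, which turns independence of \<sigma>-algebras into a product law on
  pairs.\<close>

lemma (in prob_space) indep_var_of_indep_set:
  assumes ind: "indep_set (sets F) (sets G)" and sp: "space F = space M" "space G = space M"
    and H: "H \<in> measurable F S" and K: "K \<in> measurable G T"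
  shows "indep_var S H T K"
proof -
  have F: "sets F \<subseteq> events" and G: "sets G \<subseteq> events"
    and prod: "\<And>a b. a \<in> sets F \<Longrightarrow> b \<in> sets G \<Longrightarrow> prob (a \<inter> b) = prob a * prob b"
    using ind by (auto simp: indep_sets2_eq)
  have "random_variable S H" "random_variable T K"
    using measurable_from_subalg[of M F H S] measurable_from_subalg[of M G K T] F G sp H K
    by (auto simp: subalgebra_def)
  moreover have H': "sigma_sets (space M) {H -` A \<inter> space M | A. A \<in> sets S} \<subseteq> sets F"
    using measurable_sets[OF H] unfolding sp(1)[symmetric] by (intro sets.sigma_sets_subset) auto
  moreover have K': "sigma_sets (space M) {K -` A \<inter> space M | A. A \<in> sets T} \<subseteq> sets G"
    using measurable_sets[OF K] unfolding sp(2)[symmetric] by (intro sets.sigma_sets_subset) auto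
  ultimately show ?thesis
    unfolding indep_var_eq indep_sets2_eq
    by (intro conjI ballI prod subset_trans[OF H' F] subset_trans[OF K' G]) (simp_all add: subsetD[OF H'] subsetD[OF K'])
qed

section \<open>Independence of later increments from the past\<close>

context levy_process begin

lemma process_sigma_le_events: "T \<subseteq> {0..} \<Longrightarrow> process_sigma M T X \<subseteq> events"
  by (rule process_sigma_least) (auto intro: rv)

text \<open>The cylinder event is almost surely an event about finitely many increments up to time \<open>s\<close>.\<close>

lemma indep_cylinders_increment:
  assumes st: "0 \<le> s" "s \<le> t" and J: "finite J" "J \<subseteq> {0..s}"
    and A: "\<And>r. A r \<in> sets borel" and C: "C \<in> sets borel"
  shows "prob ({\<omega> \<in> space M. \<forall>r\<in>J. X r \<omega> \<in> A r} \<inter> {\<omega> \<in> space M. X t \<omega> - X s \<omega> \<in> C})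
    = prob {\<omega> \<in> space M. \<forall>r\<in>J. X r \<omega> \<in> A r} * prob {\<omega> \<in> space M. X t \<omega> - X s \<omega> \<in> C}"
proof -
  \<comment> \<open>Starting at \<open>0\<close> and ending with \<open>s, t\<close> makes every
    \<open>X r - X 0\<close> a partial sum of the increments before index \<open>n\<close>, and
    \<open>X t - X s\<close> the increment with index \<open>n\<close>. Repeated times are harmless
    because increments over empty intervals are allowed.\<close>
  define l where "l = 0 # sorted_list_of_set J @ [s, t]"
  define n where "n = card J + 1"
  have len: "length l = n + 2" using J by (simp add: l_def n_def)
  have sorted: "sorted l" using st J by (auto simp: l_def sorted_append)
  \<comment> \<open>The \<open>min\<close> only makes \<open>u\<close> total; beyond the last time
    it is constant.\<close>
  define u where "u i = l ! min i (Suc n)" for i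
  define D where "D i \<omega> = X (u (Suc i)) \<omega> - X (u i) \<omega>" for i \<omega>
  have u: "u 0 = 0" "u n = s" "u (Suc n) = t"
    using J by (auto simp: u_def l_def n_def nth_append)
  have u_nonneg: "0 \<le> u i" for i
  proof -
    have "u i \<in> set l" unfolding u_def using len by (intro nth_mem) auto
    then show ?thesis using J st by (auto simp: l_def)
  qed
  have ind: "indep_vars (\<lambda>_. borel) D {..<Suc n}"
    unfolding D_def using sorted len u(1)
    by (intro indep_increments) (auto simp: u_def intro!: sorted_nth_mono)
  have Dm: "random_variable borel (D i)" for i
    unfolding D_def using u_nonneg by (intro borel_measurable_diff rv)
  have tele: "(\<Sum>j<i. D j \<omega>) = X (u i) \<omega> - X 0 \<omega>" for i \<omega>
    by (induction i) (auto simp: D_def u)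
  have "\<exists>i\<le>n. u i = r" if r: "r \<in> J" for r
  proof -
    have "r \<in> set (sorted_list_of_set J)" using r J by simp
    then obtain i where i: "i < card J" "sorted_list_of_set J ! i = r"
      using J unfolding in_set_conv_nth by auto
    then show ?thesis using J by (intro exI[of _ "Suc i"]) (auto simp: u_def l_def n_def nth_append)
  qed
  then obtain idx where idx: "\<And>r. r \<in> J \<Longrightarrow> idx r \<le> n \<and> u (idx r) = r" by metis
  let ?P = "PiM {..<n} (\<lambda>_. borel :: real measure)" and ?Q = "PiM {n} (\<lambda>_. borel :: real measure)"
  have iv: "indep_var ?P (\<lambda>\<omega>. restrict (\<lambda>i. D i \<omega>) {..<n}) ?Q (\<lambda>\<omega>. restrict (\<lambda>i. D i \<omega>) {n})"
    by (rule indep_var_restrict[OF ind]) auto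
  let ?Xa = "{v \<in> space ?P. \<forall>r\<in>J. (\<Sum>j<idx r. v j) \<in> A r}" and ?Xb = "{v \<in> space ?Q. v n \<in> C}"
  have Xa: "?Xa \<in> sets ?P"
  proof (rule sets.sets_Collect_finite_All[OF _ J(1)])
    fix r assume r: "r \<in> J"
    have "(\<lambda>v. \<Sum>j<idx r. v j) \<in> borel_measurable ?P"
      using idx[OF r] by (intro borel_measurable_sum measurable_component_singleton) auto
    from measurable_sets[OF this A[of r]] show "{v \<in> space ?P. (\<Sum>j<idx r. v j) \<in> A r} \<in> sets ?P"
      by (auto simp: vimage_def Int_def conj_commute)
  qed
  have Xb: "?Xb \<in> sets ?Q"
    using measurable_sets[OF measurable_component_singleton[of n "{n}" "\<lambda>_. borel"] C]
    by (auto simp: vimage_def Int_def conj_commute)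
  \<comment> \<open>The initial value is subtracted because independence concerns increments; as
    \<open>X 0 = 0\<close> almost surely, the intended events replace these at the end.\<close>
  let ?E1 = "{\<omega> \<in> space M. \<forall>r\<in>J. X r \<omega> - X 0 \<omega> \<in> A r}" and ?E2 = "{\<omega> \<in> space M. X t \<omega> - X s \<omega> \<in> C}"
  have sum_eq: "(\<Sum>j<idx r. restrict (\<lambda>i. D i \<omega>) {..<n} j) = X r \<omega> - X 0 \<omega>" if "r \<in> J" for r \<omega>
  proof -
    have "(\<Sum>j<idx r. restrict (\<lambda>i. D i \<omega>) {..<n} j) = (\<Sum>j<idx r. D j \<omega>)"
      using idx[OF that] by (intro sum.cong) auto
    then show ?thesis using idx[OF that] by (simp add: tele)
  qed
  have Dn: "D n \<omega> = X t \<omega> - X s \<omega>" for \<omega> by (simp add: D_def u)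
  have E1: "(\<lambda>\<omega>. restrict (\<lambda>i. D i \<omega>) {..<n}) -` ?Xa \<inter> space M = ?E1"
    using sum_eq by (auto simp: space_PiM simp del: restrict_apply)
  have E2: "(\<lambda>\<omega>. restrict (\<lambda>i. D i \<omega>) {n}) -` ?Xb \<inter> space M = ?E2"
    by (auto simp: Dn space_PiM)
  have E12: "(\<lambda>\<omega>. (restrict (\<lambda>i. D i \<omega>) {..<n}, restrict (\<lambda>i. D i \<omega>) {n})) -` (?Xa \<times> ?Xb) \<inter> space M = ?E1 \<inter> ?E2"
    using E1 E2 by blast
  have prod: "prob (?E1 \<inter> ?E2) = prob ?E1 * prob ?E2"
    using indep_varD[OF iv Xa Xb] unfolding E1 E2 E12 .
  have [measurable]: "X r \<in> borel_measurable M" if "r \<in> J" for r using J that by (intro rv) auto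
  have [measurable]: "X s \<in> borel_measurable M" "X t \<in> borel_measurable M" "X 0 \<in> borel_measurable M"
    using st by (auto intro: rv)
  note [measurable] = A C
  let ?F = "{\<omega> \<in> space M. \<forall>r\<in>J. X r \<omega> \<in> A r}"
  have sE1: "?E1 \<in> events" using J by (intro sets.sets_Collect_finite_All) auto
  have sF: "?F \<in> events" using J by (intro sets.sets_Collect_finite_All) auto
  have sE2: "?E2 \<in> events" by measurable
  have "prob ?F = prob ?E1"
    by (rule measure_eq_AE[OF _ sF sE1]) (use start in \<open>eventually_elim, auto\<close>)
  moreover have "prob (?F \<inter> ?E2) = prob (?E1 \<inter> ?E2)"
    by (rule measure_eq_AE[OF _ sets.Int[OF sF sE2] sets.Int[OF sE1 sE2]])
      (use start in \<open>eventually_elim, auto\<close>)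
  ultimately show ?thesis using prod by simp
qed

text \<open>A \<pi>-\<lambda> argument carries the product formula from cylinders to the
  \<sigma>-algebra they generate.\<close>

lemma indep_past_increment:
  assumes st: "0 \<le> s" "s \<le> t"
  shows "indep_set (process_sigma M {0..s} X) (rv_sigma M (\<lambda>\<omega>. X t \<omega> - X s \<omega>))"
proof -
  let ?R = "rv_sigma M (\<lambda>\<omega>. X t \<omega> - X s \<omega>)"
  have [measurable]: "X s \<in> borel_measurable M" "X t \<in> borel_measurable M"
    using st by (auto intro: rv)
  have "indep_set (cylinders M {0..s} X) ?R"
    unfolding indep_sets2_eq
  proof (intro conjI ballI)
    have "cylinders M {0..s} X \<subseteq> process_sigma M {0..s} X"
      unfolding process_sigma_eq_cylinders by (rule sigma_sets_superset_generator)
    then show "cylinders M {0..s} X \<subseteq> events" using process_sigma_le_events[of "{0..s}"] by auto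
    show "?R \<subseteq> events" unfolding rv_sigma_def by (auto intro!: measurable_sets)
    fix a b assume "a \<in> cylinders M {0..s} X" "b \<in> ?R"
    then obtain J A C where *: "a = {\<omega> \<in> space M. \<forall>r\<in>J. X r \<omega> \<in> A r}" "finite J" "J \<subseteq> {0..s}" "\<forall>r. A r \<in> sets borel"
      and b: "b = (\<lambda>\<omega>. X t \<omega> - X s \<omega>) -` C \<inter> space M" "C \<in> sets borel"
      unfolding cylinders_def rv_sigma_def by blast
    have b': "b = {\<omega> \<in> space M. X t \<omega> - X s \<omega> \<in> C}" using b by auto
    show "prob (a \<inter> b) = prob a * prob b"
      unfolding *(1) b' using indep_cylinders_increment[OF st *(2,3)] * b by blast
  qed
  then have "indep_set (sigma_sets (space M) (cylinders M {0..s} X)) (sigma_sets (space M) ?R)"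
    by (rule indep_set_sigma_sets[OF _ Int_stable_cylinders])
       (simp add: rv_sigma_eq_vimage_algebra Int_stable_def sets.Int)
  then show ?thesis
    unfolding process_sigma_eq_cylinders[symmetric] indep_sets2_eq
    using sigma_sets_superset_generator[of ?R "space M"] by blast
qed

end


section \<open>First passage times\<close>

lemma first_passage_less_iff: "first_passage X x \<omega> < a \<longleftrightarrow> (\<exists>t>0. ereal t < a \<and> x < X t \<omega>)"
  unfolding first_passage_def INF_less_iff by auto

lemma first_passage_ge_iff: "a \<le> first_passage X x \<omega> \<longleftrightarrow> (\<forall>t>0. ereal t < a \<longrightarrow> X t \<omega> \<le> x)"
  using first_passage_less_iff[of X x \<omega> a] by (auto simp: not_less[symmetric])

lemma first_passage_nonneg: "0 \<le> first_passage X x \<omega>"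
  by (auto simp: first_passage_ge_iff zero_ereal_def)

lemma first_passage_mono: "x \<le> y \<Longrightarrow> first_passage X x \<omega> \<le> first_passage X y \<omega>"
  unfolding first_passage_def by (intro INF_superset_mono) auto

text \<open>This is right continuity of the passage time in its level, written as a union over
  rational levels: a path point strictly above \<open>x\<close> leaves room for a rational level
  below it. The countable form yields joint measurability directly.\<close>

lemma first_passage_right_continuous:
  "first_passage X x \<omega> < a \<longleftrightarrow> (\<exists>r\<in>\<rat>. x < r \<and> first_passage X r \<omega> < a)"
proof
  assume "first_passage X x \<omega> < a"
  then obtain t where t: "t > 0" "ereal t < a" "x < X t \<omega>" by (auto simp: first_passage_less_iff)
  obtain r where "r \<in> \<rat>" "x < r" "r < X t \<omega>" using Rats_dense_in_real[OF t(3)] by auto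
  with t show "\<exists>r\<in>\<rat>. x < r \<and> first_passage X r \<omega> < a"
    by (auto simp: first_passage_less_iff)
next
  assume "\<exists>r\<in>\<rat>. x < r \<and> first_passage X r \<omega> < a"
  then show "first_passage X x \<omega> < a"
    using first_passage_mono[of x _ X \<omega>] by (auto intro: le_less_trans less_imp_le)
qed

text \<open>Measurability is asked only for levels above some value of \<open>h\<close>. For
  \<open>h = max 0\<close> these are positive, so the \<sigma>-algebra generated by
  \<open>\<tau>\<close> at nonnegative levels suffices.\<close>

lemma measurable_first_passage_joint:
  assumes h: "h \<in> borel_measurable borel"
    and fp: "\<And>x r. h x < r \<Longrightarrow> first_passage X r \<in> borel_measurable N"
  shows "(\<lambda>(x, \<omega>). first_passage X (h x) \<omega>) \<in> borel_measurable (borel \<Otimes>\<^sub>M N)"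
proof (rule borel_measurableI_less)
  fix a
  let ?Q = "{r \<in> \<rat>. \<exists>x. h x < r}"
  have "{z \<in> space (borel \<Otimes>\<^sub>M N). (case z of (x, \<omega>) \<Rightarrow> first_passage X (h x) \<omega>) < a}
     = (\<Union>r\<in>?Q. {x. h x < r} \<times> {\<omega> \<in> space N. first_passage X r \<omega> < a})"
    by (auto simp: space_pair_measure) (metis first_passage_right_continuous)+
  also have "\<dots> \<in> sets (borel \<Otimes>\<^sub>M N)"
  proof (intro sets.countable_UN' image_subsetI pair_measureI)
    show "countable ?Q" using countable_rat by (rule countable_subset[rotated]) auto
    fix r assume "r \<in> ?Q"
    then have [measurable]: "first_passage X r \<in> borel_measurable N" using fp by auto
    show "{\<omega> \<in> space N. first_passage X r \<omega> < a} \<in> sets N" by measurable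
    show "{x. h x < r} \<in> sets borel" using h by measurable
  qed
  finally show "{z \<in> space (borel \<Otimes>\<^sub>M N). (case z of (x, \<omega>) \<Rightarrow> first_passage X (h x) \<omega>) < a} \<in> sets (borel \<Otimes>\<^sub>M N)" .
qed

section \<open>Measurability of passage times and the events prior to them\<close>

context levy_process begin

abbreviation "\<tau> \<equiv> first_passage X"

lemma right_continuousD:
  assumes "\<omega> \<in> space M" "0 \<le> t"
  shows "((\<lambda>s. X s \<omega>) \<longlongrightarrow> X t \<omega>) (at_right t)"
  using cadlag_paths[OF assms(1)] assms(2) by (auto simp: cadlag_def continuous_within)

text \<open>By right continuity a path that exceeds \<open>x\<close> at time \<open>t\<close> also
  does so at rational times just after \<open>t\<close>, some of which still lie before
  \<open>a\<close>.\<close>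

lemma first_passage_less_Rats:
  assumes \<omega>: "\<omega> \<in> space M"
  shows "\<tau> x \<omega> < a \<longleftrightarrow> (\<exists>t\<in>\<rat>. 0 < t \<and> ereal t < a \<and> x < X t \<omega>)"
proof
  assume "\<tau> x \<omega> < a"
  then obtain t where t: "t > 0" "ereal t < a" "x < X t \<omega>" by (auto simp: first_passage_less_iff)
  have "eventually (\<lambda>s. x < X s \<omega>) (at_right t)"
    using right_continuousD[OF \<omega>, of t] t by (auto dest: order_tendstoD)
  then obtain b where b: "b > t" "\<And>s. t < s \<Longrightarrow> s < b \<Longrightarrow> x < X s \<omega>"
    by (auto simp: eventually_at_right_field)
  obtain b' where b': "t < b'" "ereal b' \<le> a"
    using t(2) by (cases a) (auto intro: less_add_one)
  obtain s where "s \<in> \<rat>" "t < s" "s < min b b'"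
    using Rats_dense_in_real[of t "min b b'"] b(1) b'(1) by auto
  then show "\<exists>t\<in>\<rat>. 0 < t \<and> ereal t < a \<and> x < X t \<omega>"
    using b(2)[of s] t(1) less_le_trans[of "ereal s" "ereal b'" a] b'(2) by (intro bexI[of _ s]) auto
qed (auto simp: first_passage_less_iff)

text \<open>Strictness matters: rational times before \<open>t\<close> decide the event, whereas a
  passage exactly at \<open>t\<close> may show only after \<open>t\<close>.\<close>

lemma first_passage_less_past:
  assumes "0 \<le> t"
  shows "{\<omega> \<in> space M. \<tau> x \<omega> < ereal t} \<in> process_sigma M {0..t} X"
proof -
  let ?N = "process_algebra M {0..t} X"
  have "{\<omega> \<in> space M. \<tau> x \<omega> < ereal t} = (\<Union>s\<in>{s \<in> \<rat>. 0 < s \<and> s < t}. {\<omega> \<in> space ?N. x < X s \<omega>})"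
    by (auto simp: first_passage_less_Rats)
  also have "\<dots> \<in> sets ?N"
  proof (intro sets.countable_UN' image_subsetI)
    show "countable {s \<in> \<rat>. 0 < s \<and> s < t}" using countable_rat by (rule countable_subset[rotated]) auto
    fix s assume "s \<in> {s \<in> \<rat>. 0 < s \<and> s < t}"
    then have [measurable]: "X s \<in> borel_measurable ?N"
      by (intro measurable_process_algebra) auto
    show "{\<omega> \<in> space ?N. x < X s \<omega>} \<in> sets ?N" by measurable
  qed
  finally show ?thesis by (simp add: sets_process_algebra)
qed

lemma measurable_first_passage [measurable]: "\<tau> x \<in> borel_measurable M"
proof (rule borel_measurableI_less)
  have fin: "{\<omega> \<in> space M. \<tau> x \<omega> < ereal t} \<in> events" for t
  proof (cases "t \<ge> 0")
    case True
    then show ?thesis using first_passage_less_past[OF True] process_sigma_le_events[of "{0..t}"] by auto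
  next
    case False
    have "\<not> \<tau> x \<omega> < ereal t" for \<omega>
      using first_passage_nonneg[of X x \<omega>] False by (metis ereal_less_eq(5) not_less order_trans less_imp_le)
    then show ?thesis by simp
  qed
  fix a
  show "{\<omega> \<in> space M. \<tau> x \<omega> < a} \<in> events"
  proof (cases a)
    case (real r)
    then show ?thesis using fin by simp
  next
    case PInf
    have "{\<omega> \<in> space M. \<tau> x \<omega> < \<infinity>} = (\<Union>n::nat. {\<omega> \<in> space M. \<tau> x \<omega> < ereal (real n)})"
    proof -
      have "\<tau> x \<omega> < \<infinity> \<longleftrightarrow> (\<exists>n::nat. \<tau> x \<omega> < ereal (real n))" for \<omega>
        using less_PInf_Ex_of_nat[of "\<tau> x \<omega>"] by (simp add: less_top[symmetric])
      then show ?thesis by blast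
    qed
    also have "\<dots> \<in> events" using fin by (intro sets.countable_UN) auto
    finally show ?thesis using PInf by simp
  qed simp
qed

text \<open>The events prior to \<open>\<tau> x\<close>, i.e. the \<open>\<sigma>\<close>-algebra \<open>F\<close> at \<open>\<tau> x+\<close>.\<close>

definition passage_sigma :: "real \<Rightarrow> 'a set set" where
  "passage_sigma x = {A \<in> events. \<forall>t\<ge>0. A \<inter> {\<omega> \<in> space M. \<tau> x \<omega> < ereal t} \<in> process_sigma M {0..t} X}"

text \<open>Since \<open>\<tau> x \<le> \<tau> y\<close>, intersecting with
  \<open>\<tau> y < t\<close> can pass through the intersection with
  \<open>\<tau> x < t\<close>.\<close>

lemma passage_sigma_mono:
  assumes "x \<le> y" shows "passage_sigma x \<subseteq> passage_sigma y"
proof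
  fix A assume A: "A \<in> passage_sigma x"
  have "A \<inter> {\<omega> \<in> space M. \<tau> y \<omega> < ereal t} \<in> sets (process_algebra M {0..t} X)" if "t \<ge> 0" for t
  proof -
    have "A \<inter> {\<omega> \<in> space M. \<tau> y \<omega> < ereal t} =
       (A \<inter> {\<omega> \<in> space M. \<tau> x \<omega> < ereal t}) \<inter> {\<omega> \<in> space M. \<tau> y \<omega> < ereal t}"
      using first_passage_mono[OF assms, of X] by (auto intro: le_less_trans)
    moreover have "A \<inter> {\<omega> \<in> space M. \<tau> x \<omega> < ereal t} \<in> sets (process_algebra M {0..t} X)"
      using A that by (auto simp: passage_sigma_def sets_process_algebra)
    ultimately show ?thesis
      using first_passage_less_past[OF that, of y] sets.Int[of _ "process_algebra M {0..t} X"]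
      by (simp add: sets_process_algebra)
  qed
  then show "A \<in> passage_sigma y" using A by (auto simp: passage_sigma_def sets_process_algebra)
qed

lemma sigma_algebra_passage_sigma: "sigma_algebra (space M) (passage_sigma x)"
  unfolding sigma_algebra_iff2
proof (intro conjI ballI allI impI)
  note [simp] = sets_process_algebra[symmetric]
  have [simp]: "{\<omega> \<in> space M. \<tau> x \<omega> < ereal t} \<in> sets (process_algebra M {0..t} X)" if "t \<ge> 0" for t
    using first_passage_less_past[OF that] by simp
  show "passage_sigma x \<subseteq> Pow (space M)"
    using sets.sets_into_space by (auto simp: passage_sigma_def)
  show "{} \<in> passage_sigma x" by (simp add: passage_sigma_def)
  fix A assume A: "A \<in> passage_sigma x"
  have "(space M - A) \<inter> {\<omega> \<in> space M. \<tau> x \<omega> < ereal t} =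
    {\<omega> \<in> space M. \<tau> x \<omega> < ereal t} - A \<inter> {\<omega> \<in> space M. \<tau> x \<omega> < ereal t}" for t by auto
  then show "space M - A \<in> passage_sigma x"
    using A by (auto simp: passage_sigma_def intro!: sets.Diff)
next
  note [simp] = sets_process_algebra[symmetric]
  fix A :: "nat \<Rightarrow> 'a set" assume A: "range A \<subseteq> passage_sigma x"
  have "(\<Union>i. A i) \<inter> {\<omega> \<in> space M. \<tau> x \<omega> < ereal t} = (\<Union>i. A i \<inter> {\<omega> \<in> space M. \<tau> x \<omega> < ereal t})" for t by auto
  then show "(\<Union>i. A i) \<in> passage_sigma x"
    using A by (auto simp: passage_sigma_def simp del: UN_extend_simps UN_simps intro!: sets.countable_UN)
qed

definition passage_algebra :: "real \<Rightarrow> 'a measure" where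
  "passage_algebra x = sigma (space M) (passage_sigma x)"

lemma space_passage_algebra [simp]: "space (passage_algebra x) = space M"
  by (simp add: passage_algebra_def space_measure_of_conv)

lemma sets_passage_algebra: "sets (passage_algebra x) = passage_sigma x"
  unfolding passage_algebra_def
  by (intro sigma_algebra.sets_measure_of_eq sigma_algebra_passage_sigma)

lemma measurable_first_passage_passage_algebra:
  assumes "x \<le> y" shows "\<tau> x \<in> borel_measurable (passage_algebra y)"
proof (rule borel_measurableI_less)
  fix a
  have "{\<omega> \<in> space M. \<tau> x \<omega> < a} \<in> passage_sigma x"
    unfolding passage_sigma_def
  proof (intro CollectI conjI allI impI)
    show "{\<omega> \<in> space M. \<tau> x \<omega> < a} \<in> events" by measurable
    fix t :: real assume t: "t \<ge> 0"
    show "{\<omega> \<in> space M. \<tau> x \<omega> < a} \<inter> {\<omega> \<in> space M. \<tau> x \<omega> < ereal t} \<in> process_sigma M {0..t} X"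
    proof (cases "a \<le> 0")
      case True
      then have "\<not> \<tau> x \<omega> < a" for \<omega>
        using first_passage_nonneg[of X x \<omega>] by (auto simp: not_less intro: order_trans)
      then show ?thesis by (simp add: sets_process_algebra[symmetric])
    next
      case False
      \<comment> \<open>The intersection of the two events is \<open>\<tau> x < min a t\<close>, and
        \<open>s\<close> is that minimum as a real number; \<open>a\<close> may be infinite.\<close>
      define s where "s = (if a \<le> ereal t then real_of_ereal a else t)"
      have s: "0 \<le> s" "s \<le> t" "min a (ereal t) = ereal s"
        using False t by (cases a; auto simp: s_def min_def)+
      have "{\<omega> \<in> space M. \<tau> x \<omega> < a} \<inter> {\<omega> \<in> space M. \<tau> x \<omega> < ereal t} = {\<omega> \<in> space M. \<tau> x \<omega> < ereal s}"
        by (auto simp flip: s(3))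
      then show ?thesis
        using first_passage_less_past[OF s(1), of x] process_sigma_mono[of "{0..s}" "{0..t}" M X] s(2)
        by (simp add: subset_iff)
    qed
  qed
  then show "{\<omega> \<in> space (passage_algebra y). \<tau> x \<omega> < a} \<in> sets (passage_algebra y)"
    using passage_sigma_mono[OF assms] by (auto simp: sets_passage_algebra)
qed

end

text \<open>An infinite passage time becomes \<open>0\<close>; until finiteness is proved,
  transforms of \<open>passage_time\<close> carry the indicator of a finite passage.\<close>

definition passage_time :: "(real \<Rightarrow> 'a \<Rightarrow> real) \<Rightarrow> real \<Rightarrow> 'a \<Rightarrow> real" where
  "passage_time X x \<omega> = real_of_ereal (first_passage X x \<omega>)"

text \<open>The rate at which the part of the exponential martingale not stopped before time
  \<open>n + 1\<close> vanishes.\<close>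

lemma exp_bound_tendsto_0:
  fixes q :: real assumes "q > 0" shows "(\<lambda>n. exp (a - q * Suc n)) \<longlonglongrightarrow> 0"
proof -
  have "filterlim (\<lambda>n. - a + q * real (Suc n)) at_top sequentially"
    using assms by (intro filterlim_tendsto_add_at_top[OF tendsto_const]
      filterlim_tendsto_pos_mult_at_top[OF tendsto_const] filterlim_compose[OF filterlim_real_sequentially filterlim_Suc]) auto
  then have "filterlim (\<lambda>n. - (- a + q * real (Suc n))) at_bot sequentially"
    by (simp only: filterlim_uminus_at_top)
  from filterlim_compose[OF exp_at_bot this] show ?thesis by simp
qed

lemma (in prob_space) expectation_diff_le:
  fixes f g :: "'a \<Rightarrow> real"
  assumes "integrable M f" "integrable M g" "AE \<omega> in M. \<bar>f \<omega> - g \<omega>\<bar> \<le> C"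
  shows "\<bar>expectation f - expectation g\<bar> \<le> C"
proof -
  have "\<bar>expectation (\<lambda>\<omega>. f \<omega> - g \<omega>)\<bar> \<le> expectation (\<lambda>\<omega>. \<bar>f \<omega> - g \<omega>\<bar>)"
    by (rule integral_abs_bound)
  also have "\<dots> \<le> expectation (\<lambda>_. C)"
    using assms by (intro integral_mono_AE) auto
  finally show ?thesis using assms by (simp add: prob_space)
qed

section \<open>The path at its passage times\<close>

context spectrally_negative_levy_process begin

text \<open>Before \<open>u\<close> the path stays at or below \<open>x\<close>, hence so does its
  left limit, and without an upward jump so does \<open>X u\<close>; for \<open>u = 0\<close> this
  is \<open>X 0 = 0 \<le> x\<close>. Conversely \<open>X u < x\<close> would by right continuity
  persist after \<open>u\<close> and delay the passage.\<close>

lemma AE_X_first_passage: "AE \<omega> in M. \<forall>x\<ge>0. \<forall>u. \<tau> x \<omega> = ereal u \<longrightarrow> X u \<omega> = x"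
  using start no_positive_jumps AE_space
proof eventually_elim
  case (elim \<omega>)
  show ?case
  proof (intro allI impI)
    fix x u :: real assume x: "0 \<le> x" and u: "\<tau> x \<omega> = ereal u"
    have u0: "0 \<le> u" using first_passage_nonneg[of X x \<omega>] u by simp
    have before: "X t \<omega> \<le> x" if "0 < t" "t < u" for t
      using first_passage_ge_iff[of "\<tau> x \<omega>" X x \<omega>] that u by auto
    show "X u \<omega> = x"
    proof (rule antisym)
      show "X u \<omega> \<le> x"
      proof (cases "u = 0")
        case True
        then show ?thesis using elim(1) x by simp
      next
        case False
        with u0 have "0 < u" by simp
        then obtain l where l: "((\<lambda>s. X s \<omega>) \<longlongrightarrow> l) (at_left u)"
          using cadlag_paths[OF elim(3)] by (auto simp: cadlag_def)
        have "eventually (\<lambda>s. s < u \<and> 0 < s) (at_left u)"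
          using \<open>0 < u\<close> by (auto simp: eventually_at_left_field)
        then have "eventually (\<lambda>s. X s \<omega> \<le> x) (at_left u)"
          by eventually_elim (auto intro: before)
        then have "l \<le> x" by (intro tendsto_upperbound[OF l]) auto
        then show ?thesis using elim(2) l \<open>0 < u\<close> by fastforce
      qed
      show "x \<le> X u \<omega>"
      proof (rule ccontr)
        assume "\<not> x \<le> X u \<omega>"
        then have less: "X u \<omega> < x" by simp
        then have "eventually (\<lambda>s. X s \<omega> < x) (at_right u)"
          using right_continuousD[OF elim(3) u0] by (auto dest: order_tendstoD)
        then obtain b where b: "b > u" "\<And>s. u < s \<Longrightarrow> s < b \<Longrightarrow> X s \<omega> < x"
          by (auto simp: eventually_at_right_field)
        have "X t \<omega> \<le> x" if "0 < t" "t < b" for t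
          using that before[of t] less b(2)[of t] by (cases t u rule: linorder_cases) auto
        then have "ereal b \<le> \<tau> x \<omega>" by (auto simp: first_passage_ge_iff)
        then show False using u b(1) by simp
      qed
    qed
  qed
qed

text \<open>Adds to \<open>first_passage_ge_iff\<close> the single time \<open>t = \<tau> x\<close>,
  where the path sits exactly at \<open>x\<close>. The complement of \<open>\<tau> x < t\<close>
  contains this case.\<close>

lemma AE_X_le_before_passage:
  "AE \<omega> in M. \<forall>x\<ge>0. \<forall>t>0. ereal t \<le> \<tau> x \<omega> \<longrightarrow> X t \<omega> \<le> x"
  using AE_X_first_passage
proof eventually_elim
  case (elim \<omega>)
  show ?case
  proof (intro allI impI)
    fix x t :: real assume *: "0 \<le> x" "0 < t" "ereal t \<le> \<tau> x \<omega>"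
    show "X t \<omega> \<le> x"
    proof (cases "ereal t = \<tau> x \<omega>")
      case True
      then show ?thesis using elim *(1) by (metis order_refl)
    next
      case False
      then show ?thesis using * first_passage_ge_iff[of "\<tau> x \<omega>" X x \<omega>] by auto
    qed
  qed
qed

abbreviation "T \<equiv> passage_time X"

lemma measurable_T [measurable]: "T x \<in> borel_measurable M"
  unfolding passage_time_def by measurable

lemma T_nonneg: "0 \<le> T x \<omega>"
  unfolding passage_time_def by (intro real_of_ereal_pos first_passage_nonneg)

lemma measurable_T_passage_algebra: "x \<le> y \<Longrightarrow> T x \<in> borel_measurable (passage_algebra y)"
  unfolding passage_time_def by (intro borel_measurable_real_of_ereal measurable_first_passage_passage_algebra)

section \<open>The exponential martingale and optional stopping\<close>

context
  fixes \<psi> :: "real \<Rightarrow> real"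
  assumes exponent: "has_laplace_exponent M X \<psi>"
begin

lemma exp_moment:
  assumes "0 < t" "0 \<le> \<theta>"
  shows "integrable M (\<lambda>\<omega>. exp (\<theta> * X t \<omega>))" "expectation (\<lambda>\<omega>. exp (\<theta> * X t \<omega>)) = exp (\<psi> \<theta> * t)"
proof -
  show int: "integrable M (\<lambda>\<omega>. exp (\<theta> * X t \<omega>))"
    using exponent assms by (auto simp: has_laplace_exponent_def)
  \<comment> \<open>The logarithm can be inverted only for a positive expectation.\<close>
  have "0 < expectation (\<lambda>\<omega>. exp (\<theta> * X t \<omega>))"
    by (rule expectation_greater[OF int]) simp
  moreover have "\<psi> \<theta> = 1 / t * ln (expectation (\<lambda>\<omega>. exp (\<theta> * X t \<omega>)))"
    using exponent assms by (auto simp: has_laplace_exponent_def)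
  ultimately show "expectation (\<lambda>\<omega>. exp (\<theta> * X t \<omega>)) = exp (\<psi> \<theta> * t)"
    using assms by simp
qed

lemma exp_moment_increment:
  assumes st: "0 \<le> s" "s \<le> t" and \<theta>: "0 \<le> \<theta>"
  shows "integrable M (\<lambda>\<omega>. exp (\<theta> * (X t \<omega> - X s \<omega>)))"
    "expectation (\<lambda>\<omega>. exp (\<theta> * (X t \<omega> - X s \<omega>))) = exp (\<psi> \<theta> * (t - s))"
proof -
  have [measurable]: "X s \<in> borel_measurable M" "X t \<in> borel_measurable M" "X (t - s) \<in> borel_measurable M"
    using st by (auto intro: rv)
  have "integrable M (\<lambda>\<omega>. exp (\<theta> * (X t \<omega> - X s \<omega>))) \<and>
    expectation (\<lambda>\<omega>. exp (\<theta> * (X t \<omega> - X s \<omega>))) = exp (\<psi> \<theta> * (t - s))"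
  proof (cases "s = t")
    case True
    then show ?thesis by (simp add: prob_space)
  next
    case False
    have eq: "distr M borel (\<lambda>\<omega>. X t \<omega> - X s \<omega>) = distr M borel (X (t - s))"
      using stationary_increments[of s "t - s"] st by simp
    have m: "(\<lambda>z. exp (\<theta> * z)) \<in> borel_measurable borel" by measurable
    have "integrable (distr M borel (X (t - s))) (\<lambda>z. exp (\<theta> * z))"
      using exp_moment(1)[of "t - s" \<theta>] False st \<theta> by (simp add: integrable_distr_eq)
    then have 1: "integrable M (\<lambda>\<omega>. exp (\<theta> * (X t \<omega> - X s \<omega>)))"
      unfolding eq[symmetric] by (simp add: integrable_distr_eq)
    have "expectation (\<lambda>\<omega>. exp (\<theta> * (X t \<omega> - X s \<omega>))) = (\<integral>z. exp (\<theta> * z) \<partial>distr M borel (\<lambda>\<omega>. X t \<omega> - X s \<omega>))"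
      by (subst integral_distr) auto
    also have "\<dots> = exp (\<psi> \<theta> * (t - s))"
      unfolding eq using exp_moment(2)[of "t - s" \<theta>] False st \<theta> by (subst integral_distr) auto
    finally show ?thesis using 1 by simp
  qed
  then show "integrable M (\<lambda>\<omega>. exp (\<theta> * (X t \<omega> - X s \<omega>)))"
    "expectation (\<lambda>\<omega>. exp (\<theta> * (X t \<omega> - X s \<omega>))) = exp (\<psi> \<theta> * (t - s))" by auto
qed

text \<open>The martingale property of \<open>exp (\<theta> * X t - \<psi> \<theta> * t)\<close>,
  tested against bounded functions of the past and written with increments, so that it is a product
  formula for independent variables.\<close>

lemma exp_martingale:
  assumes st: "0 \<le> s" "s \<le> t" and \<theta>: "0 \<le> \<theta>"
    and H: "H \<in> borel_measurable (process_algebra M {0..s} X)" and K: "\<And>\<omega>. \<bar>H \<omega>\<bar> \<le> K"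
  shows "integrable M (\<lambda>\<omega>. H \<omega> * exp (\<theta> * (X t \<omega> - X s \<omega>)))"
    "expectation (\<lambda>\<omega>. H \<omega> * exp (\<theta> * (X t \<omega> - X s \<omega>))) = expectation H * exp (\<psi> \<theta> * (t - s))"
proof -
  let ?D = "\<lambda>\<omega>. X t \<omega> - X s \<omega>"
  let ?G = "vimage_algebra (space M) ?D borel"
  have D: "?D \<in> borel_measurable ?G" by (rule measurable_vimage_algebra1) simp
  have "indep_var borel H borel (\<lambda>\<omega>. exp (\<theta> * ?D \<omega>))"
  proof (rule indep_var_of_indep_set[of "process_algebra M {0..s} X" ?G])
    show "indep_set (sets (process_algebra M {0..s} X)) (sets ?G)"
      using indep_past_increment[OF st] by (simp add: sets_process_algebra rv_sigma_eq_vimage_algebra)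
    show "(\<lambda>\<omega>. exp (\<theta> * ?D \<omega>)) \<in> borel_measurable ?G" using D by measurable
  qed (use H in auto)
  moreover have "integrable M H"
  proof (rule integrable_const_bound[where B=K])
    show "H \<in> borel_measurable M"
      using H process_sigma_le_events[of "{0..s}"]
      by (intro measurable_from_subalg[of M "process_algebra M {0..s} X"]) (auto simp: subalgebra_def sets_process_algebra)
  qed (use K in auto)
  ultimately show "integrable M (\<lambda>\<omega>. H \<omega> * exp (\<theta> * (X t \<omega> - X s \<omega>)))"
    "expectation (\<lambda>\<omega>. H \<omega> * exp (\<theta> * (X t \<omega> - X s \<omega>))) = expectation H * exp (\<psi> \<theta> * (t - s))"
    using indep_var_lebesgue_integral[of H "\<lambda>\<omega>. exp (\<theta> * ?D \<omega>)"] indep_var_integrable[of H "\<lambda>\<omega>. exp (\<theta> * ?D \<omega>)"]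
      exp_moment_increment[OF st \<theta>] by simp_all
qed

text \<open>The passage time is replaced by the next point of the grid of mesh
  \<open>1 / (k + 1)\<close>. On the event that this point is \<open>t k j\<close>, the martingale
  is compared between \<open>t k j\<close> and \<open>n\<close>; as \<open>k\<close> grows, right
  continuity and the value \<open>x\<close> at the passage give the formula. An integer
  \<open>n\<close> lies on every grid.\<close>

lemma optional_stopping:
  fixes n :: nat
  assumes \<theta>: "0 \<le> \<theta>" "0 \<le> \<psi> \<theta>" and x: "0 \<le> x" and n: "0 < n" and B: "B \<in> passage_sigma x"
  shows "expectation (\<lambda>\<omega>. indicator (B \<inter> {\<omega> \<in> space M. \<tau> x \<omega> < ereal n}) \<omega> * exp (\<theta> * X n \<omega> - \<psi> \<theta> * n))
    = exp (\<theta> * x) * expectation (\<lambda>\<omega>. indicator (B \<inter> {\<omega> \<in> space M. \<tau> x \<omega> < ereal n}) \<omega> * exp (- \<psi> \<theta> * real_of_ereal (\<tau> x \<omega>)))"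
    (is "expectation ?L = _ * expectation ?R")
proof -
  define q where "q = \<psi> \<theta>"
  have q: "0 \<le> q" using \<theta> by (simp add: q_def)
  define A where "A = B \<inter> {\<omega> \<in> space M. \<tau> x \<omega> < ereal n}"
  define u where "u \<omega> = real_of_ereal (\<tau> x \<omega>)" for \<omega>
  have BM: "B \<in> events" using B by (simp add: passage_sigma_def)
  have AM[measurable]: "A \<in> events" unfolding A_def using BM by measurable
  have A: "\<omega> \<in> space M" "\<omega> \<in> B" "\<tau> x \<omega> = ereal (u \<omega>)" "0 \<le> u \<omega>" "u \<omega> < n" if "\<omega> \<in> A" for \<omega>
    using that first_passage_nonneg[of X x \<omega>] by (cases "\<tau> x \<omega>"; auto simp: A_def u_def)+
  \<comment> \<open>The \<open>+ 1\<close> makes the grid time strictly larger than the passage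
    time, as both the event \<open>\<tau> x < t k j\<close> and the right limit of the path
    require.\<close>
  define J where "J k \<omega> = nat \<lfloor>u \<omega> * Suc k\<rfloor> + 1" for k \<omega>
  define t where "t k j = real j / Suc k" for k j
  have t: "0 \<le> t k j" for k j by (simp add: t_def)
  have J_iff: "J k \<omega> = j \<longleftrightarrow> t k (j - 1) \<le> u \<omega> \<and> u \<omega> < t k j" if "\<omega> \<in> A" "1 \<le> j" for k j \<omega>
  proof -
    have "0 \<le> u \<omega> * Suc k" using A(4)[OF that(1)] by simp
    then have "J k \<omega> = j \<longleftrightarrow> \<lfloor>u \<omega> * Suc k\<rfloor> = int (j - 1)"
      using that(2) zero_le_floor[of "u \<omega> * Suc k"] unfolding J_def by linarith
    also have "\<dots> \<longleftrightarrow> real (j - 1) \<le> u \<omega> * Suc k \<and> u \<omega> * Suc k < real (j - 1) + 1"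
      by (simp add: floor_eq_iff)
    also have "real (j - 1) + 1 = real j" using that(2) by simp
    finally show ?thesis by (simp add: t_def field_simps)
  qed
  have T: "u \<omega> < t k (J k \<omega>)" "t k (J k \<omega>) \<le> u \<omega> + 1 / Suc k" "J k \<omega> \<in> {1..n * Suc k}" if "\<omega> \<in> A" for k \<omega>
  proof -
    have 1: "1 \<le> J k \<omega>" by (simp add: J_def)
    from J_iff[OF that 1, of k] have 2: "t k (J k \<omega> - 1) \<le> u \<omega>" "u \<omega> < t k (J k \<omega>)" by auto
    moreover have "t k (J k \<omega>) = t k (J k \<omega> - 1) + 1 / Suc k"
      using 1 by (simp add: t_def of_nat_diff add_divide_distrib[symmetric])
    ultimately show "u \<omega> < t k (J k \<omega>)" "t k (J k \<omega>) \<le> u \<omega> + 1 / Suc k"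
      by linarith+
    have "t k (J k \<omega> - 1) < n" using 2 A(5)[OF that] by linarith
    then have "real (J k \<omega> - 1) < real (n * Suc k)" by (simp add: t_def field_simps)
    then show "J k \<omega> \<in> {1..n * Suc k}" using 1 by (simp del: of_nat_mult of_nat_Suc mult_Suc_right)
  qed
  define S where "S k j = {\<omega> \<in> A. J k \<omega> = j}" for k j
  have S: "S k j \<in> sets (process_algebra M {0..t k j} X)" if j: "j \<in> {1..n * Suc k}" for k j
  proof -
    have tn: "t k j \<le> n" "t k (j - 1) \<le> t k j"
    proof -
      have "real j \<le> real (n * Suc k)" using j by (subst of_nat_le_iff) simp
      then show "t k j \<le> n" by (simp add: t_def field_simps)
    qed (auto simp: t_def divide_right_mono)
    \<comment> \<open>\<open>B\<close> is prior to \<open>\<tau> x\<close>, so each of the two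
      events belongs to the past of its own grid time, and the earlier past is contained in the
      later one.\<close>
    have "S k j = (B \<inter> {\<omega> \<in> space M. \<tau> x \<omega> < ereal (t k j)}) - (B \<inter> {\<omega> \<in> space M. \<tau> x \<omega> < ereal (t k (j - 1))})"
    proof (intro set_eqI iffI)
      fix \<omega> assume "\<omega> \<in> S k j"
      then show "\<omega> \<in> (B \<inter> {\<omega> \<in> space M. \<tau> x \<omega> < ereal (t k j)}) - (B \<inter> {\<omega> \<in> space M. \<tau> x \<omega> < ereal (t k (j - 1))})"
        using J_iff[of \<omega> j k] A[of \<omega>] j by (auto simp: S_def)
    next
      fix \<omega> assume \<omega>: "\<omega> \<in> (B \<inter> {\<omega> \<in> space M. \<tau> x \<omega> < ereal (t k j)}) - (B \<inter> {\<omega> \<in> space M. \<tau> x \<omega> < ereal (t k (j - 1))})"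
      then have "\<tau> x \<omega> < ereal n" using tn(1) less_le_trans[of "\<tau> x \<omega>" "ereal (t k j)" "ereal n"] by auto
      with \<omega> have "\<omega> \<in> A" by (auto simp: A_def)
      then show "\<omega> \<in> S k j" using \<omega> J_iff[of \<omega> j k] A(3)[of \<omega>] j by (auto simp: S_def)
    qed
    moreover have "B \<inter> {\<omega> \<in> space M. \<tau> x \<omega> < ereal (t k j)} \<in> process_sigma M {0..t k j} X"
      using B t by (auto simp: passage_sigma_def)
    moreover have "B \<inter> {\<omega> \<in> space M. \<tau> x \<omega> < ereal (t k (j - 1))} \<in> process_sigma M {0..t k (j - 1)} X"
      using B t by (auto simp: passage_sigma_def)
    then have "B \<inter> {\<omega> \<in> space M. \<tau> x \<omega> < ereal (t k (j - 1))} \<in> process_sigma M {0..t k j} X"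
      using process_sigma_mono[of "{0..t k (j - 1)}" "{0..t k j}" M X] tn by auto
    ultimately show ?thesis by (simp add: sets_process_algebra[symmetric] sets.Diff)
  qed
  \<comment> \<open>The truncation at \<open>exp (\<theta> * x)\<close> provides the dominating
    constant for \<open>R\<close>, since the path may overshoot \<open>x\<close> without bound
    between the passage and the grid time. In the limit it is inactive.\<close>
  define h where "h k j \<omega> = indicator (S k j) \<omega> * (exp (- q * t k j) * min (exp (\<theta> * X (t k j) \<omega>)) (exp (\<theta> * x)))" for k j \<omega>
  \<comment> \<open>The quotient of the martingale at \<open>n\<close> and at \<open>t k j\<close>;
    it has mean \<open>1\<close> and is independent of the past of \<open>t k j\<close>.\<close>
  define g where "g k j \<omega> = exp (\<theta> * (X n \<omega> - X (t k j) \<omega>)) * exp (- (q * (n - t k j)))" for k j \<omega>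
  have h_meas: "h k j \<in> borel_measurable (process_algebra M {0..t k j} X)" if j: "j \<in> {1..n * Suc k}" for k j
  proof -
    have [measurable]: "X (t k j) \<in> borel_measurable (process_algebra M {0..t k j} X)"
      using t by (intro measurable_process_algebra) auto
    note [measurable] = S[OF j]
    show ?thesis unfolding h_def by measurable
  qed
  have h_bound: "0 \<le> h k j \<omega>" "h k j \<omega> \<le> exp (\<theta> * x)" for k j \<omega>
  proof -
    have "exp (- q * t k j) * min (exp (\<theta> * X (t k j) \<omega>)) (exp (\<theta> * x)) \<le> 1 * exp (\<theta> * x)"
      using q t by (intro mult_mono) (auto simp: min_def)
    then show "h k j \<omega> \<le> exp (\<theta> * x)" by (auto simp: h_def indicator_def)
  qed (auto simp: h_def)
  have step: "integrable M (\<lambda>\<omega>. h k j \<omega> * g k j \<omega>)" "integrable M (h k j)"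
    "expectation (\<lambda>\<omega>. h k j \<omega> * g k j \<omega>) = expectation (h k j)" if j: "j \<in> {1..n * Suc k}" for k j
  proof -
    have "real j \<le> real (n * Suc k)" using j by (subst of_nat_le_iff) simp
    then have tn: "t k j \<le> n" by (simp add: t_def field_simps)
    have b: "\<bar>h k j \<omega>\<bar> \<le> exp (\<theta> * x)" for \<omega> using h_bound[of k j \<omega>] by simp
    note mart = exp_martingale[OF t[of k j] tn \<theta>(1) h_meas[OF j] b]
    have eq: "(\<lambda>\<omega>. h k j \<omega> * g k j \<omega>) = (\<lambda>\<omega>. h k j \<omega> * exp (\<theta> * (X n \<omega> - X (t k j) \<omega>)) * exp (- (q * (n - t k j))))"
      by (simp add: g_def mult.assoc)
    show "integrable M (\<lambda>\<omega>. h k j \<omega> * g k j \<omega>)" unfolding eq using mart(1) by simp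
    show "expectation (\<lambda>\<omega>. h k j \<omega> * g k j \<omega>) = expectation (h k j)"
      unfolding eq using mart(2) by (simp add: q_def exp_minus)
    show "integrable M (h k j)"
    proof (rule integrable_const_bound[where B="exp (\<theta> * x)"])
      show "h k j \<in> borel_measurable M"
        using h_meas[OF j] process_sigma_le_events[of "{0..t k j}"]
        by (intro measurable_from_subalg[of M "process_algebra M {0..t k j} X"]) (auto simp: subalgebra_def sets_process_algebra)
    qed (use b in auto)
  qed
  define L where "L k \<omega> = (\<Sum>j\<in>{1..n * Suc k}. h k j \<omega> * g k j \<omega>)" for k \<omega>
  define R where "R k \<omega> = (\<Sum>j\<in>{1..n * Suc k}. h k j \<omega>)" for k \<omega>
  have LR: "expectation (L k) = expectation (R k)" for k
  proof -
    have "expectation (L k) = (\<Sum>j\<in>{1..n * Suc k}. expectation (\<lambda>\<omega>. h k j \<omega> * g k j \<omega>))"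
      unfolding L_def by (rule Bochner_Integration.integral_sum) (rule step(1))
    also have "\<dots> = (\<Sum>j\<in>{1..n * Suc k}. expectation (h k j))"
      by (rule sum.cong[OF refl]) (rule step(3))
    also have "\<dots> = expectation (R k)"
      unfolding R_def by (rule Bochner_Integration.integral_sum[symmetric]) (rule step(2))
    finally show ?thesis .
  qed
  have Lm: "L k \<in> borel_measurable M" and Rm: "R k \<in> borel_measurable M" for k
    unfolding L_def R_def using step[of _ k]
    by (auto intro!: borel_measurable_sum borel_measurable_integrable simp del: mult_Suc_right)
  \<comment> \<open>On \<open>A\<close> exactly one summand survives, the one with index
    \<open>J k \<omega>\<close>.\<close>
  have pick: "(\<Sum>j\<in>{1..n * Suc k}. h k j \<omega> * f j)
     = (if \<omega> \<in> A then exp (- q * t k (J k \<omega>)) * min (exp (\<theta> * X (t k (J k \<omega>)) \<omega>)) (exp (\<theta> * x)) * f (J k \<omega>) else 0)" for k f \<omega>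
  proof (cases "\<omega> \<in> A")
    case True
    have "(\<Sum>j\<in>{1..n * Suc k}. h k j \<omega> * f j) = (\<Sum>j\<in>{1..n * Suc k}. if j = J k \<omega> then h k j \<omega> * f j else 0)"
      by (intro sum.cong) (auto simp: h_def S_def)
    also have "\<dots> = h k (J k \<omega>) \<omega> * f (J k \<omega>)" using T(3)[OF True, of k] by (simp add: sum.delta del: mult_Suc_right)
    finally show ?thesis using True by (simp add: h_def S_def)
  next
    case False
    then have "h k j \<omega> = 0" for j by (simp add: h_def S_def)
    then show ?thesis using False by simp
  qed
  have L_eq: "L k \<omega> = (if \<omega> \<in> A then exp (- q * t k (J k \<omega>)) * min (exp (\<theta> * X (t k (J k \<omega>)) \<omega>)) (exp (\<theta> * x)) * g k (J k \<omega>) \<omega> else 0)" for k \<omega>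
    unfolding L_def by (rule pick)
  have R_eq: "R k \<omega> = (if \<omega> \<in> A then exp (- q * t k (J k \<omega>)) * min (exp (\<theta> * X (t k (J k \<omega>)) \<omega>)) (exp (\<theta> * x)) else 0)" for k \<omega>
  proof -
    have "R k \<omega> = (\<Sum>j\<in>{1..n * Suc k}. h k j \<omega> * 1)" unfolding R_def by (simp only: mult_1_right)
    then show ?thesis unfolding pick by simp
  qed
  have lims: "AE \<omega> in M. (\<lambda>k. L k \<omega>) \<longlonglongrightarrow> indicator A \<omega> * exp (\<theta> * X n \<omega> - q * n) \<and>
    (\<lambda>k. R k \<omega>) \<longlonglongrightarrow> indicator A \<omega> * (exp (- q * u \<omega>) * exp (\<theta> * x))"
    using AE_X_first_passage
  proof eventually_elim
    case (elim \<omega>)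
    show ?case
    proof (cases "\<omega> \<in> A")
      case True
      have Xu: "X (u \<omega>) \<omega> = x" using elim[rule_format, OF x A(3)[OF True]] .
      have "(\<lambda>k. u \<omega> + 1 / real (Suc k)) \<longlonglongrightarrow> u \<omega> + 0"
        by (rule tendsto_add[OF tendsto_const LIMSEQ_Suc[OF lim_1_over_n]])
      then have up: "(\<lambda>k. u \<omega> + 1 / real (Suc k)) \<longlonglongrightarrow> u \<omega>" by (simp only: add_0_right)
      have Tl: "(\<lambda>k. t k (J k \<omega>)) \<longlonglongrightarrow> u \<omega>"
      proof (rule tendsto_sandwich[OF _ _ tendsto_const up])
        show "eventually (\<lambda>k. u \<omega> \<le> t k (J k \<omega>)) sequentially"
          by (intro always_eventually allI less_imp_le T(1)[OF True])
        show "eventually (\<lambda>k. t k (J k \<omega>) \<le> u \<omega> + 1 / real (Suc k)) sequentially"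
          by (intro always_eventually allI T(2)[OF True])
      qed
      have "filterlim (\<lambda>k. t k (J k \<omega>)) (at_right (u \<omega>)) sequentially"
        by (intro tendsto_imp_filterlim_at_right Tl always_eventually allI T(1)[OF True])
      from filterlim_compose[OF right_continuousD[OF A(1)[OF True] A(4)[OF True]] this]
      have Xl: "(\<lambda>k. X (t k (J k \<omega>)) \<omega>) \<longlonglongrightarrow> x" by (simp add: Xu)
      have "(\<lambda>k. exp (- q * t k (J k \<omega>)) * min (exp (\<theta> * X (t k (J k \<omega>)) \<omega>)) (exp (\<theta> * x)))
        \<longlonglongrightarrow> exp (- q * u \<omega>) * min (exp (\<theta> * x)) (exp (\<theta> * x))"
        by (intro tendsto_intros Tl Xl)
      moreover have "(\<lambda>k. exp (- q * t k (J k \<omega>)) * min (exp (\<theta> * X (t k (J k \<omega>)) \<omega>)) (exp (\<theta> * x)) * g k (J k \<omega>) \<omega>)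
        \<longlonglongrightarrow> exp (- q * u \<omega>) * min (exp (\<theta> * x)) (exp (\<theta> * x)) * (exp (\<theta> * (X n \<omega> - x)) * exp (- (q * (n - u \<omega>))))"
        unfolding g_def by (intro tendsto_intros Tl Xl)
      moreover have "exp (- q * u \<omega>) * min (exp (\<theta> * x)) (exp (\<theta> * x)) * (exp (\<theta> * (X n \<omega> - x)) * exp (- (q * (n - u \<omega>))))
        = exp (\<theta> * X n \<omega> - q * n)"
        unfolding min.idem exp_add[symmetric] by (rule arg_cong[where f=exp]) (simp add: algebra_simps)
      ultimately show ?thesis using True by (simp add: L_eq R_eq)
    next
      case False
      then show ?thesis by (simp add: L_eq R_eq)
    qed
  qed
  have Xn: "integrable M (\<lambda>\<omega>. exp (\<theta> * X n \<omega>))" using exp_moment(1)[of n \<theta>] n \<theta> by simp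
  have [measurable]: "X n \<in> borel_measurable M" by (rule rv) simp
  have um[measurable]: "u \<in> borel_measurable M" unfolding u_def by measurable
  have "(\<lambda>k. expectation (L k)) \<longlonglongrightarrow> expectation (\<lambda>\<omega>. indicator A \<omega> * exp (\<theta> * X n \<omega> - q * n))"
  proof (rule integral_dominated_convergence)
    show "integrable M (\<lambda>\<omega>. exp (\<theta> * X n \<omega>) * exp (- (q * n)))" using Xn by simp
    show "AE \<omega> in M. (\<lambda>k. L k \<omega>) \<longlonglongrightarrow> indicator A \<omega> * exp (\<theta> * X n \<omega> - q * n)"
      using lims by eventually_elim simp
    have "norm (L k \<omega>) \<le> exp (\<theta> * X n \<omega>) * exp (- (q * n))" for k \<omega>
    proof -
      let ?t = "t k (J k \<omega>)"
      \<comment> \<open>Without the truncation the exponents telescope, so the terminal value of the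
        martingale dominates every \<open>L k\<close>.\<close>
      have "exp (- q * ?t) * min (exp (\<theta> * X ?t \<omega>)) (exp (\<theta> * x)) * g k (J k \<omega>) \<omega>
        \<le> exp (- q * ?t) * exp (\<theta> * X ?t \<omega>) * g k (J k \<omega>) \<omega>"
        by (intro mult_right_mono mult_left_mono) (auto simp: g_def)
      also have "\<dots> = exp (\<theta> * X n \<omega>) * exp (- (q * n))"
        unfolding g_def exp_add[symmetric] by (rule arg_cong[where f=exp]) (simp add: algebra_simps)
      finally have "exp (- q * ?t) * min (exp (\<theta> * X ?t \<omega>)) (exp (\<theta> * x)) * g k (J k \<omega>) \<omega> \<le> exp (\<theta> * X n \<omega>) * exp (- (q * n))" .
      moreover have "0 \<le> exp (- q * ?t) * min (exp (\<theta> * X ?t \<omega>)) (exp (\<theta> * x)) * g k (J k \<omega>) \<omega>"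
        by (auto simp: g_def intro!: mult_nonneg_nonneg)
      ultimately show ?thesis unfolding L_eq by auto
    qed
    then show "AE \<omega> in M. norm (L k \<omega>) \<le> exp (\<theta> * X n \<omega>) * exp (- (q * n))" for k by auto
  qed (use Lm in measurable)
  moreover have "(\<lambda>k. expectation (R k)) \<longlonglongrightarrow> expectation (\<lambda>\<omega>. indicator A \<omega> * (exp (- q * u \<omega>) * exp (\<theta> * x)))"
  proof (rule integral_dominated_convergence)
    show "integrable M (\<lambda>_. exp (\<theta> * x))" by simp
    show "AE \<omega> in M. (\<lambda>k. R k \<omega>) \<longlonglongrightarrow> indicator A \<omega> * (exp (- q * u \<omega>) * exp (\<theta> * x))"
      using lims by eventually_elim simp
    have "norm (R k \<omega>) \<le> exp (\<theta> * x)" for k \<omega>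
    proof -
      have "exp (- q * t k (J k \<omega>)) * min (exp (\<theta> * X (t k (J k \<omega>)) \<omega>)) (exp (\<theta> * x)) \<le> 1 * exp (\<theta> * x)"
        using q t by (intro mult_mono) (auto simp: min_def)
      moreover have "0 \<le> exp (- q * t k (J k \<omega>)) * min (exp (\<theta> * X (t k (J k \<omega>)) \<omega>)) (exp (\<theta> * x))"
        by (auto intro!: mult_nonneg_nonneg)
      ultimately show ?thesis unfolding R_eq by auto
    qed
    then show "AE \<omega> in M. norm (R k \<omega>) \<le> exp (\<theta> * x)" for k by auto
  qed (use Rm in measurable)
  ultimately have "expectation (\<lambda>\<omega>. indicator A \<omega> * exp (\<theta> * X n \<omega> - q * n)) = expectation (\<lambda>\<omega>. indicator A \<omega> * (exp (- q * u \<omega>) * exp (\<theta> * x)))"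
    unfolding LR by (rule LIMSEQ_unique)
  also have "\<dots> = expectation (\<lambda>\<omega>. exp (\<theta> * x) * (indicator A \<omega> * exp (- q * u \<omega>)))"
    by (simp add: ac_simps)
  finally show ?thesis by (simp add: A_def u_def q_def)
qed

text \<open>Dominated convergence with bound \<open>1\<close> replaces the deadline by mere
  finiteness of the passage time.\<close>

lemma optional_stopping_limit:
  assumes \<theta>: "0 \<le> \<theta>" "0 \<le> \<psi> \<theta>" and x: "0 \<le> x" and B: "B \<in> passage_sigma x"
  shows "(\<lambda>n. expectation (\<lambda>\<omega>. indicator (B \<inter> {\<omega> \<in> space M. \<tau> x \<omega> < ereal (Suc n)}) \<omega> * exp (\<theta> * X (Suc n) \<omega> - \<psi> \<theta> * Suc n)))
    \<longlonglongrightarrow> exp (\<theta> * x) * expectation (\<lambda>\<omega>. indicator (B \<inter> {\<omega> \<in> space M. \<tau> x \<omega> < \<infinity>}) \<omega> * exp (- \<psi> \<theta> * T x \<omega>))"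
  unfolding optional_stopping[OF \<theta> x zero_less_Suc B] passage_time_def[symmetric]
proof (intro tendsto_intros integral_dominated_convergence)
  have [measurable]: "B \<in> events" using B by (simp add: passage_sigma_def)
  show "integrable M (\<lambda>_. 1::real)" by simp
  show "(\<lambda>\<omega>. indicator (B \<inter> {\<omega> \<in> space M. \<tau> x \<omega> < \<infinity>}) \<omega> * exp (- \<psi> \<theta> * T x \<omega>)) \<in> borel_measurable M"
    "\<And>n. (\<lambda>\<omega>. indicator (B \<inter> {\<omega> \<in> space M. \<tau> x \<omega> < ereal (Suc n)}) \<omega> * exp (- \<psi> \<theta> * T x \<omega>)) \<in> borel_measurable M"
    by measurable
  show "AE \<omega> in M. norm (indicator (B \<inter> {\<omega> \<in> space M. \<tau> x \<omega> < ereal (Suc n)}) \<omega> * exp (- \<psi> \<theta> * T x \<omega>)) \<le> 1" for n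
    using \<theta>(2) T_nonneg[of x] by (intro AE_I2) (auto simp: indicator_def)
  show "AE \<omega> in M. (\<lambda>n. indicator (B \<inter> {\<omega> \<in> space M. \<tau> x \<omega> < ereal (Suc n)}) \<omega> * exp (- \<psi> \<theta> * T x \<omega>))
    \<longlonglongrightarrow> indicator (B \<inter> {\<omega> \<in> space M. \<tau> x \<omega> < \<infinity>}) \<omega> * exp (- \<psi> \<theta> * T x \<omega>)"
  proof (intro AE_I2 tendsto_intros)
    fix \<omega>
    show "(\<lambda>n. indicator (B \<inter> {\<omega> \<in> space M. \<tau> x \<omega> < ereal (Suc n)}) \<omega> :: real)
      \<longlonglongrightarrow> indicator (B \<inter> {\<omega> \<in> space M. \<tau> x \<omega> < \<infinity>}) \<omega>"
    proof (cases "\<tau> x \<omega> < \<infinity>")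
      case True
      then obtain N :: nat where N: "\<tau> x \<omega> < ereal N" using less_PInf_Ex_of_nat[of "\<tau> x \<omega>"] by auto
      have "\<tau> x \<omega> < ereal (Suc n)" if "n \<ge> N" for n
        by (rule less_trans[OF N]) (use that in simp)
      then have "eventually (\<lambda>n. \<tau> x \<omega> < ereal (Suc n)) sequentially"
        by (auto simp: eventually_sequentially)
      then have "eventually (\<lambda>n. indicator (B \<inter> {\<omega> \<in> space M. \<tau> x \<omega> < ereal (Suc n)}) \<omega> =
          (indicator (B \<inter> {\<omega> \<in> space M. \<tau> x \<omega> < \<infinity>}) \<omega> :: real)) sequentially"
        by eventually_elim (use True in \<open>auto simp: indicator_def\<close>)
      then show ?thesis by (rule tendsto_eventually)
    next
      case False
      then have "\<not> \<tau> x \<omega> < ereal (Suc n)" for n by auto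
      then show ?thesis using False by (auto simp: indicator_def)
    qed
  qed
qed

text \<open>Controls what is not stopped before \<open>n + 1\<close>: the path is then still at most
  \<open>y\<close>, and for \<open>q > 0\<close> the bound tends to \<open>0\<close>.\<close>

lemma exp_martingale_passage_bound:
  fixes n :: nat and q :: real
  assumes \<theta>: "0 \<le> \<theta>" and y: "0 \<le> y"
  shows "AE \<omega> in M. ereal (Suc n) \<le> \<tau> y \<omega> \<longrightarrow> exp (\<theta> * X (Suc n) \<omega> - q * Suc n) \<le> exp (\<theta> * y - q * Suc n)"
  using AE_X_le_before_passage
proof eventually_elim
  case (elim \<omega>)
  show ?case
  proof
    assume "ereal (Suc n) \<le> \<tau> y \<omega>"
    then have "X (Suc n) \<omega> \<le> y" using elim y by (metis of_nat_0_less_iff zero_less_Suc)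
    then show "exp (\<theta> * X (Suc n) \<omega> - q * Suc n) \<le> exp (\<theta> * y - q * Suc n)"
      using \<theta> by (simp add: mult_left_mono)
  qed
qed

text \<open>For a fixed \<open>B\<close>, the left sides of \<open>optional_stopping_limit\<close>
  for \<open>x\<close> and \<open>y\<close> differ only where \<open>x\<close> but not
  \<open>y\<close> was passed before \<open>n + 1\<close>, and there the martingale is negligible.
  Up to finiteness of the passages this says that
  \<open>exp (\<theta> * x - \<psi> \<theta> * T x)\<close> is a martingale in the level.\<close>

lemma passage_transform_step:
  assumes \<theta>: "0 < \<theta>" "0 < \<psi> \<theta>" and xy: "0 \<le> x" "x \<le> y" and B: "B \<in> passage_sigma x"
  shows "exp (\<theta> * x) * expectation (\<lambda>\<omega>. indicator (B \<inter> {\<omega> \<in> space M. \<tau> x \<omega> < \<infinity>}) \<omega> * exp (- \<psi> \<theta> * T x \<omega>))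
    = exp (\<theta> * y) * expectation (\<lambda>\<omega>. indicator (B \<inter> {\<omega> \<in> space M. \<tau> y \<omega> < \<infinity>}) \<omega> * exp (- \<psi> \<theta> * T y \<omega>))"
    (is "?l = ?r")
proof -
  let ?a = "\<lambda>z n. expectation (\<lambda>\<omega>. indicator (B \<inter> {\<omega> \<in> space M. \<tau> z \<omega> < ereal (Suc n)}) \<omega> * exp (\<theta> * X (Suc n) \<omega> - \<psi> \<theta> * Suc n))"
  have "B \<in> passage_sigma y" using B passage_sigma_mono[OF xy(2)] by auto
  then have lims: "?a x \<longlonglongrightarrow> ?l" "?a y \<longlonglongrightarrow> ?r"
    using optional_stopping_limit[OF less_imp_le[OF \<theta>(1)] less_imp_le[OF \<theta>(2)]] B xy by auto
  have [measurable]: "B \<in> events" using B by (simp add: passage_sigma_def)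
  have int: "integrable M (\<lambda>\<omega>. indicator (B \<inter> {\<omega> \<in> space M. \<tau> z \<omega> < ereal (Suc n)}) \<omega> * exp (\<theta> * X (Suc n) \<omega> - \<psi> \<theta> * Suc n))" for z n
  proof -
    have "integrable M (\<lambda>\<omega>. exp (\<theta> * X (Suc n) \<omega>) * exp (- (\<psi> \<theta> * Suc n)))"
      using exp_moment(1)[of "Suc n" \<theta>] \<theta> by simp
    then have "integrable M (\<lambda>\<omega>. exp (\<theta> * X (Suc n) \<omega> - \<psi> \<theta> * Suc n))"
      by (simp add: exp_diff exp_minus divide_inverse)
    from integrable_mult_indicator[OF _ this, of "B \<inter> {\<omega> \<in> space M. \<tau> z \<omega> < ereal (Suc n)}"]
    show ?thesis by simp
  qed
  have bound: "\<bar>?a x n - ?a y n\<bar> \<le> exp (\<theta> * y - \<psi> \<theta> * Suc n)" for n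
  proof (rule expectation_diff_le[OF int int])
    have "0 \<le> y" using xy by simp
    from exp_martingale_passage_bound[OF less_imp_le[OF \<theta>(1)] this, of n "\<psi> \<theta>"]
    show "AE \<omega> in M. \<bar>indicator (B \<inter> {\<omega> \<in> space M. \<tau> x \<omega> < ereal (Suc n)}) \<omega> * exp (\<theta> * X (Suc n) \<omega> - \<psi> \<theta> * Suc n)
       - indicator (B \<inter> {\<omega> \<in> space M. \<tau> y \<omega> < ereal (Suc n)}) \<omega> * exp (\<theta> * X (Suc n) \<omega> - \<psi> \<theta> * Suc n)\<bar>
       \<le> exp (\<theta> * y - \<psi> \<theta> * Suc n)"
    proof eventually_elim
      case (elim \<omega>)
      show ?case
        using elim first_passage_mono[OF xy(2), of X \<omega>]
        by (cases "\<tau> y \<omega> < ereal (Suc n)") (auto simp: indicator_def not_less)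
    qed
  qed
  have "(\<lambda>n. ?a x n - ?a y n) \<longlonglongrightarrow> 0"
    by (rule Lim_null_comparison[OF _ exp_bound_tendsto_0[OF \<theta>(2), of "\<theta> * y"]]) (use bound in auto)
  then show ?thesis
    using tendsto_diff[OF lims] LIMSEQ_unique by fastforce
qed

text \<open>The part stopped before \<open>n + 1\<close> is compared with the full martingale, whose
  mean is \<open>1\<close>. The transform is called defective because the passage might still fail
  to occur.\<close>

lemma passage_transform_defective:
  assumes \<theta>: "0 < \<theta>" "0 < \<psi> \<theta>" and y: "0 \<le> y"
  shows "expectation (\<lambda>\<omega>. indicator {\<omega> \<in> space M. \<tau> y \<omega> < \<infinity>} \<omega> * exp (- \<psi> \<theta> * T y \<omega>)) = exp (- \<theta> * y)"
proof -
  let ?a = "\<lambda>n. expectation (\<lambda>\<omega>. indicator {\<omega> \<in> space M. \<tau> y \<omega> < ereal (Suc n)} \<omega> * exp (\<theta> * X (Suc n) \<omega> - \<psi> \<theta> * Suc n))"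
  have B: "space M \<in> passage_sigma y"
    using sets.top[of "passage_algebra y"] by (simp add: sets_passage_algebra)
  have sub: "space M \<inter> {\<omega> \<in> space M. P \<omega>} = {\<omega> \<in> space M. P \<omega>}" for P by auto
  have lim: "?a \<longlonglongrightarrow> exp (\<theta> * y) * expectation (\<lambda>\<omega>. indicator {\<omega> \<in> space M. \<tau> y \<omega> < \<infinity>} \<omega> * exp (- \<psi> \<theta> * T y \<omega>))"
    using optional_stopping_limit[OF less_imp_le[OF \<theta>(1)] less_imp_le[OF \<theta>(2)] y B] unfolding sub .
  have int: "integrable M (\<lambda>\<omega>. exp (\<theta> * X (Suc n) \<omega> - \<psi> \<theta> * Suc n))"
    "expectation (\<lambda>\<omega>. exp (\<theta> * X (Suc n) \<omega> - \<psi> \<theta> * Suc n)) = 1" for n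
  proof -
    have *: "(\<lambda>\<omega>. exp (\<theta> * X (Suc n) \<omega> - \<psi> \<theta> * Suc n)) = (\<lambda>\<omega>. exp (\<theta> * X (Suc n) \<omega>) * exp (- (\<psi> \<theta> * Suc n)))"
      by (simp add: exp_diff exp_minus divide_inverse)
    show "integrable M (\<lambda>\<omega>. exp (\<theta> * X (Suc n) \<omega> - \<psi> \<theta> * Suc n))"
      unfolding * using exp_moment(1)[of "Suc n" \<theta>] \<theta> by simp
    show "expectation (\<lambda>\<omega>. exp (\<theta> * X (Suc n) \<omega> - \<psi> \<theta> * Suc n)) = 1"
      unfolding * using exp_moment(2)[of "Suc n" \<theta>] \<theta> by (simp add: exp_minus)
  qed
  have int': "integrable M (\<lambda>\<omega>. indicator {\<omega> \<in> space M. \<tau> y \<omega> < ereal (Suc n)} \<omega> * exp (\<theta> * X (Suc n) \<omega> - \<psi> \<theta> * Suc n))" for n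
    using integrable_mult_indicator[OF _ int(1)[of n], of "{\<omega> \<in> space M. \<tau> y \<omega> < ereal (Suc n)}"] by simp
  have bound: "\<bar>1 - ?a n\<bar> \<le> exp (\<theta> * y - \<psi> \<theta> * Suc n)" for n
    unfolding int(2)[of n, symmetric]
  proof (rule expectation_diff_le[OF int(1) int'])
    from exp_martingale_passage_bound[OF less_imp_le[OF \<theta>(1)] y, of n "\<psi> \<theta>"] AE_space
    show "AE \<omega> in M. \<bar>exp (\<theta> * X (Suc n) \<omega> - \<psi> \<theta> * Suc n)
       - indicator {\<omega> \<in> space M. \<tau> y \<omega> < ereal (Suc n)} \<omega> * exp (\<theta> * X (Suc n) \<omega> - \<psi> \<theta> * Suc n)\<bar>
       \<le> exp (\<theta> * y - \<psi> \<theta> * Suc n)"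
    proof eventually_elim
      case (elim \<omega>)
      then show ?case
        by (cases "\<tau> y \<omega> < ereal (Suc n)") (auto simp: indicator_def not_less)
    qed
  qed
  have "(\<lambda>n. 1 - ?a n) \<longlonglongrightarrow> 0"
    by (rule Lim_null_comparison[OF _ exp_bound_tendsto_0[OF \<theta>(2), of "\<theta> * y"]]) (use bound in auto)
  then have "exp (\<theta> * y) * expectation (\<lambda>\<omega>. indicator {\<omega> \<in> space M. \<tau> y \<omega> < \<infinity>} \<omega> * exp (- \<psi> \<theta> * T y \<omega>)) = 1"
    using tendsto_diff[OF tendsto_const lim, of 1] LIMSEQ_unique by fastforce
  then show ?thesis by (simp add: exp_minus field_simps)
qed

section \<open>Passage times as a process in the level\<close>

context
  assumes exponent_pos: "\<forall>\<theta>>0. \<psi> \<theta> > 0"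
    and exponent_surj: "\<forall>q>0. \<exists>\<theta>>0. \<psi> \<theta> = q"
begin

text \<open>The defective transform is a lower bound for the probability of a finite passage, and
  its value \<open>exp (- \<theta> * y)\<close> tends to \<open>1\<close> as \<open>\<theta>\<close>
  tends to \<open>0\<close>. Integer levels and monotonicity give one null set for all
  levels.\<close>

lemma AE_first_passage_finite: "AE \<omega> in M. \<forall>x. \<tau> x \<omega> = ereal (T x \<omega>)"
proof -
  have one: "AE \<omega> in M. \<tau> (real y) \<omega> < \<infinity>" for y :: nat
  proof -
    let ?F = "{\<omega> \<in> space M. \<tau> (real y) \<omega> < \<infinity>}"
    have F[measurable]: "?F \<in> events" by measurable
    have "exp (- \<theta> * real y) \<le> prob ?F" if "\<theta> > 0" for \<theta>
    proof -
      have "exp (- \<theta> * y) = expectation (\<lambda>\<omega>. indicator ?F \<omega> * exp (- \<psi> \<theta> * T y \<omega>))"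
        using passage_transform_defective[OF that exponent_pos[rule_format, OF that], of "real y"] by simp
      also have "\<dots> \<le> expectation (indicator ?F)"
      proof (rule integral_mono)
        show "integrable M (\<lambda>\<omega>. indicator ?F \<omega> * exp (- \<psi> \<theta> * T y \<omega>))"
          using exponent_pos[rule_format, OF that] T_nonneg[of y]
          by (intro integrable_const_bound[where B=1]) (auto simp: indicator_def)
        show "indicator ?F \<omega> * exp (- \<psi> \<theta> * T y \<omega>) \<le> indicator ?F \<omega>" for \<omega>
          using exponent_pos[rule_format, OF that] T_nonneg[of y \<omega>] by (auto simp: indicator_def)
      qed (use F in \<open>auto simp: emeasure_eq_measure\<close>)
      finally show ?thesis by simp
    qed
    from this[of "1 / Suc n" for n] have "exp (- (1 / Suc n) * real y) \<le> prob ?F" for n by simp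
    moreover have "(\<lambda>n. exp (- (1 / Suc n) * real y)) \<longlonglongrightarrow> exp (- 0 * real y)"
      by (intro tendsto_intros LIMSEQ_Suc[OF lim_1_over_n])
    ultimately have "exp (- 0 * real y) \<le> prob ?F" by (intro LIMSEQ_le_const2) auto
    then have "prob ?F = 1" by (intro antisym prob_le_1) simp
    then show ?thesis using AE_prob_1[of ?F] by auto
  qed
  then have "AE \<omega> in M. \<forall>y::nat. \<tau> (real y) \<omega> < \<infinity>" by (simp add: AE_all_countable)
  then show ?thesis
  proof eventually_elim
    case (elim \<omega>)
    show ?case
    proof
      fix x :: real
      obtain y :: nat where "x \<le> y" using real_arch_simple by blast
      then have "\<tau> x \<omega> < \<infinity>" using elim first_passage_mono[of x y X \<omega>] by (meson le_less_trans)
      then show "\<tau> x \<omega> = ereal (T x \<omega>)"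
        using first_passage_nonneg[of X x \<omega>] by (cases "\<tau> x \<omega>") (auto simp: passage_time_def)
    qed
  qed
qed

lemma passage_transform:
  assumes "0 < \<theta>" "0 \<le> y"
  shows "expectation (\<lambda>\<omega>. exp (- \<psi> \<theta> * T y \<omega>)) = exp (- \<theta> * y)"
proof -
  have "expectation (\<lambda>\<omega>. exp (- \<psi> \<theta> * T y \<omega>)) = expectation (\<lambda>\<omega>. indicator {\<omega> \<in> space M. \<tau> y \<omega> < \<infinity>} \<omega> * exp (- \<psi> \<theta> * T y \<omega>))"
  proof (rule integral_cong_AE)
    show "AE \<omega> in M. exp (- \<psi> \<theta> * T y \<omega>) = indicator {\<omega> \<in> space M. \<tau> y \<omega> < \<infinity>} \<omega> * exp (- \<psi> \<theta> * T y \<omega>)"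
      using AE_first_passage_finite AE_space by eventually_elim simp
  qed measurable
  then show ?thesis using passage_transform_defective[of \<theta> y] exponent_pos assms by simp
qed

text \<open>At level \<open>0\<close> the transform equals \<open>1\<close> while its integrand
  never exceeds \<open>1\<close>, so the integrand is \<open>1\<close> almost surely.\<close>

lemma AE_T_0: "AE \<omega> in M. T 0 \<omega> = 0"
proof -
  have "expectation (\<lambda>\<omega>. exp (- \<psi> 1 * T 0 \<omega>)) = 1" using passage_transform[of 1 0] by simp
  moreover have p: "\<psi> 1 > 0" by (simp add: exponent_pos)
  moreover have "exp (- \<psi> 1 * T 0 \<omega>) \<le> 1" for \<omega> using p T_nonneg[of 0 \<omega>] by simp
  moreover have i: "integrable M (\<lambda>\<omega>. exp (- \<psi> 1 * T 0 \<omega>))"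
    using p T_nonneg[of 0] by (intro integrable_const_bound[where B=1]) auto
  ultimately have "expectation (\<lambda>\<omega>. 1 - exp (- \<psi> 1 * T 0 \<omega>)) = 0" "\<And>\<omega>. 0 \<le> 1 - exp (- \<psi> 1 * T 0 \<omega>)"
    by (simp_all add: prob_space)
  then have "AE \<omega> in M. 1 - exp (- \<psi> 1 * T 0 \<omega>) = 0"
    using i by (subst (asm) integral_nonneg_eq_0_iff_AE) auto
  then show ?thesis by eventually_elim (use p in auto)
qed

text \<open>The weight \<open>exp (\<psi> \<theta> * T x)\<close>, which turns the martingale
  identity in the level into one for the increment, is measurable for the past of
  \<open>\<tau> x\<close> but unbounded. The identity is therefore read as a conditional expectation
  of nonnegative functions, where such weights are admissible.\<close>

lemma passage_transform_past:
  assumes \<theta>: "0 < \<theta>" and xy: "0 \<le> x" "x \<le> y" and A: "A \<in> passage_sigma x"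
  shows "expectation (\<lambda>\<omega>. indicator A \<omega> * exp (- \<psi> \<theta> * (T y \<omega> - T x \<omega>))) = prob A * exp (- \<theta> * (y - x))"
proof -
  have p: "\<psi> \<theta> > 0" using exponent_pos[rule_format, OF \<theta>] .
  let ?F = "passage_algebra x"
  have sub: "subalgebra M ?F"
    by (auto simp: subalgebra_def sets_passage_algebra passage_sigma_def)
  have "finite_measure_subalgebra M ?F"
    by (intro finite_measure_subalgebra.intro finite_measure_subalgebra_axioms.intro finite_measure_axioms sub)
  then interpret S: sigma_finite_subalgebra M ?F by (rule finite_measure_subalgebra_is_sigma_finite)
  have Am: "A \<in> sets ?F" "A \<in> events" using A by (auto simp: sets_passage_algebra passage_sigma_def)
  have TF[measurable]: "T x \<in> borel_measurable ?F" by (rule measurable_T_passage_algebra) simp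
  define f where "f \<omega> = ennreal (exp (\<theta> * y) * exp (- \<psi> \<theta> * T y \<omega>))" for \<omega>
  define g where "g \<omega> = ennreal (exp (\<theta> * x) * exp (- \<psi> \<theta> * T x \<omega>))" for \<omega>
  have bi: "integrable M (\<lambda>\<omega>. indicator B \<omega> * exp (- \<psi> \<theta> * T z \<omega>))" if [measurable]: "B \<in> events" for z B
    using p T_nonneg[of z] by (intro integrable_const_bound[where B=1]) (auto simp: indicator_def)
  have nn: "(\<integral>\<^sup>+\<omega>\<in>B. ennreal (exp (\<theta> * z) * exp (- \<psi> \<theta> * T z \<omega>)) \<partial>M)
    = ennreal (exp (\<theta> * z) * expectation (\<lambda>\<omega>. indicator (B \<inter> {\<omega> \<in> space M. \<tau> z \<omega> < \<infinity>}) \<omega> * exp (- \<psi> \<theta> * T z \<omega>)))"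
    if B: "B \<in> events" for B z
  proof -
    have "(\<integral>\<^sup>+\<omega>\<in>B. ennreal (exp (\<theta> * z) * exp (- \<psi> \<theta> * T z \<omega>)) \<partial>M) = (\<integral>\<^sup>+\<omega>. ennreal (exp (\<theta> * z) * (indicator B \<omega> * exp (- \<psi> \<theta> * T z \<omega>))) \<partial>M)"
      by (intro nn_integral_cong) (auto simp: indicator_def)
    also have "\<dots> = ennreal (expectation (\<lambda>\<omega>. exp (\<theta> * z) * (indicator B \<omega> * exp (- \<psi> \<theta> * T z \<omega>))))"
      using bi[OF B] by (intro nn_integral_eq_integral) auto
    also have "expectation (\<lambda>\<omega>. exp (\<theta> * z) * (indicator B \<omega> * exp (- \<psi> \<theta> * T z \<omega>)))
      = exp (\<theta> * z) * expectation (\<lambda>\<omega>. indicator B \<omega> * exp (- \<psi> \<theta> * T z \<omega>))" by simp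
    also have "expectation (\<lambda>\<omega>. indicator B \<omega> * exp (- \<psi> \<theta> * T z \<omega>))
      = expectation (\<lambda>\<omega>. indicator (B \<inter> {\<omega> \<in> space M. \<tau> z \<omega> < \<infinity>}) \<omega> * exp (- \<psi> \<theta> * T z \<omega>))"
    proof (rule integral_cong_AE)
      show "AE \<omega> in M. indicator B \<omega> * exp (- \<psi> \<theta> * T z \<omega>) = indicator (B \<inter> {\<omega> \<in> space M. \<tau> z \<omega> < \<infinity>}) \<omega> * exp (- \<psi> \<theta> * T z \<omega>)"
        using AE_first_passage_finite AE_space by eventually_elim (simp add: indicator_def)
    qed (use B in measurable)
    finally show ?thesis .
  qed
  have "AE \<omega> in M. g \<omega> = nn_cond_exp M ?F f \<omega>"
  proof (rule S.nn_cond_exp_charact)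
    fix B assume "B \<in> sets ?F"
    then have B: "B \<in> passage_sigma x" "B \<in> events" by (auto simp: sets_passage_algebra passage_sigma_def)
    show "(\<integral>\<^sup>+\<omega>\<in>B. f \<omega> \<partial>M) = (\<integral>\<^sup>+\<omega>\<in>B. g \<omega> \<partial>M)"
      unfolding f_def g_def nn[OF B(2)] using passage_transform_step[OF \<theta> p xy B(1)] by simp
  next
    show "f \<in> borel_measurable M" unfolding f_def by measurable
    show "g \<in> borel_measurable ?F" unfolding g_def by measurable
  qed
  define W where "W \<omega> = ennreal (indicator A \<omega> * exp (\<psi> \<theta> * T x \<omega>))" for \<omega>
  have W: "W \<in> borel_measurable ?F" unfolding W_def using Am(1) by measurable
  have fM: "f \<in> borel_measurable M" unfolding f_def by measurable
  have "(\<integral>\<^sup>+\<omega>. W \<omega> * f \<omega> \<partial>M) = (\<integral>\<^sup>+\<omega>. W \<omega> * nn_cond_exp M ?F f \<omega> \<partial>M)"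
    by (rule S.nn_cond_exp_intg[symmetric, OF W fM])
  also have "\<dots> = (\<integral>\<^sup>+\<omega>. W \<omega> * g \<omega> \<partial>M)"
    using \<open>AE \<omega> in M. g \<omega> = nn_cond_exp M ?F f \<omega>\<close> by (intro nn_integral_cong_AE) auto
  also have "\<dots> = (\<integral>\<^sup>+\<omega>. ennreal (exp (\<theta> * x)) * indicator A \<omega> \<partial>M)"
  proof (rule nn_integral_cong)
    fix \<omega>
    have "W \<omega> * g \<omega> = ennreal ((indicator A \<omega> * exp (\<psi> \<theta> * T x \<omega>)) * (exp (\<theta> * x) * exp (- \<psi> \<theta> * T x \<omega>)))"
      unfolding W_def g_def by (rule ennreal_mult[symmetric]) auto
    also have "(indicator A \<omega> * exp (\<psi> \<theta> * T x \<omega>)) * (exp (\<theta> * x) * exp (- \<psi> \<theta> * T x \<omega>)) = exp (\<theta> * x) * indicator A \<omega>"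
      by (simp add: exp_minus)
    also have "ennreal \<dots> = ennreal (exp (\<theta> * x)) * indicator A \<omega>"
      by (cases "\<omega> \<in> A") auto
    finally show "W \<omega> * g \<omega> = ennreal (exp (\<theta> * x)) * indicator A \<omega>" .
  qed
  also have "\<dots> = ennreal (exp (\<theta> * x) * prob A)"
    using Am(2) by (simp add: nn_integral_cmult_indicator emeasure_eq_measure ennreal_mult)
  finally have 1: "(\<integral>\<^sup>+\<omega>. W \<omega> * f \<omega> \<partial>M) = ennreal (exp (\<theta> * x) * prob A)" .
  have 2: "W \<omega> * f \<omega> = ennreal (exp (\<theta> * y) * (indicator A \<omega> * exp (- \<psi> \<theta> * (T y \<omega> - T x \<omega>))))" for \<omega>
  proof -
    have "W \<omega> * f \<omega> = ennreal ((indicator A \<omega> * exp (\<psi> \<theta> * T x \<omega>)) * (exp (\<theta> * y) * exp (- \<psi> \<theta> * T y \<omega>)))"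
      unfolding W_def f_def by (rule ennreal_mult[symmetric]) auto
    also have "(indicator A \<omega> * exp (\<psi> \<theta> * T x \<omega>)) * (exp (\<theta> * y) * exp (- \<psi> \<theta> * T y \<omega>))
      = exp (\<theta> * y) * (indicator A \<omega> * (exp (\<psi> \<theta> * T x \<omega>) * exp (- \<psi> \<theta> * T y \<omega>)))"
      by (simp only: ac_simps)
    also have "exp (\<psi> \<theta> * T x \<omega>) * exp (- \<psi> \<theta> * T y \<omega>) = exp (- \<psi> \<theta> * (T y \<omega> - T x \<omega>))"
      unfolding exp_add[symmetric] by (simp add: right_diff_distrib)
    finally show ?thesis .
  qed
  have "has_bochner_integral M (\<lambda>\<omega>. exp (\<theta> * y) * (indicator A \<omega> * exp (- \<psi> \<theta> * (T y \<omega> - T x \<omega>)))) (exp (\<theta> * x) * prob A)"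
  proof (rule has_bochner_integral_nn_integral)
    show "(\<lambda>\<omega>. exp (\<theta> * y) * (indicator A \<omega> * exp (- \<psi> \<theta> * (T y \<omega> - T x \<omega>)))) \<in> borel_measurable M"
      using Am(2) by measurable
  qed (use 1 2 in auto)
  then have "exp (\<theta> * y) * expectation (\<lambda>\<omega>. indicator A \<omega> * exp (- \<psi> \<theta> * (T y \<omega> - T x \<omega>))) = exp (\<theta> * x) * prob A"
    by (simp add: has_bochner_integral_iff)
  then have "expectation (\<lambda>\<omega>. indicator A \<omega> * exp (- \<psi> \<theta> * (T y \<omega> - T x \<omega>))) = exp (- (\<theta> * y)) * (exp (\<theta> * x) * prob A)"
    by (simp add: exp_minus field_simps)
  also have "\<dots> = prob A * (exp (- (\<theta> * y)) * exp (\<theta> * x))" by (simp only: ac_simps)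
  also have "exp (- (\<theta> * y)) * exp (\<theta> * x) = exp (- \<theta> * (y - x))"
    unfolding exp_add[symmetric] by (simp add: right_diff_distrib)
  finally show ?thesis .
qed

text \<open>Independence of a single increment from the past is enough for independence of finitely many
  increments, and it only requires the one-dimensional uniqueness theorem.\<close>

lemma passage_increment:
  assumes xy: "0 \<le> x" "x \<le> y" and A: "A \<in> passage_sigma x" and C: "C \<in> sets borel"
  shows "prob (A \<inter> {\<omega> \<in> space M. T y \<omega> - T x \<omega> \<in> C}) = prob A * prob {\<omega> \<in> space M. T (y - x) \<omega> \<in> C}"
proof -
  have AM[measurable]: "A \<in> events" using A by (simp add: passage_sigma_def)
  let ?D = "\<lambda>\<omega>. T y \<omega> - T x \<omega>"
  \<comment> \<open>Two measures of total mass \<open>prob A\<close>: the law of the increment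
    restricted to \<open>A\<close>, and a scaled copy of the law of \<open>T (y - x)\<close>. Their
    equality gives independence and stationarity at once; it needs the uniqueness theorem for finite
    measures.\<close>
  define \<mu> where "\<mu> = distr (density M (\<lambda>\<omega>. ennreal (indicator A \<omega>))) borel ?D"
  define \<nu> where "\<nu> = density (distr M borel (T (y - x))) (\<lambda>_. ennreal (prob A))"
  have m: "emeasure \<mu> E = ennreal (prob (A \<inter> {\<omega> \<in> space M. ?D \<omega> \<in> E}))" if [measurable]: "E \<in> sets borel" for E
  proof -
    have "emeasure \<mu> E = emeasure (density M (\<lambda>\<omega>. ennreal (indicator A \<omega>))) {\<omega> \<in> space M. ?D \<omega> \<in> E}"
      unfolding \<mu>_def by (subst emeasure_distr) (auto intro!: arg_cong2[where f=emeasure])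
    also have "\<dots> = (\<integral>\<^sup>+\<omega>. indicator (A \<inter> {\<omega> \<in> space M. ?D \<omega> \<in> E}) \<omega> \<partial>M)"
      by (subst emeasure_density) (auto intro!: nn_integral_cong simp: indicator_def simp del: nn_integral_indicator)
    also have "\<dots> = emeasure M (A \<inter> {\<omega> \<in> space M. ?D \<omega> \<in> E})" by (intro nn_integral_indicator) measurable
    finally show ?thesis by (simp add: emeasure_eq_measure)
  qed
  have n: "emeasure \<nu> E = ennreal (prob A * prob {\<omega> \<in> space M. T (y - x) \<omega> \<in> E})" if [measurable]: "E \<in> sets borel" for E
  proof -
    have "emeasure \<nu> E = (\<integral>\<^sup>+z. ennreal (prob A) * indicator E z \<partial>distr M borel (T (y - x)))"
      unfolding \<nu>_def by (subst emeasure_density) auto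
    also have "\<dots> = ennreal (prob A) * emeasure M (T (y - x) -` E \<inter> space M)"
      by (subst nn_integral_cmult_indicator) (auto simp: emeasure_distr)
    also have "T (y - x) -` E \<inter> space M = {\<omega> \<in> space M. T (y - x) \<omega> \<in> E}" by auto
    finally show ?thesis by (simp add: emeasure_eq_measure ennreal_mult)
  qed
  have "\<mu> = \<nu>"
  proof (rule laplace_transform_unique)
    show s: "sets \<mu> = sets borel" "sets \<nu> = sets borel" by (auto simp: \<mu>_def \<nu>_def)
    show "finite_measure \<mu>" "finite_measure \<nu>"
      using sets_eq_imp_space_eq[OF s(1)] sets_eq_imp_space_eq[OF s(2)] m[of UNIV] n[of UNIV]
      by (auto intro!: finite_measureI)
    have "AE \<omega> in M. 0 \<le> ?D \<omega>"
      using AE_first_passage_finite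
    proof eventually_elim
      case (elim \<omega>)
      have "ereal (T x \<omega>) \<le> ereal (T y \<omega>)"
        using first_passage_mono[OF xy(2), of X \<omega>] elim by metis
      then show ?case by simp
    qed
    then show "AE z in \<mu>. 0 \<le> z"
      unfolding \<mu>_def by (subst AE_distr_iff) (auto simp: AE_density)
    show "AE z in \<nu>. 0 \<le> z"
      unfolding \<nu>_def using T_nonneg[of "y - x"] by (subst AE_density) (auto simp: AE_distr_iff)
    fix q :: real assume "q > 0"
    \<comment> \<open>The transforms are known at values of the exponent, and every positive
      \<open>q\<close> is such a value.\<close>
    then obtain \<theta> where \<theta>: "\<theta> > 0" "\<psi> \<theta> = q" using exponent_surj by blast
    have "(\<integral>z. exp (- q * z) \<partial>\<mu>) = expectation (\<lambda>\<omega>. indicator A \<omega> * exp (- \<psi> \<theta> * ?D \<omega>))"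
      unfolding \<mu>_def \<theta>(2) by (simp add: integral_distr integral_density)
    also have "\<dots> = prob A * exp (- \<theta> * (y - x))" by (rule passage_transform_past[OF \<theta>(1) xy A])
    also have "exp (- \<theta> * (y - x)) = expectation (\<lambda>\<omega>. exp (- \<psi> \<theta> * T (y - x) \<omega>))"
      using passage_transform[OF \<theta>(1), of "y - x"] xy by simp
    also have "prob A * expectation (\<lambda>\<omega>. exp (- \<psi> \<theta> * T (y - x) \<omega>)) = (\<integral>z. exp (- q * z) \<partial>\<nu>)"
      unfolding \<nu>_def \<theta>(2) by (subst integral_density) (auto simp: integral_distr)
    finally show "(\<integral>z. exp (- q * z) \<partial>\<mu>) = (\<integral>z. exp (- q * z) \<partial>\<nu>)" .
  qed
  then show ?thesis using m[OF C] n[OF C] by simp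
qed

text \<open>Induction on the number of increments: the event about those before index
  \<open>k\<close> is prior to \<open>\<tau> (x k)\<close>, so it can serve as the conditioning
  event for the next increment.\<close>

lemma passage_increments:
  fixes x :: "nat \<Rightarrow> real"
  assumes x: "0 \<le> x 0" "\<And>i. i < n \<Longrightarrow> x i \<le> x (Suc i)" and C: "\<And>i. i < n \<Longrightarrow> C i \<in> sets borel"
  shows "prob {\<omega> \<in> space M. \<forall>i<n. T (x (Suc i)) \<omega> - T (x i) \<omega> \<in> C i}
    = (\<Prod>i<n. prob {\<omega> \<in> space M. T (x (Suc i) - x i) \<omega> \<in> C i})"
proof -
  have mono: "x i \<le> x j" if "i \<le> j" "j \<le> n" for i j
    using that x(2) by (induction j rule: dec_induct) (auto intro: order_trans)
  have "{\<omega> \<in> space M. \<forall>i<k. T (x (Suc i)) \<omega> - T (x i) \<omega> \<in> C i} \<in> passage_sigma (x k) \<and>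
    prob {\<omega> \<in> space M. \<forall>i<k. T (x (Suc i)) \<omega> - T (x i) \<omega> \<in> C i}
    = (\<Prod>i<k. prob {\<omega> \<in> space M. T (x (Suc i) - x i) \<omega> \<in> C i})" if "k \<le> n" for k
    using that
  proof (induction k)
    case 0
    show ?case using sets.top[of "passage_algebra (x 0)"] by (simp add: sets_passage_algebra prob_space)
  next
    case (Suc k)
    let ?E = "{\<omega> \<in> space M. \<forall>i<k. T (x (Suc i)) \<omega> - T (x i) \<omega> \<in> C i}"
    let ?G = "{\<omega> \<in> space M. T (x (Suc k)) \<omega> - T (x k) \<omega> \<in> C k}"
    have eq: "{\<omega> \<in> space M. \<forall>i<Suc k. T (x (Suc i)) \<omega> - T (x i) \<omega> \<in> C i} = ?E \<inter> ?G"
      by (auto simp: less_Suc_eq)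
    have E: "?E \<in> passage_sigma (x k)" using Suc by simp
    then have E': "?E \<in> passage_sigma (x (Suc k))"
      using passage_sigma_mono[of "x k" "x (Suc k)"] x(2) Suc by auto
    have [measurable]: "T (x (Suc k)) \<in> borel_measurable (passage_algebra (x (Suc k)))"
      "T (x k) \<in> borel_measurable (passage_algebra (x (Suc k)))" "C k \<in> sets borel"
      using Suc x(2) C by (auto intro: measurable_T_passage_algebra)
    have "{\<omega> \<in> space (passage_algebra (x (Suc k))). T (x (Suc k)) \<omega> - T (x k) \<omega> \<in> C k} \<in> sets (passage_algebra (x (Suc k)))"
      by measurable
    then have "?E \<inter> ?G \<in> passage_sigma (x (Suc k))"
      using E' sets.Int[of ?E "passage_algebra (x (Suc k))" ?G] by (simp add: sets_passage_algebra)
    moreover have "prob (?E \<inter> ?G) = prob ?E * prob {\<omega> \<in> space M. T (x (Suc k) - x k) \<omega> \<in> C k}"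
      using mono[of 0 k] x Suc C by (intro passage_increment E) auto
    ultimately show ?case unfolding eq using Suc by simp
  qed
  then show ?thesis by blast
qed

end

end

end

section \<open>The time change\<close>

text \<open>The pair of identity maps into \<open>F\<close> and \<open>G\<close> has a product law,
  so one copy of \<open>\<omega>\<close> can be frozen while the other is integrated. Measurability
  of \<open>h\<close> with respect to \<open>F\<close> and \<open>G\<close>, not merely
  \<open>M\<close>, makes this possible.\<close>

lemma (in prob_space) nn_integral_indep_freeze:
  assumes ind: "indep_set (sets F) (sets G)" and sp: "space F = space M" "space G = space M"
    and h: "h \<in> borel_measurable (F \<Otimes>\<^sub>M G)"
  shows "(\<integral>\<^sup>+\<omega>. h (\<omega>, \<omega>) \<partial>M) = (\<integral>\<^sup>+\<omega>. \<integral>\<^sup>+\<omega>'. h (\<omega>, \<omega>') \<partial>M \<partial>M)"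
proof -
  have iv: "indep_var F (\<lambda>\<omega>. \<omega>) G (\<lambda>\<omega>. \<omega>)"
    by (rule indep_var_of_indep_set[OF ind sp]) simp_all
  then have FM: "(\<lambda>\<omega>. \<omega>) \<in> measurable M F" and GM: "(\<lambda>\<omega>. \<omega>) \<in> measurable M G"
    and eq: "distr M F (\<lambda>\<omega>. \<omega>) \<Otimes>\<^sub>M distr M G (\<lambda>\<omega>. \<omega>) = distr M (F \<Otimes>\<^sub>M G) (\<lambda>\<omega>. (\<omega>, \<omega>))"
    by (simp_all add: indep_var_distribution_eq)
  interpret G: prob_space "distr M G (\<lambda>\<omega>. \<omega>)" using GM by (rule prob_space_distr)
  have [measurable]: "h \<in> borel_measurable (F \<Otimes>\<^sub>M distr M G (\<lambda>\<omega>. \<omega>))"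
    using h by (simp cong: measurable_cong_sets)
  have "(\<integral>\<^sup>+\<omega>. h (\<omega>, \<omega>) \<partial>M) = integral\<^sup>N (distr M (F \<Otimes>\<^sub>M G) (\<lambda>\<omega>. (\<omega>, \<omega>))) h"
    using FM GM h by (subst nn_integral_distr) (auto intro!: measurable_Pair)
  also have "\<dots> = (\<integral>\<^sup>+\<omega>. \<integral>\<^sup>+\<omega>'. h (\<omega>, \<omega>') \<partial>distr M G (\<lambda>\<omega>. \<omega>) \<partial>distr M F (\<lambda>\<omega>. \<omega>))"
    unfolding eq[symmetric] using h
    by (intro G.nn_integral_fst[symmetric]) (simp cong: measurable_cong_sets)
  also have "\<dots> = (\<integral>\<^sup>+\<omega>. \<integral>\<^sup>+\<omega>'. h (\<omega>, \<omega>') \<partial>distr M G (\<lambda>\<omega>. \<omega>) \<partial>M)"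
    by (rule nn_integral_distr[OF FM]) (rule G.borel_measurable_nn_integral, simp)
  also have "\<dots> = (\<integral>\<^sup>+\<omega>. \<integral>\<^sup>+\<omega>'. h (\<omega>, \<omega>') \<partial>M \<partial>M)"
  proof (rule nn_integral_cong)
    fix \<omega> assume "\<omega> \<in> space M"
    then show "(\<integral>\<^sup>+\<omega>'. h (\<omega>, \<omega>') \<partial>distr M G (\<lambda>\<omega>. \<omega>)) = (\<integral>\<^sup>+\<omega>'. h (\<omega>, \<omega>') \<partial>M)"
      using sp h by (intro nn_integral_distr[OF GM]) (auto intro: measurable_Pair2)
  qed
  finally show ?thesis .
qed

text \<open>The limit is the supremum of the earlier values; this supplies one half of the cadlag
  property of the time change.\<close>

lemma mono_on_has_left_limit:
  fixes f :: "real \<Rightarrow> real"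
  assumes mono: "mono_on {0..} f" and t: "0 < t"
  shows "\<exists>l. (f \<longlongrightarrow> l) (at_left t)"
proof -
  let ?S = "f ` {0..<t}"
  have le: "f s \<le> f t" if "0 \<le> s" "s \<le> t" for s using mono that by (auto intro: mono_onD)
  have bdd: "bdd_above ?S" by (rule bdd_aboveI[of _ "f t"]) (auto intro: le)
  have ne: "?S \<noteq> {}" using t by auto
  have "(f \<longlongrightarrow> Sup ?S) (at_left t)"
  proof (rule order_tendstoI)
    fix a assume "a < Sup ?S"
    then obtain s where s: "0 \<le> s" "s < t" "a < f s" using less_cSup_iff[OF ne bdd] by auto
    have "a < f r" if "s < r" "r < t" for r
      using mono_onD[OF mono, of s r] s that by auto
    then show "eventually (\<lambda>r. a < f r) (at_left t)"
      using s by (auto simp: eventually_at_left_field)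
  next
    fix a assume a: "Sup ?S < a"
    have "f r < a" if "0 < r" "r < t" for r
      using cSup_upper[OF _ bdd, of "f r"] that a by force
    then show "eventually (\<lambda>r. f r < a) (at_left t)"
      using t by (auto simp: eventually_at_left_field)
  qed
  then show ?thesis by blast
qed

text \<open>The first and second moments of \<open>exp (X t - c * t)\<close> are both
  \<open>1\<close>, so its variance is \<open>0\<close>. Right continuity passes from rational times
  to all times.\<close>

lemma (in spectrally_negative_levy_process) linear_exponent_imp_pure_drift:
  assumes "has_laplace_exponent M X (\<lambda>\<theta>. c * \<theta>)"
  shows "pure_drift M X"
proof -
  have one: "AE \<omega> in M. X t \<omega> = c * t" if t: "0 < t" for t
  proof -
    let ?Z = "\<lambda>\<omega>. exp (X t \<omega> - c * t)"
    have eq: "?Z = (\<lambda>\<omega>. exp (1 * X t \<omega>) * exp (- (c * t)))"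
      "(\<lambda>\<omega>. (?Z \<omega>)\<^sup>2) = (\<lambda>\<omega>. exp (2 * X t \<omega>) * exp (- (2 * (c * t))))"
      by (simp_all add: fun_eq_iff power2_eq_square flip: exp_add)
    have scaled: "integrable M (\<lambda>\<omega>. exp (\<theta> * X t \<omega>) * exp (- (\<theta> * (c * t))))"
      "expectation (\<lambda>\<omega>. exp (\<theta> * X t \<omega>) * exp (- (\<theta> * (c * t)))) = 1" if "0 \<le> \<theta>" for \<theta>
    proof -
      note moment = exp_moment[OF assms t that]
      show "integrable M (\<lambda>\<omega>. exp (\<theta> * X t \<omega>) * exp (- (\<theta> * (c * t))))"
        by (intro integrable_mult_left moment(1))
      have "expectation (\<lambda>\<omega>. exp (\<theta> * X t \<omega>) * exp (- (\<theta> * (c * t)))) = exp (c * \<theta> * t) * exp (- (\<theta> * (c * t)))"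
        unfolding integral_mult_left_zero moment(2) ..
      also have "\<dots> = 1" unfolding exp_add[symmetric] by simp
      finally show "expectation (\<lambda>\<omega>. exp (\<theta> * X t \<omega>) * exp (- (\<theta> * (c * t)))) = 1" .
    qed
    have Z: "integrable M ?Z" "expectation ?Z = 1"
      unfolding eq(1) using scaled[of 1] by (simp_all only: mult_1 zero_le_one)
    have Z2: "integrable M (\<lambda>\<omega>. (?Z \<omega>)\<^sup>2)" "expectation (\<lambda>\<omega>. (?Z \<omega>)\<^sup>2) = 1"
      unfolding eq(2) using scaled[of 2] by (simp_all only: zero_le_numeral)
    have eq2: "(\<lambda>\<omega>. (?Z \<omega> - 1)\<^sup>2) = (\<lambda>\<omega>. (?Z \<omega>)\<^sup>2 - 2 * ?Z \<omega> + 1)"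
      by (simp add: fun_eq_iff power2_diff)
    have "integrable M (\<lambda>\<omega>. (?Z \<omega> - 1)\<^sup>2)" "expectation (\<lambda>\<omega>. (?Z \<omega> - 1)\<^sup>2) = 0"
      unfolding eq2 using Z Z2 by (simp_all add: prob_space)
    then have "AE \<omega> in M. (?Z \<omega> - 1)\<^sup>2 = 0"
      using integral_nonneg_eq_0_iff_AE[of M "\<lambda>\<omega>. (?Z \<omega> - 1)\<^sup>2"] by simp
    then show ?thesis by eventually_elim simp
  qed
  have "AE \<omega> in M. \<forall>r\<in>\<rat> \<inter> {0<..}. X r \<omega> = c * r"
  proof (rule AE_ball_countable[THEN iffD2])
    show "countable (\<rat> \<inter> {0<..} :: real set)" using countable_rat by (rule countable_subset[rotated]) auto
  qed (use one in auto)
  with AE_space have "AE \<omega> in M. \<forall>t\<ge>0. X t \<omega> = c * t"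
  proof eventually_elim
    case (elim \<omega>)
    show ?case
    proof (intro allI impI, rule ccontr)
      fix t :: real assume t: "0 \<le> t" and "X t \<omega> \<noteq> c * t"
      then have "X t \<omega> - c * t \<noteq> 0" by simp
      moreover have "((\<lambda>s. X s \<omega> - c * s) \<longlongrightarrow> X t \<omega> - c * t) (at_right t)"
        by (intro tendsto_intros right_continuousD[OF elim(1) t])
      ultimately have "eventually (\<lambda>s. X s \<omega> - c * s \<noteq> 0) (at_right t)"
        by (rule tendsto_imp_eventually_ne[rotated])
      then obtain b where b: "t < b" "\<And>s. t < s \<Longrightarrow> s < b \<Longrightarrow> X s \<omega> - c * s \<noteq> 0"
        by (auto simp: eventually_at_right_field)
      obtain r where "r \<in> \<rat>" "t < r" "r < b" using Rats_dense_in_real[OF b(1)] by auto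
      then show False using elim(2) b(2)[of r] t by auto
    qed
  qed
  then show ?thesis unfolding pure_drift_def by blast
qed

text \<open>Of the exponent only positivity and surjectivity on the positive axis are kept, which
  separates the path argument from the analysis of the Levy measure. \<open>V\<close> is the clock
  before killing, and the pair \<open>(V, e)\<close> is independent of the passage times.\<close>

locale subordinated_passage =
  spectrally_negative_levy_process M X + V: subordinator M V
  for M :: "'a measure" and X V :: "real \<Rightarrow> 'a \<Rightarrow> real" +
  fixes \<psi> :: "real \<Rightarrow> real" and \<beta> :: real and e :: "'a \<Rightarrow> ereal" and Y :: "real \<Rightarrow> 'a \<Rightarrow> ereal"
  assumes exponent: "has_laplace_exponent M X \<psi>"
    and exponent_pos: "\<forall>\<theta>>0. \<psi> \<theta> > 0"
    and exponent_surj: "\<forall>q>0. \<exists>\<theta>>0. \<psi> \<theta> = q"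
    and Y_killed: "killed_subordinator_via M \<beta> V e Y"
    and Y_indep: "indep_set
         (sigma_sets (space M) (process_sigma M {0..} V \<union> rv_sigma M e))
         (process_sigma M {0..} (first_passage X))"
begin

lemmas passage_facts =
  AE_first_passage_finite[OF exponent exponent_pos exponent_surj]
  passage_transform[OF exponent exponent_pos exponent_surj]
  AE_T_0[OF exponent exponent_pos exponent_surj]
  passage_increments[OF exponent exponent_pos exponent_surj]

text \<open>This \<sigma>-algebra is frozen while passage times are integrated. Its companion
  \<open>joint_algebra\<close> contains the unkilled time change and turns out to be independent of
  \<open>e\<close>.\<close>

definition clock_algebra :: "'a measure" where
  "clock_algebra = sigma (space M) (process_sigma M {0..} V \<union> rv_sigma M e)"

definition joint_algebra :: "'a measure" where
  "joint_algebra = sigma (space M) (process_sigma M {0..} V \<union> process_sigma M {0..} \<tau>)"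

abbreviation "passages \<equiv> process_algebra M {0..} \<tau>"

lemma e_measurable: "e \<in> borel_measurable M"
  using Y_killed by (simp add: killed_subordinator_via_def exponential_time_def)

lemma rv_sigma_e: "rv_sigma M e \<subseteq> events"
  using e_measurable by (auto simp: rv_sigma_def intro: measurable_sets)

lemma process_sigma_tau: "process_sigma M {0..} \<tau> \<subseteq> events"
  by (rule process_sigma_least) auto

lemma clock_algebra_sets:
  "sets clock_algebra = sigma_sets (space M) (process_sigma M {0..} V \<union> rv_sigma M e)"
  "space clock_algebra = space M"
proof -
  have "process_sigma M {0..} V \<union> rv_sigma M e \<subseteq> Pow (space M)"
    using V.process_sigma_le_events[of "{0..}"] rv_sigma_e sets.sets_into_space[of _ M] by blast
  then show "sets clock_algebra = sigma_sets (space M) (process_sigma M {0..} V \<union> rv_sigma M e)"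
    "space clock_algebra = space M"
    by (simp_all add: clock_algebra_def space_measure_of_conv)
qed

lemma joint_algebra_sets:
  "sets joint_algebra = sigma_sets (space M) (process_sigma M {0..} V \<union> process_sigma M {0..} \<tau>)"
  "space joint_algebra = space M"
proof -
  have "process_sigma M {0..} V \<union> process_sigma M {0..} \<tau> \<subseteq> Pow (space M)"
    using V.process_sigma_le_events[of "{0..}"] process_sigma_tau sets.sets_into_space[of _ M] by blast
  then show "sets joint_algebra = sigma_sets (space M) (process_sigma M {0..} V \<union> process_sigma M {0..} \<tau>)"
    "space joint_algebra = space M"
    by (simp_all add: joint_algebra_def space_measure_of_conv)
qed

lemma joint_algebra_le: "subalgebra M joint_algebra"
  unfolding subalgebra_def joint_algebra_sets
  using V.process_sigma_le_events[of "{0..}"] process_sigma_tau by (auto intro!: sets.sigma_sets_subset)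

lemma clock_passages_indep: "indep_set (sets clock_algebra) (sets passages)"
  using Y_indep by (simp add: clock_algebra_sets sets_process_algebra)

lemma measurable_V_clock: "0 \<le> t \<Longrightarrow> V t \<in> borel_measurable clock_algebra"
  by (rule measurable_from_subalg[OF _ measurable_process_algebra[of t "{0..}" V M]])
     (auto simp: subalgebra_def clock_algebra_sets sets_process_algebra)

lemma measurable_e_clock: "e \<in> borel_measurable clock_algebra"
proof -
  have "e \<in> borel_measurable (vimage_algebra (space M) e borel)" by (rule measurable_vimage_algebra1) simp
  then show ?thesis
    by (rule measurable_from_subalg[rotated])
       (auto simp: subalgebra_def clock_algebra_sets rv_sigma_eq_vimage_algebra[symmetric])
qed

lemma measurable_V_joint: "0 \<le> t \<Longrightarrow> V t \<in> borel_measurable joint_algebra"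
  by (rule measurable_from_subalg[OF _ measurable_process_algebra[of t "{0..}" V M]])
     (auto simp: subalgebra_def joint_algebra_sets sets_process_algebra)

text \<open>The identity into a smaller \<sigma>-algebra, so that the jointly measurable passage map
  can be evaluated at a level depending on the same \<open>\<omega>\<close>.\<close>

lemma measurable_id_passages: "(\<lambda>\<omega>. \<omega>) \<in> measurable joint_algebra passages"
  by (rule measurable_from_subalg[of _ passages])
     (auto simp: subalgebra_def joint_algebra_sets sets_process_algebra)

text \<open>The cut-off \<open>max 0\<close> is there because \<open>V\<close> may be negative on a
  null event, while \<open>passages\<close> is generated by nonnegative levels.\<close>

lemma measurable_passage_time_joint:
  "(\<lambda>(x, \<omega>). T (max 0 x) \<omega>) \<in> borel_measurable (borel \<Otimes>\<^sub>M passages)"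
proof -
  have "(\<lambda>(x, \<omega>). \<tau> (max 0 x) \<omega>) \<in> borel_measurable (borel \<Otimes>\<^sub>M passages)"
    by (rule measurable_first_passage_joint) (auto intro: measurable_process_algebra)
  then have "(\<lambda>z. real_of_ereal ((\<lambda>(x, \<omega>). \<tau> (max 0 x) \<omega>) z)) \<in> borel_measurable (borel \<Otimes>\<^sub>M passages)"
    by measurable
  then show ?thesis by (simp add: passage_time_def split_def)
qed

text \<open>Off this event, which is almost sure and lies in the \<open>\<sigma>\<close>-algebra of \<open>V\<close> and \<open>\<tau>\<close>,
  the time-changed paths need not be cadlag.\<close>

definition good :: "'a set" where
  "good = {\<omega> \<in> space M. 0 \<le> V 0 \<omega> \<and>
     (\<forall>r\<in>\<rat> \<inter> {0..}. \<forall>s\<in>\<rat> \<inter> {0..}. r \<le> s \<longrightarrow> V r \<omega> \<le> V s \<omega>) \<and> (\<forall>n::nat. \<tau> (real n) \<omega> < \<infinity>)}"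

definition W :: "real \<Rightarrow> 'a \<Rightarrow> real" where
  "W t \<omega> = (if \<omega> \<in> good then T (V t \<omega>) \<omega> else 0)"

lemma good_space: "\<omega> \<in> good \<Longrightarrow> \<omega> \<in> space M"
  by (simp add: good_def)

text \<open>A decrease from \<open>s\<close> to \<open>t\<close> would persist, by right continuity,
  at rational times just after each of them, with the midpoint of the two values as
  separator.\<close>

lemma good_mono:
  assumes "\<omega> \<in> good" shows "mono_on {0..} (\<lambda>t. V t \<omega>)"
proof (rule mono_onI)
  fix s t :: real assume st: "s \<in> {0..}" "t \<in> {0..}" "s \<le> t"
  show "V s \<omega> \<le> V t \<omega>"
  proof (rule ccontr)
    assume *: "\<not> V s \<omega> \<le> V t \<omega>"
    then have "s < t" using st by (cases "s = t") auto
    define a where "a = (V s \<omega> + V t \<omega>) / 2"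
    have a: "V t \<omega> < a" "a < V s \<omega>" using * by (auto simp: a_def)
    have "eventually (\<lambda>r. a < V r \<omega>) (at_right s)" "eventually (\<lambda>r. V r \<omega> < a) (at_right t)"
      using order_tendstoD[OF V.right_continuousD] good_space[OF assms] a st by auto
    then obtain b c where bc: "s < b" "\<And>r. s < r \<Longrightarrow> r < b \<Longrightarrow> a < V r \<omega>"
       "t < c" "\<And>r. t < r \<Longrightarrow> r < c \<Longrightarrow> V r \<omega> < a"
      by (auto simp: eventually_at_right_field)
    \<comment> \<open>The bound by \<open>t\<close> ensures that \<open>r\<close> precedes
      \<open>r'\<close>.\<close>
    obtain r where r: "r \<in> \<rat>" "s < r" "r < min b t" using Rats_dense_in_real[of s "min b t"] bc \<open>s < t\<close> by auto
    obtain r' where r': "r' \<in> \<rat>" "t < r'" "r' < c" using Rats_dense_in_real[of t c] bc by auto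
    have "V r \<omega> \<le> V r' \<omega>" using assms r r' st by (auto simp: good_def)
    then show False using bc(2)[of r] bc(4)[of r'] r r' by auto
  qed
qed

lemma good_nonneg:
  assumes "\<omega> \<in> good" "0 \<le> t" shows "0 \<le> V t \<omega>"
  using mono_onD[OF good_mono[OF assms(1)], of 0 t] assms by (auto simp: good_def)

lemma good_finite:
  assumes "\<omega> \<in> good" shows "\<tau> x \<omega> = ereal (T x \<omega>)"
proof -
  obtain y :: nat where "x \<le> y" using real_arch_simple by blast
  then have "\<tau> x \<omega> < \<infinity>"
    using assms first_passage_mono[of x y X \<omega>] by (auto simp: good_def intro: le_less_trans)
  then show ?thesis
    using first_passage_nonneg[of X x \<omega>] by (cases "\<tau> x \<omega>") (auto simp: passage_time_def)
qed

lemma T_mono_good: "\<omega> \<in> good \<Longrightarrow> x \<le> y \<Longrightarrow> T x \<omega> \<le> T y \<omega>"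
  using first_passage_mono[of x y X \<omega>] by (simp add: good_finite)

lemma AE_good: "AE \<omega> in M. \<omega> \<in> good"
  using V.start V.nondecreasing_paths passage_facts(1) AE_space
proof eventually_elim
  case (elim \<omega>)
  then have "\<tau> (real n) \<omega> < \<infinity>" for n :: nat by simp
  with elim show ?case by (auto simp: good_def intro: mono_onD[where A="{0..}"])
qed

lemma good_measurable: "good \<in> sets joint_algebra"
proof -
  have [measurable]: "V t \<in> borel_measurable joint_algebra" if "t \<in> \<rat> \<inter> {0..}" for t
    using that by (intro measurable_V_joint) auto
  have [measurable]: "V 0 \<in> borel_measurable joint_algebra" by (intro measurable_V_joint) auto
  have [measurable]: "\<tau> (real n) \<in> borel_measurable joint_algebra" for n
    using measurable_compose[OF measurable_id_passages measurable_process_algebra[of "real n" "{0..}" \<tau> M]] by simp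
  have "countable (\<rat> \<inter> {0..} :: real set)" using countable_rat by (rule countable_subset[rotated]) auto
  then have "{\<omega> \<in> space joint_algebra. 0 \<le> V 0 \<omega> \<and>
     (\<forall>r\<in>\<rat> \<inter> {0..}. \<forall>s\<in>\<rat> \<inter> {0..}. r \<le> s \<longrightarrow> V r \<omega> \<le> V s \<omega>) \<and> (\<forall>n::nat. \<tau> (real n) \<omega> < \<infinity>)} \<in> sets joint_algebra"
    by (intro sets.sets_Collect sets.sets_Collect_countable_All' sets.sets_Collect_countable_Ball) measurable
  then show ?thesis by (simp add: good_def joint_algebra_sets)
qed

lemma measurable_W:
  assumes "0 \<le> t" shows "W t \<in> borel_measurable joint_algebra"
proof -
  have "(\<lambda>\<omega>. (V t \<omega>, \<omega>)) \<in> measurable joint_algebra (borel \<Otimes>\<^sub>M passages)"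
    using measurable_V_joint[OF assms] measurable_id_passages by measurable
  from measurable_compose[OF this measurable_passage_time_joint]
  have [measurable]: "(\<lambda>\<omega>. T (max 0 (V t \<omega>)) \<omega>) \<in> borel_measurable joint_algebra" by simp
  note [measurable] = good_measurable
  have "W t = (\<lambda>\<omega>. if \<omega> \<in> good then T (max 0 (V t \<omega>)) \<omega> else 0)"
    using good_nonneg assms by (auto simp: W_def fun_eq_iff)
  then show ?thesis by simp
qed

lemma rv_W: "0 \<le> t \<Longrightarrow> W t \<in> borel_measurable M"
  by (rule measurable_from_subalg[OF joint_algebra_le measurable_W])

lemma W_mono: "mono_on {0..} (\<lambda>t. W t \<omega>)"
proof (rule mono_onI)
  fix s t :: real assume "s \<in> {0..}" "t \<in> {0..}" "s \<le> t"
  then show "W s \<omega> \<le> W t \<omega>"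
    using T_mono_good[OF _ mono_onD[OF good_mono, of \<omega> s t]] by (cases "\<omega> \<in> good") (simp_all add: W_def)
qed

text \<open>Some level \<open>r\<close> above \<open>V t\<close> already has a passage time below
  \<open>a\<close>, by right continuity in the level; right continuity of \<open>V\<close> keeps
  \<open>V s\<close> below \<open>r\<close> shortly after \<open>t\<close>.\<close>

lemma cadlag_W: "cadlag (\<lambda>t. W t \<omega>)"
  unfolding cadlag_def
proof (intro conjI allI impI)
  show "\<exists>l. ((\<lambda>t. W t \<omega>) \<longlongrightarrow> l) (at_left t)" if "0 < t" for t
    by (rule mono_on_has_left_limit[OF W_mono that])
  fix t :: real assume t: "0 \<le> t"
  show "continuous (at_right t) (\<lambda>t. W t \<omega>)"
  proof (cases "\<omega> \<in> good")
    case True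
    have "((\<lambda>t. W t \<omega>) \<longlongrightarrow> W t \<omega>) (at_right t)"
    proof (rule order_tendstoI)
      fix a assume a: "a < W t \<omega>"
      have "a < W s \<omega>" if "t < s" for s
        using less_le_trans[OF a mono_onD[OF W_mono, of t s \<omega>]] t that by simp
      then show "eventually (\<lambda>s. a < W s \<omega>) (at_right t)"
        by (auto simp: eventually_at_right_field intro: exI[of _ "t + 1"])
    next
      fix a assume a: "W t \<omega> < a"
      then have "\<tau> (V t \<omega>) \<omega> < ereal a" using True by (simp add: W_def good_finite)
      then obtain r where r: "V t \<omega> < r" "\<tau> r \<omega> < ereal a"
        using first_passage_right_continuous[of X "V t \<omega>" \<omega> "ereal a"] by blast
      have "eventually (\<lambda>s. V s \<omega> < r) (at_right t)"
        using order_tendstoD(2)[OF V.right_continuousD[OF good_space[OF True] t] r(1)] .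
      then show "eventually (\<lambda>s. W s \<omega> < a) (at_right t)"
      proof eventually_elim
        case (elim s)
        have "\<tau> (V s \<omega>) \<omega> < ereal a"
          using first_passage_mono[of "V s \<omega>" r X \<omega>] elim r(2) by (auto intro: le_less_trans)
        then show ?case using True by (simp add: W_def good_finite)
      qed
    qed
    then show ?thesis by (simp add: continuous_within)
  next
    case False
    then have "(\<lambda>t. W t \<omega>) = (\<lambda>_. 0)" by (simp add: W_def fun_eq_iff)
    then show ?thesis by simp
  qed
qed

text \<open>The law of the passage time as a kernel in the level. Increments of passage times depend
  in law only on the level difference, so \<open>u\<close> will be an increment of \<open>V\<close>;
  \<open>max 0\<close> makes the kernel total.\<close>

definition \<mu> :: "real set \<Rightarrow> real \<Rightarrow> real" where
  "\<mu> C u = prob {\<omega> \<in> space M. T (max 0 u) \<omega> \<in> C}"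

lemma \<mu>_bounds: "0 \<le> \<mu> C u" "\<mu> C u \<le> 1"
  by (simp_all add: \<mu>_def)

lemma measurable_\<mu>:
  assumes C: "C \<in> sets borel" shows "\<mu> C \<in> borel_measurable borel"
proof -
  have sub: "subalgebra M passages"
    using process_sigma_tau by (auto simp: subalgebra_def sets_process_algebra)
  have "(\<lambda>(x, \<omega>). T (max 0 x) \<omega>) -` C \<inter> space (borel \<Otimes>\<^sub>M passages) \<in> sets (borel \<Otimes>\<^sub>M passages)"
    by (rule measurable_sets[OF measurable_passage_time_joint C])
  \<comment> \<open>The emeasure of a section is taken in \<open>M\<close>, so the set is carried
    from the product with \<open>passages\<close> to the product with \<open>M\<close>.\<close>
  moreover have "sets ((borel :: real measure) \<Otimes>\<^sub>M passages) \<subseteq> sets (borel \<Otimes>\<^sub>M M)"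
  proof -
    have "{a \<times> b |a b. a \<in> sets (borel :: real measure) \<and> b \<in> sets passages} \<subseteq> {a \<times> b |a b. a \<in> sets borel \<and> b \<in> sets M}"
      using sub unfolding subalgebra_def by blast
    then show ?thesis unfolding sets_pair_measure by (simp add: sigma_sets_mono')
  qed
  ultimately have "(\<lambda>(x, \<omega>). T (max 0 x) \<omega>) -` C \<inter> space (borel \<Otimes>\<^sub>M M) \<in> sets (borel \<Otimes>\<^sub>M M)"
    by (auto simp: space_pair_measure)
  from measurable_emeasure_Pair[OF this]
  have "(\<lambda>u. emeasure M (Pair u -` ((\<lambda>(x, \<omega>). T (max 0 x) \<omega>) -` C \<inter> space (borel \<Otimes>\<^sub>M M)))) \<in> borel_measurable borel" .
  moreover have "Pair u -` ((\<lambda>(x, \<omega>). T (max 0 x) \<omega>) -` C \<inter> space (borel \<Otimes>\<^sub>M M)) = {\<omega> \<in> space M. T (max 0 u) \<omega> \<in> C}" for u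
    by (auto simp: space_pair_measure)
  ultimately have "(\<lambda>u. enn2real (emeasure M {\<omega> \<in> space M. T (max 0 u) \<omega> \<in> C})) \<in> borel_measurable borel"
    by simp
  then show ?thesis by (simp add: \<mu>_def[abs_def] measure_def)
qed

text \<open>With \<open>V\<close> frozen, the levels \<open>V (s i)\<close> form a nondecreasing
  deterministic sequence, so the increments of the passage times are independent with laws given by
  the level differences. Integrating over \<open>V\<close> gives the expectation of the
  product.\<close>

lemma prob_W_increments:
  fixes s :: "nat \<Rightarrow> real"
  assumes s: "0 \<le> s 0" "\<And>i. i < n \<Longrightarrow> s i \<le> s (Suc i)" and C: "\<And>i. i < n \<Longrightarrow> C i \<in> sets borel"
  shows "prob {\<omega> \<in> space M. \<forall>i<n. W (s (Suc i)) \<omega> - W (s i) \<omega> \<in> C i}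
    = expectation (\<lambda>\<omega>. \<Prod>i<n. \<mu> (C i) (V (s (Suc i)) \<omega> - V (s i) \<omega>))"
proof -
  have s_nonneg: "0 \<le> s i" if "i \<le> n" for i
    using that
  proof (induction i)
    case (Suc i)
    then show ?case using s(2)[of i] by simp
  qed (simp add: s(1))
  \<comment> \<open>The first argument supplies the level, the second the path whose passage is
    timed; on the diagonal over \<open>good\<close> this is \<open>W (s i)\<close>.\<close>
  define U where "U i \<omega> \<omega>' = T (max 0 (V (s i) \<omega>)) \<omega>'" for i \<omega> \<omega>'
  have U: "(\<lambda>z. U i (fst z) (snd z)) \<in> borel_measurable (clock_algebra \<Otimes>\<^sub>M passages)" if "i \<le> n" for i
  proof -
    have [measurable]: "V (s i) \<in> borel_measurable clock_algebra" using s_nonneg[OF that] by (rule measurable_V_clock)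
    have "(\<lambda>z. (V (s i) (fst z), snd z)) \<in> measurable (clock_algebra \<Otimes>\<^sub>M passages) (borel \<Otimes>\<^sub>M passages)"
      by measurable
    from measurable_compose[OF this measurable_passage_time_joint] show ?thesis by (simp add: U_def)
  qed
  let ?S = "{z \<in> space (clock_algebra \<Otimes>\<^sub>M passages). \<forall>i\<in>{..<n}. U (Suc i) (fst z) (snd z) - U i (fst z) (snd z) \<in> C i}"
  have S: "?S \<in> sets (clock_algebra \<Otimes>\<^sub>M passages)"
  proof (rule sets.sets_Collect_finite_All)
    fix i assume "i \<in> {..<n}"
    then have "(\<lambda>z. U (Suc i) (fst z) (snd z) - U i (fst z) (snd z)) \<in> borel_measurable (clock_algebra \<Otimes>\<^sub>M passages)"
      by (intro borel_measurable_diff U) auto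
    from measurable_sets[OF this C[of i]] \<open>i \<in> {..<n}\<close>
    show "{z \<in> space (clock_algebra \<Otimes>\<^sub>M passages). U (Suc i) (fst z) (snd z) - U i (fst z) (snd z) \<in> C i} \<in> sets (clock_algebra \<Otimes>\<^sub>M passages)"
      by (simp add: vimage_def Int_def conj_commute)
  qed simp
  define h :: "'a \<times> 'a \<Rightarrow> ennreal" where "h = indicator ?S"
  have h: "h \<in> borel_measurable (clock_algebra \<Otimes>\<^sub>M passages)" unfolding h_def using S by simp
  have h_eq: "h (\<omega>, \<omega>') = indicator {\<omega>' \<in> space M. \<forall>i<n. U (Suc i) \<omega> \<omega>' - U i \<omega> \<omega>' \<in> C i} \<omega>'"
    if "\<omega> \<in> space M" for \<omega> \<omega>'
    using that by (auto simp: h_def indicator_def space_pair_measure clock_algebra_sets)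
  let ?G = "\<lambda>\<omega>. \<Prod>i<n. \<mu> (C i) (V (s (Suc i)) \<omega> - V (s i) \<omega>)"
  let ?A = "{\<omega> \<in> space M. \<forall>i\<in>{..<n}. W (s (Suc i)) \<omega> - W (s i) \<omega> \<in> C i}"
  have A: "?A \<in> events"
  proof (rule sets.sets_Collect_finite_All)
    fix i assume "i \<in> {..<n}"
    then have "(\<lambda>\<omega>. W (s (Suc i)) \<omega> - W (s i) \<omega>) \<in> borel_measurable M"
      using s_nonneg[of i] s_nonneg[of "Suc i"] by (intro borel_measurable_diff rv_W) auto
    from measurable_sets[OF this C[of i]] \<open>i \<in> {..<n}\<close>
    show "{\<omega> \<in> space M. W (s (Suc i)) \<omega> - W (s i) \<omega> \<in> C i} \<in> events"
      by (simp add: vimage_def Int_def conj_commute)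
  qed simp
  have UW: "U i \<omega> \<omega> = W (s i) \<omega>" if "\<omega> \<in> good" "i \<le> n" for i \<omega>
    using good_nonneg[OF that(1) s_nonneg[OF that(2)]] that(1) by (simp add: U_def W_def)
  have "ennreal (prob ?A) = (\<integral>\<^sup>+\<omega>. indicator ?A \<omega> \<partial>M)" using A by (simp add: emeasure_eq_measure)
  also have "\<dots> = (\<integral>\<^sup>+\<omega>. h (\<omega>, \<omega>) \<partial>M)"
  proof (rule nn_integral_cong_AE)
    show "AE \<omega> in M. indicator ?A \<omega> = h (\<omega>, \<omega>)"
      using AE_good
    proof eventually_elim
      case (elim \<omega>)
      have "(\<forall>i\<in>{..<n}. W (s (Suc i)) \<omega> - W (s i) \<omega> \<in> C i) \<longleftrightarrow> (\<forall>i<n. U (Suc i) \<omega> \<omega> - U i \<omega> \<omega> \<in> C i)"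
        by (simp add: UW[OF elim] Ball_def)
      then show ?case using good_space[OF elim] by (simp add: h_eq indicator_def)
    qed
  qed
  also have "\<dots> = (\<integral>\<^sup>+\<omega>. \<integral>\<^sup>+\<omega>'. h (\<omega>, \<omega>') \<partial>M \<partial>M)"
    using clock_algebra_sets by (intro nn_integral_indep_freeze[OF clock_passages_indep _ _ h]) auto
  also have "\<dots> = (\<integral>\<^sup>+\<omega>. ennreal (?G \<omega>) \<partial>M)"
  proof (rule nn_integral_cong_AE)
    show "AE \<omega> in M. (\<integral>\<^sup>+\<omega>'. h (\<omega>, \<omega>') \<partial>M) = ennreal (?G \<omega>)"
      using AE_good
    proof eventually_elim
      case (elim \<omega>)
      have V0: "0 \<le> V (s i) \<omega>" if "i \<le> n" for i using good_nonneg[OF elim s_nonneg[OF that]] .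
      have Vm: "V (s i) \<omega> \<le> V (s (Suc i)) \<omega>" if "i < n" for i
        using mono_onD[OF good_mono[OF elim], of "s i" "s (Suc i)"] s(2)[OF that] s_nonneg[of i] that by auto
      define B where "B = {\<omega>' \<in> space M. \<forall>i<n. T (V (s (Suc i)) \<omega>) \<omega>' - T (V (s i) \<omega>) \<omega>' \<in> C i}"
      have B_event: "B \<in> events"
      proof -
        have "{\<omega>' \<in> space M. \<forall>i\<in>{..<n}. T (V (s (Suc i)) \<omega>) \<omega>' - T (V (s i) \<omega>) \<omega>' \<in> C i} \<in> events"
        proof (rule sets.sets_Collect_finite_All)
          fix i assume "i \<in> {..<n}"
          then have Ci: "C i \<in> sets borel" using C by simp
          have "(\<lambda>\<omega>'. T (V (s (Suc i)) \<omega>) \<omega>' - T (V (s i) \<omega>) \<omega>') \<in> borel_measurable M"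
            by (intro borel_measurable_diff measurable_T)
          from measurable_sets[OF this Ci]
          show "{\<omega>' \<in> space M. T (V (s (Suc i)) \<omega>) \<omega>' - T (V (s i) \<omega>) \<omega>' \<in> C i} \<in> events"
            by (simp only: vimage_def Int_def mem_Collect_eq conj_commute)
        qed simp
        then show ?thesis by (simp only: B_def Ball_def lessThan_iff)
      qed
      have UV: "U i \<omega> \<omega>' = T (V (s i) \<omega>) \<omega>'" if "i \<le> n" for i \<omega>'
        using V0[OF that] by (simp add: U_def)
      have "h (\<omega>, \<omega>') = indicator B \<omega>'" for \<omega>'
      proof -
        have "(\<forall>i<n. U (Suc i) \<omega> \<omega>' - U i \<omega> \<omega>' \<in> C i) \<longleftrightarrow> (\<forall>i<n. T (V (s (Suc i)) \<omega>) \<omega>' - T (V (s i) \<omega>) \<omega>' \<in> C i)"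
          by (simp add: UV)
        then show ?thesis unfolding h_eq[OF good_space[OF elim]] B_def by (simp only: indicator_def mem_Collect_eq)
      qed
      then have "(\<integral>\<^sup>+\<omega>'. h (\<omega>, \<omega>') \<partial>M) = (\<integral>\<^sup>+\<omega>'. indicator B \<omega>' \<partial>M)"
        by (simp only:)
      also have "\<dots> = ennreal (prob B)" using B_event by (simp add: emeasure_eq_measure)
      also have "prob B = (\<Prod>i<n. prob {\<omega>' \<in> space M. T (V (s (Suc i)) \<omega> - V (s i) \<omega>) \<omega>' \<in> C i})"
        unfolding B_def
      proof (rule passage_facts(4)[where x="\<lambda>i. V (s i) \<omega>" and C=C and n=n])
        show "0 \<le> V (s 0) \<omega>" by (rule V0) simp
      qed (rule Vm C, assumption)+
      also have "\<dots> = ?G \<omega>"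
        using Vm by (intro prod.cong) (auto simp: \<mu>_def)
      finally show ?case .
    qed
  qed
  also have "\<dots> = ennreal (expectation ?G)"
  proof (rule nn_integral_eq_integral)
    have bd: "0 \<le> ?G \<omega>" "?G \<omega> \<le> 1" for \<omega>
      by (auto intro!: prod_nonneg prod_le_1 simp: \<mu>_bounds)
    show "integrable M ?G"
    proof (rule integrable_const_bound[where B=1])
      have [measurable]: "V (s i) \<in> borel_measurable M" if "i \<le> n" for i using s_nonneg[OF that] by (rule V.rv)
      show "?G \<in> borel_measurable M"
      proof (rule borel_measurable_prod)
        fix i assume i: "i \<in> {..<n}"
        then have "(\<lambda>\<omega>. V (s (Suc i)) \<omega> - V (s i) \<omega>) \<in> borel_measurable M" by simp
        from measurable_compose[OF this measurable_\<mu>[OF C]] i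
        show "(\<lambda>\<omega>. \<mu> (C i) (V (s (Suc i)) \<omega> - V (s i) \<omega>)) \<in> borel_measurable M" by simp
      qed
    qed (use bd in auto)
    show "AE \<omega> in M. 0 \<le> ?G \<omega>" using bd by auto
  qed
  finally have "ennreal (prob ?A) = ennreal (expectation ?G)" .
  moreover have "0 \<le> expectation ?G"
    by (intro integral_nonneg_AE AE_I2 prod_nonneg) (simp add: \<mu>_bounds)
  ultimately have "prob ?A = expectation ?G" by simp
  then show ?thesis by (simp only: Ball_def lessThan_iff)
qed

lemma prob_W_increment:
  assumes "0 \<le> a" "a \<le> b" "C \<in> sets borel"
  shows "prob {\<omega> \<in> space M. W b \<omega> - W a \<omega> \<in> C} = expectation (\<lambda>\<omega>. \<mu> C (V b \<omega> - V a \<omega>))"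
  using prob_W_increments[of "\<lambda>i. if i = 0 then a else b" 1 "\<lambda>_. C"] assms by simp

text \<open>The law of the increments of \<open>W\<close> is an expectation over increments of
  \<open>V\<close>: independence of the latter factors the expectation, and their stationarity
  changes the law that is integrated.\<close>

lemma subordinator_W: "subordinator M W"
proof
  show "W t \<in> borel_measurable M" if "0 \<le> t" for t using that by (rule rv_W)
  show W0: "AE \<omega> in M. W 0 \<omega> = 0"
    using V.start passage_facts(3) by eventually_elim (simp add: W_def)
  show "cadlag (\<lambda>t. W t \<omega>)" for \<omega> by (rule cadlag_W)
  show "AE \<omega> in M. mono_on {0..} (\<lambda>t. W t \<omega>)" using W_mono by simp
next
  fix s :: "nat \<Rightarrow> real" and n
  assume s: "0 \<le> s 0" "\<And>i. i < n \<Longrightarrow> s i \<le> s (Suc i)"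
  let ?D = "\<lambda>i \<omega>. W (s (Suc i)) \<omega> - W (s i) \<omega>" and ?E = "\<lambda>i \<omega>. V (s (Suc i)) \<omega> - V (s i) \<omega>"
  have s_nonneg: "0 \<le> s i" if "i \<le> n" for i
    using that
  proof (induction i)
    case (Suc i)
    then show ?case using s(2)[of i] by simp
  qed (simp add: s(1))
  have D: "random_variable borel (?D i)" if "i < n" for i
    using s_nonneg[of i] s_nonneg[of "Suc i"] that by (intro borel_measurable_diff rv_W) auto
  show "indep_vars (\<lambda>_. borel) ?D {..<n}"
  \<comment> \<open>For an empty index set the intersection of the events would be
    \<open>UNIV\<close> instead of \<open>space M\<close>, so this case stands apart.\<close>
  proof (cases "n = 0")
    case True
    then show ?thesis by (simp add: indep_vars_def indep_sets_def)
  next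
    case False
    have "(\<forall>A\<in>(\<Pi> i\<in>{..<n}. sets borel). prob (\<Inter>j\<in>{..<n}. ?D j -` A j \<inter> space M) = (\<Prod>j\<in>{..<n}. prob (?D j -` A j \<inter> space M)))"
    proof
      fix A :: "nat \<Rightarrow> real set" assume "A \<in> (\<Pi> i\<in>{..<n}. sets borel)"
      then have A: "A i \<in> sets borel" if "i < n" for i using that by auto
      have eq: "?D j -` A j \<inter> space M = {\<omega> \<in> space M. ?D j \<omega> \<in> A j}" for j by auto
      have "(\<Inter>j\<in>{..<n}. ?D j -` A j \<inter> space M) = {\<omega> \<in> space M. \<forall>i<n. ?D i \<omega> \<in> A i}"
        using False by auto
      then have "prob (\<Inter>j\<in>{..<n}. ?D j -` A j \<inter> space M) = expectation (\<lambda>\<omega>. \<Prod>i<n. \<mu> (A i) (?E i \<omega>))"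
        using prob_W_increments[OF s A] by simp
      also have "\<dots> = (\<Prod>i<n. expectation (\<lambda>\<omega>. \<mu> (A i) (?E i \<omega>)))"
      proof (rule indep_vars_lebesgue_integral)
        have "indep_vars (\<lambda>_. borel) ?E {..<n}" using s by (rule V.indep_increments)
        from indep_vars_compose2[OF this, of "\<lambda>i. \<mu> (A i)" "\<lambda>_. borel"]
        show "indep_vars (\<lambda>_. borel) (\<lambda>i \<omega>. \<mu> (A i) (?E i \<omega>)) {..<n}"
          using measurable_\<mu> A by simp
        fix i assume i: "i \<in> {..<n}"
        have "?E i \<in> borel_measurable M"
          using s_nonneg[of i] s_nonneg[of "Suc i"] i by (intro borel_measurable_diff V.rv) auto
        from measurable_compose[OF this measurable_\<mu>[OF A]] i
        show "integrable M (\<lambda>\<omega>. \<mu> (A i) (?E i \<omega>))"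
          by (intro integrable_const_bound[where B=1]) (auto simp: \<mu>_bounds)
      qed simp
      also have "\<dots> = (\<Prod>j<n. prob (?D j -` A j \<inter> space M))"
        using s s_nonneg A unfolding eq by (intro prod.cong refl prob_W_increment[symmetric]) auto
      finally show "prob (\<Inter>j\<in>{..<n}. ?D j -` A j \<inter> space M) = (\<Prod>j\<in>{..<n}. prob (?D j -` A j \<inter> space M))" .
    qed
    then show ?thesis
      using False D by (subst indep_vars_finite[where E="\<lambda>_. sets borel"])
        (auto simp: sets.sigma_sets_eq[of borel, simplified] Int_stable_def)
  qed
next
  fix r t :: real assume rt: "0 \<le> r" "0 \<le> t"
  have W0: "AE \<omega> in M. W 0 \<omega> = 0"
    using V.start passage_facts(3) by eventually_elim (simp add: W_def)
  have [measurable]: "W (r + t) \<in> borel_measurable M" "W r \<in> borel_measurable M" "W t \<in> borel_measurable M" "W 0 \<in> borel_measurable M"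
    "V (r + t) \<in> borel_measurable M" "V r \<in> borel_measurable M" "V t \<in> borel_measurable M" "V 0 \<in> borel_measurable M"
    using rt by (auto intro: rv_W V.rv)
  show "distr M borel (\<lambda>\<omega>. W (r + t) \<omega> - W r \<omega>) = distr M borel (W t)"
  proof (rule measure_eqI)
    fix C assume "C \<in> sets (distr M borel (\<lambda>\<omega>. W (r + t) \<omega> - W r \<omega>))"
    then have C[measurable]: "C \<in> sets borel" by simp
    have m[measurable]: "\<mu> C \<in> borel_measurable borel" by (rule measurable_\<mu>[OF C])
    have "prob {\<omega> \<in> space M. W (r + t) \<omega> - W r \<omega> \<in> C} = expectation (\<lambda>\<omega>. \<mu> C (V (r + t) \<omega> - V r \<omega>))"
      using rt by (intro prob_W_increment C) auto
    also have "\<dots> = (\<integral>z. \<mu> C z \<partial>distr M borel (\<lambda>\<omega>. V (r + t) \<omega> - V r \<omega>))"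
      by (rule integral_distr[symmetric]) measurable
    also have "\<dots> = (\<integral>z. \<mu> C z \<partial>distr M borel (V t))"
      unfolding V.stationary_increments[OF rt] ..
    also have "\<dots> = expectation (\<lambda>\<omega>. \<mu> C (V t \<omega>))" by (rule integral_distr) measurable
    \<comment> \<open>Writing \<open>V t\<close> as the increment from time \<open>0\<close> lets
      the increment formula be read backwards.\<close>
    also have "\<dots> = expectation (\<lambda>\<omega>. \<mu> C (V t \<omega> - V 0 \<omega>))"
      by (rule integral_cong_AE) (measurable, use V.start in \<open>eventually_elim, simp\<close>)
    also have "\<dots> = prob {\<omega> \<in> space M. W t \<omega> - W 0 \<omega> \<in> C}"
      using rt by (intro prob_W_increment[symmetric] C) auto
    also have "\<dots> = prob {\<omega> \<in> space M. W t \<omega> \<in> C}"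
      by (rule measure_eq_AE) (use W0 in \<open>eventually_elim, simp\<close>, measurable)
    finally show "emeasure (distr M borel (\<lambda>\<omega>. W (r + t) \<omega> - W r \<omega>)) C = emeasure (distr M borel (W t)) C"
      by (simp add: emeasure_distr emeasure_eq_measure vimage_def Int_def conj_commute)
  qed simp
qed

text \<open>\<open>V\<close>, \<open>e\<close> and \<open>\<tau>\<close> are mutually independent, so the pair \<open>(V, \<tau>)\<close> is independent of \<open>e\<close>.\<close>

lemma joint_algebra_indep: "indep_set (sets joint_algebra) (rv_sigma M e)"
proof -
  \<comment> \<open>An intersection-stable family that generates
    \<open>joint_algebra\<close>.\<close>
  let ?K = "{a \<inter> b | a b. a \<in> process_sigma M {0..} V \<and> b \<in> process_sigma M {0..} \<tau>}"
  have ev: "process_sigma M {0..} V \<subseteq> events" "process_sigma M {0..} \<tau> \<subseteq> events"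
    using V.process_sigma_le_events process_sigma_tau by auto
  have ind_V: "indep_set (process_sigma M {0..} V) (rv_sigma M e)"
    using Y_killed by (simp add: killed_subordinator_via_def)
  have "indep_set ?K (rv_sigma M e)"
    unfolding indep_sets2_eq
  proof (intro conjI ballI)
    show "?K \<subseteq> events" using ev by auto
    show "rv_sigma M e \<subseteq> events" by (rule rv_sigma_e)
    fix x c assume "x \<in> ?K" and c: "c \<in> rv_sigma M e"
    then obtain a b where x: "x = a \<inter> b" and a: "a \<in> process_sigma M {0..} V" and b: "b \<in> process_sigma M {0..} \<tau>" by blast
    have clock: "a \<in> sets clock_algebra" "c \<in> sets clock_algebra"
      using a c by (auto simp: clock_algebra_sets)
    have bp: "b \<in> sets passages" using b by (simp add: sets_process_algebra)
    \<comment> \<open>Grouping \<open>a\<close> with \<open>c\<close> lets independence of the clock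
      from the passages act on both together; \<open>V\<close> and \<open>e\<close> are separated
      afterwards.\<close>
    have "prob (x \<inter> c) = prob ((a \<inter> c) \<inter> b)" by (simp add: x Int_ac)
    also have "\<dots> = prob (a \<inter> c) * prob b"
      using clock bp by (intro indep_setD[OF clock_passages_indep] sets.Int)
    also have "prob (a \<inter> c) = prob a * prob c" by (rule indep_setD[OF ind_V a c])
    also have "prob a * prob c * prob b = (prob a * prob b) * prob c" by simp
    also have "prob a * prob b = prob x"
      unfolding x by (rule indep_setD[OF clock_passages_indep clock(1) bp, symmetric])
    finally show "prob (x \<inter> c) = prob x * prob c" .
  qed
  moreover have "Int_stable ?K"
  proof (rule Int_stableI)
    fix x y assume "x \<in> ?K" "y \<in> ?K"
    then obtain a b a' b' where *: "x = a \<inter> b" "y = a' \<inter> b'" "a \<in> process_sigma M {0..} V" "a' \<in> process_sigma M {0..} V"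
      "b \<in> process_sigma M {0..} \<tau>" "b' \<in> process_sigma M {0..} \<tau>" by blast
    then have "a \<inter> a' \<in> process_sigma M {0..} V" "b \<inter> b' \<in> process_sigma M {0..} \<tau>"
      unfolding sets_process_algebra[symmetric] by (auto intro: sets.Int)
    moreover have "x \<inter> y = (a \<inter> a') \<inter> (b \<inter> b')" using * by auto
    ultimately show "x \<inter> y \<in> ?K" by blast
  qed
  moreover have "Int_stable (rv_sigma M e)"
    by (simp add: rv_sigma_eq_vimage_algebra Int_stable_def sets.Int)
  ultimately have ind: "indep_set (sigma_sets (space M) ?K) (sigma_sets (space M) (rv_sigma M e))"
    by (rule indep_set_sigma_sets)
  have "process_sigma M {0..} V \<union> process_sigma M {0..} \<tau> \<subseteq> ?K"
  proof (intro Un_least subsetI)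
    have top: "space M \<in> process_sigma M {0..} V" "space M \<in> process_sigma M {0..} \<tau>"
      using sets.top[of "process_algebra M {0..} V"] sets.top[of passages] by (simp_all add: sets_process_algebra)
    show "x \<in> ?K" if "x \<in> process_sigma M {0..} V" for x
    proof -
      have "x = x \<inter> space M" using that ev sets.sets_into_space[of x M] by blast
      then show ?thesis using that top by blast
    qed
    show "x \<in> ?K" if "x \<in> process_sigma M {0..} \<tau>" for x
    proof -
      have "x = space M \<inter> x" using that ev sets.sets_into_space[of x M] by blast
      then show ?thesis using that top by blast
    qed
  qed
  then have "sets joint_algebra \<subseteq> sigma_sets (space M) ?K"
    unfolding joint_algebra_sets by (rule sigma_sets_mono')
  moreover have "rv_sigma M e \<subseteq> sigma_sets (space M) (rv_sigma M e)" by (rule sigma_sets_superset_generator)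
  ultimately show ?thesis using ind unfolding indep_sets2_eq by (meson subset_iff)
qed

lemma killed_subordinator_time_change: "killed_subordinator_via M \<beta> W e (time_change \<tau> Y)"
  unfolding killed_subordinator_via_def
proof (intro conjI allI impI)
  show "subordinator M W" by (rule subordinator_W)
  show "exponential_time M \<beta> e" using Y_killed by (simp add: killed_subordinator_via_def)
  have "process_sigma M {0..} W \<subseteq> sets joint_algebra"
    using measurable_W by (intro process_sigma_least) (auto simp: joint_algebra_sets)
  then show "indep_set (process_sigma M {0..} W) (rv_sigma M e)"
    using joint_algebra_indep unfolding indep_sets2_eq by (meson subset_iff)
next
  fix t :: real assume "0 \<le> t"
  then have [measurable]: "Y t \<in> borel_measurable M" using Y_killed by (simp add: killed_subordinator_via_def)
  \<comment> \<open>With respect to \<open>M\<close> the passage times at negative levels are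
    measurable too, so the identity can serve as level map.\<close>
  have j: "(\<lambda>(x, \<omega>). \<tau> x \<omega>) \<in> borel_measurable (borel \<Otimes>\<^sub>M M)"
    using measurable_first_passage_joint[of "\<lambda>x. x" X M] by simp
  have "(\<lambda>\<omega>. (real_of_ereal (Y t \<omega>), \<omega>)) \<in> measurable M (borel \<Otimes>\<^sub>M M)" by measurable
  from measurable_compose[OF this j]
  have [measurable]: "(\<lambda>\<omega>. \<tau> (real_of_ereal (Y t \<omega>)) \<omega>) \<in> borel_measurable M" by simp
  have "(\<lambda>\<omega>. if Y t \<omega> = \<infinity> then \<infinity> else \<tau> (real_of_ereal (Y t \<omega>)) \<omega>) \<in> borel_measurable M"
    by measurable
  then show "time_change \<tau> Y t \<in> borel_measurable M" by (simp add: time_change_def[abs_def])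
next
  have "AE \<omega> in M. \<forall>t\<ge>0. Y t \<omega> = (if ereal t < e \<omega> then ereal (V t \<omega>) else \<infinity>)"
    using Y_killed by (simp add: killed_subordinator_via_def)
  with AE_good show "AE \<omega> in M. \<forall>t\<ge>0. time_change \<tau> Y t \<omega> = (if ereal t < e \<omega> then ereal (W t \<omega>) else \<infinity>)"
    by eventually_elim (auto simp: time_change_def W_def good_finite)
qed

text \<open>With clock and killing time frozen, the passage time at level \<open>v = V t\<close>
  contributes \<open>exp (- \<theta> * v)\<close>, so the transform at
  \<open>\<psi> \<theta>\<close> becomes that of \<open>Y\<close> at \<open>\<theta>\<close>; killed
  outcomes contribute \<open>0\<close> on both sides.\<close>

lemma killed_transform_time_change:
  assumes \<theta>: "0 < \<theta>" and t: "0 \<le> t"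
  shows "expectation (\<lambda>\<omega>. if time_change \<tau> Y t \<omega> = \<infinity> then 0 else exp (- \<psi> \<theta> * real_of_ereal (time_change \<tau> Y t \<omega>)))
    = expectation (\<lambda>\<omega>. if Y t \<omega> = \<infinity> then 0 else exp (- \<theta> * real_of_ereal (Y t \<omega>)))"
proof -
  have p: "0 < \<psi> \<theta>" using exponent_pos \<theta> by blast
  have Ym[measurable]: "Y t \<in> borel_measurable M" "time_change \<tau> Y t \<in> borel_measurable M"
    using t Y_killed killed_subordinator_time_change by (simp_all add: killed_subordinator_via_def)
  define h :: "'a \<times> 'a \<Rightarrow> ennreal" where
    "h z = (if ereal t < e (fst z) then ennreal (exp (- \<psi> \<theta> * T (max 0 (V t (fst z))) (snd z))) else 0)" for z
  have [measurable]: "V t \<in> borel_measurable clock_algebra" using t by (rule measurable_V_clock)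
  note [measurable] = measurable_e_clock
  have "(\<lambda>z. (V t (fst z), snd z)) \<in> measurable (clock_algebra \<Otimes>\<^sub>M passages) (borel \<Otimes>\<^sub>M passages)"
    by measurable
  from measurable_compose[OF this measurable_passage_time_joint]
  have [measurable]: "(\<lambda>z. T (max 0 (V t (fst z))) (snd z)) \<in> borel_measurable (clock_algebra \<Otimes>\<^sub>M passages)" by simp
  have h: "h \<in> borel_measurable (clock_algebra \<Otimes>\<^sub>M passages)" unfolding h_def by measurable
  have AE_Y: "AE \<omega> in M. \<omega> \<in> good \<and> Y t \<omega> = (if ereal t < e \<omega> then ereal (V t \<omega>) else \<infinity>)"
    using AE_good Y_killed t by (auto simp: killed_subordinator_via_def)
  have "(\<integral>\<^sup>+\<omega>. ennreal (if time_change \<tau> Y t \<omega> = \<infinity> then 0 else exp (- \<psi> \<theta> * real_of_ereal (time_change \<tau> Y t \<omega>))) \<partial>M)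
    = (\<integral>\<^sup>+\<omega>. h (\<omega>, \<omega>) \<partial>M)"
  proof (rule nn_integral_cong_AE)
    show "AE \<omega> in M. ennreal (if time_change \<tau> Y t \<omega> = \<infinity> then 0 else exp (- \<psi> \<theta> * real_of_ereal (time_change \<tau> Y t \<omega>))) = h (\<omega>, \<omega>)"
      using AE_Y
    proof eventually_elim
      case (elim \<omega>)
      then show ?case
        using good_nonneg[of \<omega> t] t by (auto simp: h_def time_change_def good_finite)
    qed
  qed
  also have "\<dots> = (\<integral>\<^sup>+\<omega>. \<integral>\<^sup>+\<omega>'. h (\<omega>, \<omega>') \<partial>M \<partial>M)"
    using clock_algebra_sets by (intro nn_integral_indep_freeze[OF clock_passages_indep _ _ h]) auto
  also have "\<dots> = (\<integral>\<^sup>+\<omega>. ennreal (if Y t \<omega> = \<infinity> then 0 else exp (- \<theta> * real_of_ereal (Y t \<omega>))) \<partial>M)"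
  proof (rule nn_integral_cong_AE)
    show "AE \<omega> in M. (\<integral>\<^sup>+\<omega>'. h (\<omega>, \<omega>') \<partial>M) = ennreal (if Y t \<omega> = \<infinity> then 0 else exp (- \<theta> * real_of_ereal (Y t \<omega>)))"
      using AE_Y
    proof eventually_elim
      case (elim \<omega>)
      have v: "0 \<le> V t \<omega>" using elim good_nonneg t by blast
      have "(\<integral>\<^sup>+\<omega>'. ennreal (exp (- \<psi> \<theta> * T (V t \<omega>) \<omega>')) \<partial>M) = ennreal (expectation (\<lambda>\<omega>'. exp (- \<psi> \<theta> * T (V t \<omega>) \<omega>')))"
        using p T_nonneg by (intro nn_integral_eq_integral integrable_const_bound[where B=1]) auto
      also have "\<dots> = ennreal (exp (- \<theta> * V t \<omega>))" using passage_facts(2)[OF \<theta> v] by simp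
      finally show ?case using elim v by (auto simp: h_def max_absorb2)
    qed
  qed
  finally have "(\<integral>\<^sup>+\<omega>. ennreal (if time_change \<tau> Y t \<omega> = \<infinity> then 0 else exp (- \<psi> \<theta> * real_of_ereal (time_change \<tau> Y t \<omega>))) \<partial>M)
    = (\<integral>\<^sup>+\<omega>. ennreal (if Y t \<omega> = \<infinity> then 0 else exp (- \<theta> * real_of_ereal (Y t \<omega>))) \<partial>M)" .
  then show ?thesis by (simp add: integral_eq_nn_integral)
qed

text \<open>The value \<open>q = 0\<close> is not of the form \<open>\<psi> \<theta>\<close> with
  \<open>\<theta> > 0\<close>. Passage times being finite almost surely, the time change is alive
  exactly when \<open>Y\<close> is, and the survival probability is the limit of the transforms of
  \<open>Y\<close>.\<close>

lemma killed_transform_0: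
  assumes t: "0 \<le> t"
  shows "expectation (\<lambda>\<omega>. if time_change \<tau> Y t \<omega> = \<infinity> then 0 else exp (- 0 * real_of_ereal (time_change \<tau> Y t \<omega>)))
      = expectation (\<lambda>\<omega>. if Y t \<omega> = \<infinity> then 0 else 1)"
    "((\<lambda>\<theta>. expectation (\<lambda>\<omega>. if Y t \<omega> = \<infinity> then 0 else exp (- \<theta> * real_of_ereal (Y t \<omega>))))
      \<longlongrightarrow> expectation (\<lambda>\<omega>. if Y t \<omega> = \<infinity> then 0 else 1)) (at_right 0)"
proof -
  have [measurable]: "Y t \<in> borel_measurable M" "time_change \<tau> Y t \<in> borel_measurable M"
    using t Y_killed killed_subordinator_time_change by (simp_all add: killed_subordinator_via_def)
  have AE_Y: "AE \<omega> in M. \<omega> \<in> good \<and> Y t \<omega> = (if ereal t < e \<omega> then ereal (V t \<omega>) else \<infinity>)"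
    using AE_good Y_killed t by (auto simp: killed_subordinator_via_def)
  show "expectation (\<lambda>\<omega>. if time_change \<tau> Y t \<omega> = \<infinity> then 0 else exp (- 0 * real_of_ereal (time_change \<tau> Y t \<omega>)))
      = expectation (\<lambda>\<omega>. if Y t \<omega> = \<infinity> then 0 else 1)"
  proof (rule integral_cong_AE)
    show "AE \<omega> in M. (if time_change \<tau> Y t \<omega> = \<infinity> then 0 else exp (- 0 * real_of_ereal (time_change \<tau> Y t \<omega>)))
      = (if Y t \<omega> = \<infinity> then 0 else 1 :: real)"
      using AE_Y by eventually_elim (auto simp: time_change_def good_finite)
  qed measurable
  show "((\<lambda>\<theta>. expectation (\<lambda>\<omega>. if Y t \<omega> = \<infinity> then 0 else exp (- \<theta> * real_of_ereal (Y t \<omega>))))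
      \<longlongrightarrow> expectation (\<lambda>\<omega>. if Y t \<omega> = \<infinity> then 0 else 1)) (at_right 0)"
  proof (rule tendsto_at_right_sequentially[of 0 1])
    fix S :: "nat \<Rightarrow> real" assume S: "\<And>n. 0 < S n" "S \<longlonglongrightarrow> 0"
    show "(\<lambda>n. expectation (\<lambda>\<omega>. if Y t \<omega> = \<infinity> then 0 else exp (- S n * real_of_ereal (Y t \<omega>))))
      \<longlonglongrightarrow> expectation (\<lambda>\<omega>. if Y t \<omega> = \<infinity> then 0 else 1)"
    proof (rule integral_dominated_convergence)
      show "integrable M (\<lambda>_. 1 :: real)" by simp
      have "(\<lambda>n. exp (- S n * y)) \<longlonglongrightarrow> exp (- 0 * y)" for y
        using S(2) by (intro tendsto_intros)
      then show "AE \<omega> in M. (\<lambda>n. if Y t \<omega> = \<infinity> then 0 else exp (- S n * real_of_ereal (Y t \<omega>)))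
        \<longlonglongrightarrow> (if Y t \<omega> = \<infinity> then 0 else 1)"
        by (intro AE_I2) simp
      show "AE \<omega> in M. norm (if Y t \<omega> = \<infinity> then 0 else exp (- S n * real_of_ereal (Y t \<omega>))) \<le> 1" for n
        using AE_Y
      proof eventually_elim
        case (elim \<omega>)
        then have "0 \<le> V t \<omega>" using good_nonneg t by blast
        then show ?case using elim S(1)[of n] by auto
      qed
    qed measurable
  qed simp
qed

end

section \<open>Laplace exponents\<close>

text \<open>The mean value inequality bounds the difference quotients by the local bound
  \<open>w\<close> on the derivative, so dominated convergence applies along sequences.\<close>

lemma has_real_derivative_integral:
  fixes f f' :: "real \<Rightarrow> 'a \<Rightarrow> real"
  assumes d: "d > 0"
    and int: "\<And>t. \<bar>t - x\<bar> < d \<Longrightarrow> integrable M (f t)"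
    and meas: "f' x \<in> borel_measurable M"
    and w: "integrable M w"
    and deriv: "AE y in M. \<forall>t. \<bar>t - x\<bar> < d \<longrightarrow>
      ((\<lambda>t. f t y) has_real_derivative f' t y) (at t) \<and> \<bar>f' t y\<bar> \<le> w y"
  shows "((\<lambda>t. \<integral>y. f t y \<partial>M) has_real_derivative (\<integral>y. f' x y \<partial>M)) (at x)"
  unfolding has_field_derivative_iff tendsto_at_iff_sequentially comp_def
proof (intro allI impI)
  fix X :: "nat \<Rightarrow> real"
  assume X: "\<forall>i. X i \<in> UNIV - {x}" "X \<longlonglongrightarrow> x"
  have "eventually (\<lambda>i. \<bar>X i - x\<bar> < d) sequentially"
    using X(2) d by (auto dest!: tendstoD simp: dist_real_def)
  then obtain N where N: "\<And>i. i \<ge> N \<Longrightarrow> \<bar>X i - x\<bar> < d"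
    by (auto simp: eventually_sequentially)
  have X0: "X i - x \<noteq> 0" for i using X(1) by auto
  \<comment> \<open>Dropping the terms before \<open>N\<close> keeps the sequence inside the
    interval where the hypotheses hold.\<close>
  define Z where "Z i = X (i + N)" for i
  have Z: "\<bar>Z i - x\<bar> < d" "Z i - x \<noteq> 0" for i using N X0 by (auto simp: Z_def)
  have Zl: "Z \<longlonglongrightarrow> x" unfolding Z_def by (rule LIMSEQ_ignore_initial_segment[OF X(2)])
  have x: "\<bar>x - x\<bar> < d" using d by simp
  have "(\<lambda>i. \<integral>y. (f (Z i) y - f x y) / (Z i - x) \<partial>M) \<longlonglongrightarrow> (\<integral>y. f' x y \<partial>M)"
  proof (rule integral_dominated_convergence[OF meas _ w])
    show "(\<lambda>y. (f (Z i) y - f x y) / (Z i - x)) \<in> borel_measurable M" for i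
      using int[OF Z(1)] int[OF x] by measurable
    show "AE y in M. (\<lambda>i. (f (Z i) y - f x y) / (Z i - x)) \<longlonglongrightarrow> f' x y"
      using deriv
    proof eventually_elim
      case (elim y)
      then have "((\<lambda>t. f t y) has_real_derivative f' x y) (at x)" using x by blast
      then show ?case
        unfolding has_field_derivative_iff tendsto_at_iff_sequentially comp_def
        using Zl Z(2) by (elim allE[of _ Z]) auto
    qed
    show "AE y in M. norm ((f (Z i) y - f x y) / (Z i - x)) \<le> w y" for i
      using deriv
    proof eventually_elim
      case (elim y)
      have "norm (f (Z i) y - f x y) \<le> w y * norm (Z i - x)"
      proof (rule field_differentiable_bound[of "ball x d" "\<lambda>t. f t y" "\<lambda>t. f' t y"])
        fix t assume "t \<in> ball x d"
        then have "\<bar>t - x\<bar> < d" by (simp add: dist_real_def abs_minus_commute)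
        then show "((\<lambda>t. f t y) has_real_derivative f' t y) (at t within ball x d)" "norm (f' t y) \<le> w y"
          using elim by (auto intro: has_field_derivative_at_within)
      next
        show "Z i \<in> ball x d" using Z(1)[of i] by (simp add: dist_real_def abs_minus_commute)
      qed (use d in auto)
      then show ?case using Z(2)[of i] by (simp add: divide_le_eq)
    qed
  qed
  moreover have "(\<integral>y. (f (Z i) y - f x y) / (Z i - x) \<partial>M)
      = ((\<integral>y. f (Z i) y \<partial>M) - (\<integral>y. f x y \<partial>M)) / (Z i - x)" for i
    using int[OF Z(1)] int[OF x] by simp
  ultimately have "(\<lambda>i. ((\<integral>y. f (Z i) y \<partial>M) - (\<integral>y. f x y \<partial>M)) / (Z i - x)) \<longlonglongrightarrow> (\<integral>y. f' x y \<partial>M)"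
    by (simp only:)
  then show "(\<lambda>i. ((\<integral>y. f (X i) y \<partial>M) - (\<integral>y. f x y \<partial>M)) / (X i - x)) \<longlonglongrightarrow> (\<integral>y. f' x y \<partial>M)"
    unfolding Z_def by (rule LIMSEQ_offset)
qed

lemma exp_minus_second_order:
  fixes z :: real
  assumes "z \<ge> 0"
  shows "0 \<le> exp (- z) - 1 + z" "exp (- z) - 1 + z \<le> z\<^sup>2"
proof -
  show "0 \<le> exp (- z) - 1 + z" using exp_ge_add_one_self[of "-z"] by simp
  have "exp (- z) \<le> 1 / (1 + z)"
    using exp_ge_add_one_self[of z] assms by (simp add: exp_minus inverse_eq_divide frac_le)
  \<comment> \<open>\<open>(1 - z + z\<^sup>2) * (1 + z)\<close> equals
    \<open>1 + z * (z * z)\<close>, which is at least \<open>1\<close>.\<close>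
  also have "\<dots> \<le> 1 - z + z\<^sup>2"
  proof -
    have "1 \<le> 1 + z * (z * z)" using assms by simp
    also have "\<dots> = (1 - z + z\<^sup>2) * (1 + z)" by (simp add: algebra_simps power2_eq_square)
    finally show ?thesis using assms by (simp add: divide_le_eq)
  qed
  finally show "exp (- z) - 1 + z \<le> z\<^sup>2" by simp
qed

text \<open>Small jumps use the second-order bound and account for \<open>\<theta>\<^sup>2\<close>;
  jumps of size at least \<open>1\<close> are not compensated and account for the summand
  \<open>1\<close>.\<close>

lemma levy_integrand_bound:
  fixes \<theta> y :: real
  assumes "\<theta> \<ge> 0" "y > 0"
  shows "\<bar>exp (- \<theta> * y) - 1 + \<theta> * y * indicator {..<1} y\<bar> \<le> (1 + \<theta>\<^sup>2) * min 1 (y\<^sup>2)"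
proof (cases "y < 1")
  case True
  have "y\<^sup>2 \<le> 1" using True assms by (simp add: power_le_one)
  moreover have "(\<theta> * y)\<^sup>2 \<le> (1 + \<theta>\<^sup>2) * y\<^sup>2" by (simp add: power_mult_distrib algebra_simps)
  ultimately show ?thesis
    using True exp_minus_second_order[of "\<theta> * y"] assms by (simp add: min_def)
next
  case False
  then have "1 \<le> y\<^sup>2" by simp
  moreover have "\<bar>exp (- (\<theta> * y)) - 1\<bar> \<le> 1" using assms by simp
  then have "\<bar>exp (- (\<theta> * y)) - 1\<bar> \<le> 1 + \<theta>\<^sup>2" using zero_le_power2[of \<theta>] by linarith
  ultimately show ?thesis using False by (simp add: min_def)
qed

text \<open>One bound for all \<open>t\<close> near \<open>\<theta>\<close>, as differentiation
  under the integral requires. Small jumps use \<open>1 - exp (- z) \<le> z\<close> with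
  \<open>t < 2 * \<theta>\<close>, large ones \<open>z \<le> exp z\<close> with
  \<open>t > \<theta> / 2\<close>; these give the two constants.\<close>

lemma levy_integrand_deriv_bound:
  fixes \<theta> t y :: real
  assumes "\<theta> > 0" "\<bar>t - \<theta>\<bar> < \<theta> / 2" "y > 0"
  shows "\<bar>y * indicator {..<1} y - y * exp (- t * y)\<bar> \<le> (2 / \<theta> + 2 * \<theta>) * min 1 (y\<^sup>2)"
proof -
  have t: "\<theta> / 2 < t" "t < 2 * \<theta>" using assms by (auto simp: abs_if split: if_splits)
  show ?thesis
  proof (cases "y < 1")
    case True
    have y2: "y\<^sup>2 \<le> 1" using True assms by (simp add: power_le_one)
    have "0 \<le> t * y" using assms t by simp
    then have "1 - exp (- t * y) \<le> t * y" "0 \<le> 1 - exp (- t * y)"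
      using exp_ge_add_one_self[of "- t * y"] assms t by (auto intro: mult_nonneg_nonneg)
    then have up: "y * (1 - exp (- t * y)) \<le> y * (t * y)" and pos: "0 \<le> y * (1 - exp (- t * y))"
      using assms(3) by (blast intro: mult_left_mono mult_nonneg_nonneg less_imp_le)+
    note up
    also have "y * (t * y) \<le> 2 * \<theta> * y\<^sup>2"
      using mult_right_mono[of t "2 * \<theta>" "y\<^sup>2"] t by (simp add: power2_eq_square algebra_simps)
    finally have "y * (1 - exp (- t * y)) \<le> 2 * \<theta> * y\<^sup>2" .
    moreover note pos
    moreover have "0 \<le> 2 / \<theta> * y\<^sup>2" using assms by simp
    ultimately show ?thesis using True y2 by (simp add: min_def algebra_simps)
  next
    case False
    then have y2: "1 \<le> y\<^sup>2" by simp
    have "t * y \<le> exp (t * y)" using exp_ge_add_one_self[of "t * y"] by linarith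
    then have "y * exp (- t * y) \<le> 1 / t"
      using t assms by (simp add: exp_minus field_simps)
    also have "1 / t \<le> 1 / (\<theta> / 2)" using t assms by (intro divide_left_mono) auto
    finally have "y * exp (- t * y) \<le> 2 / \<theta>" by simp
    moreover have "0 \<le> y * exp (- t * y)" using assms by simp
    ultimately show ?thesis using False y2 assms by (simp add: min_def)
  qed
qed

lemma levy_exponent_0: "levy_exponent c \<sigma> \<nu> 0 = 0"
  by (simp add: levy_exponent_def)

section \<open>Integrability against a Levy measure and the derivative of the exponent\<close>

context
  fixes \<nu> :: "real measure"
  assumes levy: "levy_measure \<nu>"
begin

lemma levy_measure_sets[measurable_cong]: "sets \<nu> = sets borel"
  using levy by (simp add: levy_measure_def)

lemma levy_measure_AE_pos: "AE y in \<nu>. 0 < y"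
proof (rule AE_I[of _ _ "{..0}"])
  show "emeasure \<nu> {..0} = 0" using levy by (simp add: levy_measure_def)
qed (auto simp: levy_measure_sets)

lemma levy_measure_integrable_min: "integrable \<nu> (\<lambda>y. min 1 (y\<^sup>2))"
proof (rule integrableI_nonneg)
  have "(\<integral>\<^sup>+y. ennreal (min 1 (y\<^sup>2)) \<partial>\<nu>) = (\<integral>\<^sup>+y\<in>{0<..}. ennreal (min 1 (y\<^sup>2)) \<partial>\<nu>)"
    using levy_measure_AE_pos by (intro nn_integral_cong_AE) auto
  then show "(\<integral>\<^sup>+y. ennreal (min 1 (y\<^sup>2)) \<partial>\<nu>) < \<infinity>"
    using levy by (simp add: levy_measure_def)
qed auto

text \<open>The factor \<open>1 + 1 / a\<^sup>2\<close> lifts the integrable function to at least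
  \<open>1\<close> on the tail: the summand \<open>1\<close> serves where
  \<open>y\<^sup>2 \<ge> 1\<close>, the other summand where \<open>y\<^sup>2 < 1\<close>.\<close>

lemma levy_measure_tail_finite:
  assumes "a > 0" shows "emeasure \<nu> {a<..} < \<infinity>"
proof -
  have "integrable \<nu> (indicator {a<..} :: real \<Rightarrow> real)"
  proof (rule Bochner_Integration.integrable_bound)
    show "integrable \<nu> (\<lambda>y. (1 + 1 / a\<^sup>2) * min 1 (y\<^sup>2))"
      using levy_measure_integrable_min by simp
    have "1 \<le> (1 + 1 / a\<^sup>2) * min 1 (y\<^sup>2)" if "a < y" for y
    proof (cases "y\<^sup>2 \<ge> 1")
      case False
      have "a\<^sup>2 \<le> y\<^sup>2" using assms that by (intro power_mono) auto
      then have "1 \<le> y\<^sup>2 / a\<^sup>2" using assms by simp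
      moreover have "(1 + 1 / a\<^sup>2) * y\<^sup>2 = y\<^sup>2 + y\<^sup>2 / a\<^sup>2" by (simp add: algebra_simps)
      ultimately have "1 \<le> (1 + 1 / a\<^sup>2) * y\<^sup>2" using zero_le_power2[of y] by linarith
      then show ?thesis using False by (simp add: min_def)
    qed (use assms in \<open>simp add: min_def\<close>)
    then show "AE y in \<nu>. norm (indicator {a<..} y :: real) \<le> norm ((1 + 1 / a\<^sup>2) * min 1 (y\<^sup>2))"
      by (intro AE_I2) (auto simp: indicator_def)
  qed simp
  then show ?thesis by (simp add: integrable_indicator_iff levy_measure_sets)
qed

text \<open>Tails away from \<open>0\<close> have finite mass and the half-line up to
  \<open>0\<close> has none. Exchanging the order of integration in \<open>phi_integral\<close>
  rests on this.\<close>

lemma levy_measure_sigma_finite: "sigma_finite_measure \<nu>"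
proof
  let ?A = "insert {..0} (range (\<lambda>n. {1 / real (Suc n)<..}))"
  have "y \<in> \<Union>?A" for y
  proof (cases "y \<le> 0")
    case False
    then obtain n where "inverse (real (Suc n)) < y" using reals_Archimedean[of y] by auto
    then show ?thesis by (auto simp: inverse_eq_divide)
  qed auto
  then have "\<Union>?A = space \<nu>" using sets_eq_imp_space_eq[OF levy_measure_sets] by auto
  moreover have "\<forall>a\<in>?A. emeasure \<nu> a \<noteq> \<infinity>"
    using levy levy_measure_tail_finite by (auto simp: levy_measure_def less_top)
  ultimately show "\<exists>A. countable A \<and> A \<subseteq> sets \<nu> \<and> \<Union> A = space \<nu> \<and> (\<forall>a\<in>A. emeasure \<nu> a \<noteq> \<infinity>)"
    by (intro exI[of _ ?A]) (auto simp: levy_measure_sets)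
qed

lemma levy_exponent_eq:
  "levy_exponent c \<sigma> \<nu> \<theta> = c * \<theta> + \<sigma>\<^sup>2 * \<theta>\<^sup>2 / 2 +
     (\<integral>y. exp (- \<theta> * y) - 1 + \<theta> * y * indicator {..<1} y \<partial>\<nu>)"
  unfolding levy_exponent_def set_lebesgue_integral_def
  using levy_measure_AE_pos by (auto intro!: integral_cong_AE)

lemma levy_integrand_integrable:
  assumes "\<theta> \<ge> 0"
  shows "integrable \<nu> (\<lambda>y. exp (- \<theta> * y) - 1 + \<theta> * y * indicator {..<1} y)"
proof (rule Bochner_Integration.integrable_bound)
  show "integrable \<nu> (\<lambda>y. (1 + \<theta>\<^sup>2) * min 1 (y\<^sup>2))"
    using levy_measure_integrable_min by simp
  show "AE y in \<nu>. norm (exp (- \<theta> * y) - 1 + \<theta> * y * indicator {..<1} y) \<le> norm ((1 + \<theta>\<^sup>2) * min 1 (y\<^sup>2))"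
    using levy_measure_AE_pos by eventually_elim (use levy_integrand_bound assms in \<open>fastforce simp: abs_mult\<close>)
qed measurable

lemma levy_integrand_deriv_integrable:
  assumes "\<theta> > 0"
  shows "integrable \<nu> (\<lambda>y. y * indicator {..<1} y - y * exp (- \<theta> * y))"
proof (rule Bochner_Integration.integrable_bound)
  show "integrable \<nu> (\<lambda>y. (2 / \<theta> + 2 * \<theta>) * min 1 (y\<^sup>2))"
    using levy_measure_integrable_min by simp
  show "AE y in \<nu>. norm (y * indicator {..<1} y - y * exp (- \<theta> * y)) \<le> norm ((2 / \<theta> + 2 * \<theta>) * min 1 (y\<^sup>2))"
    using levy_measure_AE_pos
  proof eventually_elim
    case (elim y)
    then show ?case using levy_integrand_deriv_bound[of \<theta> \<theta> y] assms by simp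
  qed
qed measurable

lemma levy_exponent_has_derivative:
  assumes "\<theta> > 0"
  shows "(levy_exponent c \<sigma> \<nu> has_real_derivative
    c + \<sigma>\<^sup>2 * \<theta> + (\<integral>y. y * indicator {..<1} y - y * exp (- \<theta> * y) \<partial>\<nu>)) (at \<theta>)"
proof -
  have "((\<lambda>\<theta>. \<integral>y. exp (- \<theta> * y) - 1 + \<theta> * y * indicator {..<1} y \<partial>\<nu>) has_real_derivative
     (\<integral>y. y * indicator {..<1} y - y * exp (- \<theta> * y) \<partial>\<nu>)) (at \<theta>)"
  proof (rule has_real_derivative_integral[where d="\<theta> / 2" and w="\<lambda>y. (2 / \<theta> + 2 * \<theta>) * min 1 (y\<^sup>2)"])
    show "\<theta> / 2 > 0" using assms by simp
    show "integrable \<nu> (\<lambda>y. exp (- t * y) - 1 + t * y * indicator {..<1} y)" if "\<bar>t - \<theta>\<bar> < \<theta> / 2" for t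
      using that assms by (intro levy_integrand_integrable) (auto simp: abs_if split: if_splits)
    show "integrable \<nu> (\<lambda>y. (2 / \<theta> + 2 * \<theta>) * min 1 (y\<^sup>2))"
      using levy_measure_integrable_min by simp
    show "AE y in \<nu>. \<forall>t. \<bar>t - \<theta>\<bar> < \<theta> / 2 \<longrightarrow>
      ((\<lambda>t. exp (- t * y) - 1 + t * y * indicator {..<1} y) has_real_derivative
        y * indicator {..<1} y - y * exp (- t * y)) (at t) \<and>
      \<bar>y * indicator {..<1} y - y * exp (- t * y)\<bar> \<le> (2 / \<theta> + 2 * \<theta>) * min 1 (y\<^sup>2)"
      using levy_measure_AE_pos
    proof eventually_elim
      case (elim y)
      show ?case
        using levy_integrand_deriv_bound[OF assms _ elim]
        by (auto intro!: derivative_eq_intros)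
    qed
  qed measurable
  then show ?thesis
    unfolding levy_exponent_eq[abs_def] by (auto intro!: derivative_eq_intros)
qed

section \<open>The limit of the derivative and the integration by parts\<close>

context
  fixes c \<sigma> m :: real
  assumes deriv_limit: "(deriv (levy_exponent c \<sigma> \<nu>) \<longlongrightarrow> m) (at_right 0)"
begin

lemma levy_measure_large_jumps:
  "integrable \<nu> (\<lambda>y. y * indicator {1..} y)" "(\<integral>y. y * indicator {1..} y \<partial>\<nu>) = c - m"
proof -
  define t where "t n = 1 / real (Suc n)" for n
  have t: "t n > 0" "t (Suc n) \<le> t n" for n by (auto simp: t_def field_simps)
  have t0: "t \<longlonglongrightarrow> 0" unfolding t_def by (rule LIMSEQ_Suc[OF lim_1_over_n])
  have "filterlim t (at_right 0) sequentially"
    using t(1) by (intro tendsto_imp_filterlim_at_right[OF t0]) auto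
  from filterlim_compose[OF deriv_limit this]
  have "(\<lambda>n. deriv (levy_exponent c \<sigma> \<nu>) (t n)) \<longlonglongrightarrow> m" .
  then have "(\<lambda>n. c + \<sigma>\<^sup>2 * t n - deriv (levy_exponent c \<sigma> \<nu>) (t n)) \<longlonglongrightarrow> c + \<sigma>\<^sup>2 * 0 - m"
    using t0 by (intro tendsto_intros)
  \<comment> \<open>Both parts of the integrand stay together, since small jumps alone need not have
    a finite mean.\<close>
  moreover have "c + \<sigma>\<^sup>2 * t n - deriv (levy_exponent c \<sigma> \<nu>) (t n)
      = (\<integral>y. y * exp (- t n * y) - y * indicator {..<1} y \<partial>\<nu>)" for n
    unfolding DERIV_imp_deriv[OF levy_exponent_has_derivative[OF t(1)]]
    using Bochner_Integration.integral_minus[of \<nu> "\<lambda>y. y * indicator {..<1} y - y * exp (- t n * y)"] by simp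
  ultimately have lim: "(\<lambda>n. \<integral>y. y * exp (- t n * y) - y * indicator {..<1} y \<partial>\<nu>) \<longlonglongrightarrow> c - m"
    by simp
  have int: "integrable \<nu> (\<lambda>y. y * exp (- t n * y) - y * indicator {..<1} y)" for n
    using Bochner_Integration.integrable_minus[OF levy_integrand_deriv_integrable[OF t(1)[of n]]] by simp
  \<comment> \<open>As \<open>t n\<close> decreases, the integrand grows to
    \<open>y * indicator {1..} y\<close>; convergence of the integrals then yields integrability of
    the limit.\<close>
  have mono: "AE y in \<nu>. mono (\<lambda>n. y * exp (- t n * y) - y * indicator {..<1} y)"
    using levy_measure_AE_pos
  proof eventually_elim
    case (elim y)
    show ?case using elim t(2) by (auto intro!: incseq_SucI)
  qed
  have pw: "AE y in \<nu>. (\<lambda>n. y * exp (- t n * y) - y * indicator {..<1} y) \<longlonglongrightarrow> y * indicator {1..} y"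
  proof (rule AE_I2)
    fix y :: real
    have "(\<lambda>n. y * exp (- t n * y) - y * indicator {..<1} y) \<longlonglongrightarrow> y * exp (- 0 * y) - y * indicator {..<1} y"
      using t0 by (intro tendsto_intros)
    then show "(\<lambda>n. y * exp (- t n * y) - y * indicator {..<1} y) \<longlonglongrightarrow> y * indicator {1..} y"
      by (cases "y < 1") auto
  qed
  show "integrable \<nu> (\<lambda>y. y * indicator {1..} y)" "(\<integral>y. y * indicator {1..} y \<partial>\<nu>) = c - m"
    by (rule integrable_monotone_convergence[OF int mono pw lim]; measurable)
       (rule integral_monotone_convergence[OF int mono pw lim]; measurable)
qed

text \<open>Compensating all jumps instead of only those below \<open>1\<close> changes the drift
  from \<open>c\<close> to \<open>m\<close>, because the large jumps have mean \<open>c - m\<close>.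
  The new integrand is the integral of \<open>1 - exp (- \<theta> * z)\<close> over
  \<open>0 < z < y\<close>, which leads to the tail in \<open>phi\<close>.\<close>

lemma levy_J_integral:
  assumes "\<theta> > 0"
  shows "integrable \<nu> (\<lambda>y. y - (1 - exp (- \<theta> * y)) / \<theta>)"
    "levy_exponent c \<sigma> \<nu> \<theta> = \<theta> * (m + \<sigma>\<^sup>2 / 2 * \<theta> + (\<integral>y. y - (1 - exp (- \<theta> * y)) / \<theta> \<partial>\<nu>))"
proof -
  have eq: "(\<lambda>y::real. y - (1 - exp (- \<theta> * y)) / \<theta>)
      = (\<lambda>y. (exp (- \<theta> * y) - 1 + \<theta> * y * indicator {..<1} y) / \<theta> + y * indicator {1..} y)"
    using assms by (auto simp: fun_eq_iff indicator_def field_simps)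
  have i: "integrable \<nu> (\<lambda>y. exp (- \<theta> * y) - 1 + \<theta> * y * indicator {..<1} y)"
    using assms by (intro levy_integrand_integrable) auto
  show "integrable \<nu> (\<lambda>y. y - (1 - exp (- \<theta> * y)) / \<theta>)"
    unfolding eq using i levy_measure_large_jumps(1) by simp
  have "(\<integral>y. y - (1 - exp (- \<theta> * y)) / \<theta> \<partial>\<nu>)
     = (\<integral>y. exp (- \<theta> * y) - 1 + \<theta> * y * indicator {..<1} y \<partial>\<nu>) / \<theta> + (c - m)"
    unfolding eq using i levy_measure_large_jumps by simp
  moreover have "c * \<theta> + \<sigma>\<^sup>2 * \<theta>\<^sup>2 / 2 + A = \<theta> * (m + \<sigma>\<^sup>2 / 2 * \<theta> + J)" if "J = A / \<theta> + (c - m)" for A J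
    using assms that by (simp add: field_simps power2_eq_square)
  ultimately show "levy_exponent c \<sigma> \<nu> \<theta> = \<theta> * (m + \<sigma>\<^sup>2 / 2 * \<theta> + (\<integral>y. y - (1 - exp (- \<theta> * y)) / \<theta> \<partial>\<nu>))"
    unfolding levy_exponent_eq by blast
qed

text \<open>Tonelli for \<open>1 - exp (- \<theta> * z)\<close> on \<open>0 < z < y\<close>:
  integrating over \<open>y\<close> leaves the tail of \<open>\<nu>\<close>, integrating over
  \<open>z\<close> leaves the kernel of \<open>levy_J_integral\<close>.\<close>

lemma phi_integral:
  assumes "\<theta> > 0"
  shows "set_integrable lborel {0<..} (\<lambda>y. (1 - exp (- \<theta> * y)) * measure \<nu> {y<..})"
    "(LINT y:{0<..}|lborel. (1 - exp (- \<theta> * y)) * measure \<nu> {y<..}) = (\<integral>y. y - (1 - exp (- \<theta> * y)) / \<theta> \<partial>\<nu>)"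
proof -
  interpret sigma_finite_measure \<nu> by (rule levy_measure_sigma_finite)
  interpret P: pair_sigma_finite lborel \<nu> ..
  define K where "K z y = (if 0 < z \<and> z < y then ennreal (1 - exp (- \<theta> * z)) else 0)" for z y :: real
  have [measurable]: "case_prod K \<in> borel_measurable (lborel \<Otimes>\<^sub>M \<nu>)" unfolding K_def by measurable
  have inner1: "(\<integral>\<^sup>+y. K z y \<partial>\<nu>) = ennreal (indicator {0<..} z *\<^sub>R ((1 - exp (- \<theta> * z)) * measure \<nu> {z<..}))" for z
  proof (cases "z > 0")
    case True
    have "(\<integral>\<^sup>+y. K z y \<partial>\<nu>) = (\<integral>\<^sup>+y. ennreal (1 - exp (- \<theta> * z)) * indicator {z<..} y \<partial>\<nu>)"
      using True by (intro nn_integral_cong) (auto simp: K_def)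
    also have "\<dots> = ennreal (1 - exp (- \<theta> * z)) * emeasure \<nu> {z<..}"
      by (simp add: nn_integral_cmult_indicator levy_measure_sets)
    also have "emeasure \<nu> {z<..} = ennreal (measure \<nu> {z<..})"
      using levy_measure_tail_finite[OF True] by (simp add: emeasure_eq_ennreal_measure less_top)
    finally show ?thesis using True assms by (simp add: ennreal_mult)
  qed (simp add: K_def)
  have inner2: "(\<integral>\<^sup>+z. K z y \<partial>lborel) = ennreal (y - (1 - exp (- \<theta> * y)) / \<theta>)" if "y > 0" for y
  proof -
    have "AE z in lborel. z \<noteq> y" "AE z in lborel. z \<noteq> (0::real)" by (rule AE_lborel_singleton)+
    then have "AE z in lborel. K z y = ennreal (1 - exp (- \<theta> * z)) * indicator {0..y} z"
      by eventually_elim (auto simp: K_def indicator_def)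
    then have "(\<integral>\<^sup>+z. K z y \<partial>lborel) = (\<integral>\<^sup>+z. ennreal (1 - exp (- \<theta> * z)) * indicator {0..y} z \<partial>lborel)"
      by (rule nn_integral_cong_AE)
    also have "\<dots> = (y + exp (- \<theta> * y) / \<theta>) - (0 + exp (- \<theta> * 0) / \<theta>)"
      using assms that by (intro nn_integral_FTC_Icc) (auto intro!: derivative_eq_intros)
    finally show ?thesis by (simp add: diff_divide_distrib algebra_simps)
  qed
  have J0: "0 \<le> y - (1 - exp (- \<theta> * y)) / \<theta>" for y
    using exp_ge_add_one_self[of "- \<theta> * y"] assms by (simp add: field_simps)
  have "(\<integral>\<^sup>+z. ennreal (indicator {0<..} z *\<^sub>R ((1 - exp (- \<theta> * z)) * measure \<nu> {z<..})) \<partial>lborel) = (\<integral>\<^sup>+z. \<integral>\<^sup>+y. K z y \<partial>\<nu> \<partial>lborel)"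
    by (simp only: inner1)
  also have "\<dots> = (\<integral>\<^sup>+y. \<integral>\<^sup>+z. K z y \<partial>lborel \<partial>\<nu>)" by (rule P.Fubini'[symmetric]) measurable
  also have "\<dots> = (\<integral>\<^sup>+y. ennreal (y - (1 - exp (- \<theta> * y)) / \<theta>) \<partial>\<nu>)"
    using levy_measure_AE_pos by (intro nn_integral_cong_AE) (auto simp: inner2)
  also have "\<dots> = ennreal (\<integral>y. y - (1 - exp (- \<theta> * y)) / \<theta> \<partial>\<nu>)"
    using levy_J_integral(1)[OF assms] J0 by (intro nn_integral_eq_integral) auto
  finally have nn: "(\<integral>\<^sup>+z. ennreal (indicator {0<..} z *\<^sub>R ((1 - exp (- \<theta> * z)) * measure \<nu> {z<..})) \<partial>lborel)
    = ennreal (\<integral>y. y - (1 - exp (- \<theta> * y)) / \<theta> \<partial>\<nu>)" .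
  \<comment> \<open>Measurability of the tail function comes from the inner integral over
    \<open>\<nu>\<close>.\<close>
  have "(\<lambda>z. enn2real (\<integral>\<^sup>+y. K z y \<partial>\<nu>)) \<in> borel_measurable lborel" by measurable
  then have meas: "(\<lambda>z. indicator {0<..} z *\<^sub>R ((1 - exp (- \<theta> * z)) * measure \<nu> {z<..})) \<in> borel_measurable lborel"
    using assms by (subst (asm) inner1, subst (asm) enn2real_ennreal) (auto simp: indicator_def)
  have "has_bochner_integral lborel (\<lambda>z. indicator {0<..} z *\<^sub>R ((1 - exp (- \<theta> * z)) * measure \<nu> {z<..}))
     (\<integral>y. y - (1 - exp (- \<theta> * y)) / \<theta> \<partial>\<nu>)"
    using assms J0 by (intro has_bochner_integral_nn_integral[OF meas _ _ nn] AE_I2 integral_nonneg_AE)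
      (auto simp: indicator_def)
  then show "set_integrable lborel {0<..} (\<lambda>y. (1 - exp (- \<theta> * y)) * measure \<nu> {y<..})"
    "(LINT y:{0<..}|lborel. (1 - exp (- \<theta> * y)) * measure \<nu> {y<..}) = (\<integral>y. y - (1 - exp (- \<theta> * y)) / \<theta> \<partial>\<nu>)"
    by (simp_all add: has_bochner_integral_iff set_integrable_def set_lebesgue_integral_def)
qed

lemma levy_exponent_eq_phi:
  "\<theta> > 0 \<Longrightarrow> levy_exponent c \<sigma> \<nu> \<theta> = \<theta> * phi m \<sigma> \<nu> \<theta>"
  by (simp only: levy_J_integral(2) phi_def phi_integral(2))

lemma phi_mono:
  assumes "0 < a" "a \<le> b"
  shows "phi m \<sigma> \<nu> a \<le> phi m \<sigma> \<nu> b"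
proof -
  have "(LINT y:{0<..}|lborel. (1 - exp (- a * y)) * measure \<nu> {y<..})
      \<le> (LINT y:{0<..}|lborel. (1 - exp (- b * y)) * measure \<nu> {y<..})"
    using assms by (intro set_integral_mono phi_integral(1)) (auto intro!: mult_right_mono)
  then show ?thesis using assms by (auto simp: phi_def intro!: add_mono mult_left_mono)
qed

text \<open>For \<open>\<theta> < 1\<close> the integrand is dominated by the one at
  \<open>\<theta> = 1\<close>.\<close>

lemma phi_tendsto_0: "(phi m \<sigma> \<nu> \<longlongrightarrow> m) (at_right 0)"
proof -
  have "((\<lambda>\<theta>. LINT y:{0<..}|lborel. (1 - exp (- \<theta> * y)) * measure \<nu> {y<..}) \<longlongrightarrow> 0) (at_right 0)"
  proof (rule tendsto_at_right_sequentially[of 0 1])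
    fix S :: "nat \<Rightarrow> real"
    assume S: "\<And>n. 0 < S n" "\<And>n. S n < 1" "S \<longlonglongrightarrow> 0"
    have "(\<lambda>n. LINT y:{0<..}|lborel. (1 - exp (- S n * y)) * measure \<nu> {y<..}) \<longlonglongrightarrow> (\<integral>y. 0 \<partial>(lborel :: real measure))"
      unfolding set_lebesgue_integral_def
    proof (rule integral_dominated_convergence)
      show "integrable lborel (\<lambda>y. indicator {0<..} y *\<^sub>R ((1 - exp (- 1 * y)) * measure \<nu> {y<..}))"
        using phi_integral(1)[of 1] by (simp add: set_integrable_def)
      show "(\<lambda>y. indicator {0<..} y *\<^sub>R ((1 - exp (- S n * y)) * measure \<nu> {y<..})) \<in> borel_measurable lborel" for n
        using phi_integral(1)[OF S(1)[of n]] unfolding set_integrable_def by (rule borel_measurable_integrable)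
      have "(\<lambda>n. indicator {0<..} y *\<^sub>R ((1 - exp (- S n * y)) * measure \<nu> {y<..}))
         \<longlonglongrightarrow> indicator {0<..} y *\<^sub>R ((1 - exp (- 0 * y)) * measure \<nu> {y<..})" for y :: real
        using S(3) by (intro tendsto_intros)
      then show "AE y in lborel. (\<lambda>n. indicator {0<..} y *\<^sub>R ((1 - exp (- S n * y)) * measure \<nu> {y<..})) \<longlonglongrightarrow> 0"
        by simp
      show "AE y in lborel. norm (indicator {0<..} y *\<^sub>R ((1 - exp (- S n * y)) * measure \<nu> {y<..}))
         \<le> indicator {0<..} y *\<^sub>R ((1 - exp (- 1 * y)) * measure \<nu> {y<..})" for n
        using S(1)[of n] S(2)[of n]
        by (intro AE_I2) (auto simp: indicator_def abs_mult intro!: mult_right_mono)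
    qed simp
    then show "(\<lambda>n. LINT y:{0<..}|lborel. (1 - exp (- S n * y)) * measure \<nu> {y<..}) \<longlonglongrightarrow> 0" by simp
  qed simp
  then have "(phi m \<sigma> \<nu> \<longlongrightarrow> m + \<sigma>\<^sup>2 / 2 * 0 + 0) (at_right 0)"
    unfolding phi_def by (intro tendsto_intros)
  then show ?thesis by simp
qed

section \<open>Inverting the exponent\<close>

context
  assumes m_nonneg: "m \<ge> 0" and nondegenerate: "\<not> (\<sigma> = 0 \<and> (AE y in \<nu>. False))"
begin

text \<open>As \<open>m\<close> may be \<open>0\<close>, strictness comes from the Gaussian part or,
  when \<open>\<sigma> = 0\<close>, from the jumps: the kernel is strictly positive on positive
  arguments and \<open>\<nu>\<close> is not null.\<close>

lemma phi_pos:
  assumes "\<theta> > 0" shows "phi m \<sigma> \<nu> \<theta> > 0"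
proof -
  have J: "0 < y - (1 - exp (- \<theta> * y)) / \<theta>" if "y > 0" for y
  proof -
    have "1 - \<theta> * y < exp (- (\<theta> * y))" using exp_minus_greater[of "\<theta> * y"] assms that by simp
    then show ?thesis using assms by (simp add: field_simps)
  qed
  let ?I = "\<integral>y. y - (1 - exp (- \<theta> * y)) / \<theta> \<partial>\<nu>"
  have phi: "phi m \<sigma> \<nu> \<theta> = m + \<sigma>\<^sup>2 / 2 * \<theta> + ?I"
    using assms by (simp only: phi_def phi_integral(2))
  have nn: "AE y in \<nu>. 0 \<le> y - (1 - exp (- \<theta> * y)) / \<theta>"
    using levy_measure_AE_pos by eventually_elim (use J in \<open>auto intro: less_imp_le\<close>)
  then have I0: "?I \<ge> 0" by (rule integral_nonneg_AE)
  show ?thesis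
  proof (cases "\<sigma> = 0")
    case True
    have "?I \<noteq> 0"
    proof
      assume "?I = 0"
      then have "AE y in \<nu>. y - (1 - exp (- \<theta> * y)) / \<theta> = 0"
        using integral_nonneg_eq_0_iff_AE[OF levy_J_integral(1)[OF assms] nn] by blast
      with levy_measure_AE_pos have "AE y in \<nu>. False"
        by eventually_elim (use J in force)
      with True nondegenerate show False by blast
    qed
    with I0 m_nonneg True phi show ?thesis by simp
  next
    case False
    then have "\<sigma>\<^sup>2 / 2 * \<theta> > 0" using assms by simp
    with I0 m_nonneg phi show ?thesis by linarith
  qed
qed

text \<open>In the product of \<open>\<theta>\<close> and \<open>phi\<close> the latter is
  nondecreasing and positive, while the former increases strictly.\<close>

lemma levy_exponent_strict_mono:
  assumes "0 < a" "a < b" shows "levy_exponent c \<sigma> \<nu> a < levy_exponent c \<sigma> \<nu> b"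
proof -
  have "a * phi m \<sigma> \<nu> a \<le> a * phi m \<sigma> \<nu> b" using assms by (intro mult_left_mono phi_mono) auto
  also have "\<dots> < b * phi m \<sigma> \<nu> b" using assms phi_pos[of b] by simp
  finally show ?thesis using assms by (simp add: levy_exponent_eq_phi)
qed

lemma levy_exponent_pos: "\<theta> > 0 \<Longrightarrow> levy_exponent c \<sigma> \<nu> \<theta> > 0"
  by (simp add: levy_exponent_eq_phi phi_pos)

text \<open>The supremum runs over a single point: strict monotonicity excludes the other positive
  arguments, and the exponent vanishes at \<open>0\<close>.\<close>

lemma right_inverse_exponent_eq:
  assumes "\<theta> > 0"
  shows "right_inverse_exponent (levy_exponent c \<sigma> \<nu>) (levy_exponent c \<sigma> \<nu> \<theta>) = \<theta>"
proof -
  have "t = \<theta>" if "t \<ge> 0" "levy_exponent c \<sigma> \<nu> t = levy_exponent c \<sigma> \<nu> \<theta>" for t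
  proof (cases "t = 0")
    case True
    then show ?thesis using that levy_exponent_pos[OF assms] levy_exponent_0 by simp
  next
    case False
    then show ?thesis
      using that assms levy_exponent_strict_mono[of t \<theta>] levy_exponent_strict_mono[of \<theta> t]
      by (cases t \<theta> rule: linorder_cases) auto
  qed
  then have "{t. 0 \<le> t \<and> levy_exponent c \<sigma> \<nu> t = levy_exponent c \<sigma> \<nu> \<theta>} = {\<theta>}"
    using assms by auto
  then show ?thesis by (simp add: right_inverse_exponent_def)
qed

lemma levy_exponent_surj:
  assumes "q > 0" obtains \<theta> where "\<theta> > 0" "levy_exponent c \<sigma> \<nu> \<theta> = q"
proof -
  let ?p = "phi m \<sigma> \<nu> 1"
  have p: "?p > 0" by (simp add: phi_pos)
  \<comment> \<open>Monotonicity of \<open>phi\<close> brackets \<open>q\<close>: the exponent is at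
    most \<open>a * ?p\<close> for \<open>a \<le> 1\<close> and at least \<open>b * ?p\<close> for
    \<open>b \<ge> 1\<close>, and \<open>q / ?p\<close> lies between \<open>a\<close> and
    \<open>b\<close>.\<close>
  define a b where "a = min 1 (q / ?p)" and "b = max 1 (q / ?p)"
  have a: "a > 0" "a \<le> 1" using assms p by (auto simp: a_def)
  have b: "b \<ge> 1" by (auto simp: b_def)
  have "levy_exponent c \<sigma> \<nu> a \<le> a * ?p"
    using a by (simp add: levy_exponent_eq_phi mult_left_mono phi_mono)
  also have "\<dots> \<le> q / ?p * ?p" using p by (intro mult_right_mono) (auto simp: a_def)
  finally have la: "levy_exponent c \<sigma> \<nu> a \<le> q" using p by simp
  have "q = q / ?p * ?p" using p by simp
  also have "\<dots> \<le> b * ?p" using p by (intro mult_right_mono) (auto simp: b_def)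
  also have "\<dots> \<le> levy_exponent c \<sigma> \<nu> b"
    using b by (simp add: levy_exponent_eq_phi mult_left_mono phi_mono)
  finally have lb: "q \<le> levy_exponent c \<sigma> \<nu> b" .
  have "\<exists>x\<ge>a. x \<le> b \<and> levy_exponent c \<sigma> \<nu> x = q"
    using a b la lb by (intro IVT) (auto intro!: DERIV_isCont[OF levy_exponent_has_derivative])
  then show ?thesis using a(1) that by (metis less_le_trans)
qed

text \<open>The ratio is \<open>phi\<close> evaluated at the inverse of \<open>q\<close>, which
  tends to \<open>0\<close> with \<open>q\<close>, so the limit of \<open>phi\<close> at
  \<open>0\<close> applies.\<close>

lemma exponent_ratio_tendsto:
  "((\<lambda>q. q / right_inverse_exponent (levy_exponent c \<sigma> \<nu>) q) \<longlongrightarrow> m) (at_right 0)"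
proof -
  let ?R = "right_inverse_exponent (levy_exponent c \<sigma> \<nu>)"
  have R: "?R q > 0 \<and> levy_exponent c \<sigma> \<nu> (?R q) = q" if "q > 0" for q
    using levy_exponent_surj[OF that] right_inverse_exponent_eq by metis
  have "(?R \<longlongrightarrow> 0) (at_right 0)"
  proof (rule order_tendstoI)
    fix e :: real assume e: "e > 0"
    have "?R q < e" if "0 < q" "q < levy_exponent c \<sigma> \<nu> e" for q
      using R[OF that(1)] that(2) e levy_exponent_strict_mono[of e "?R q"] by (metis linorder_neqE_linordered_idom order_less_asym)
    then show "eventually (\<lambda>q. ?R q < e) (at_right 0)"
      using levy_exponent_pos[OF e] by (auto simp: eventually_at_right_field)
  next
    fix e :: real assume "e < 0"
    then show "eventually (\<lambda>q. e < ?R q) (at_right 0)"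
      using R by (auto simp: eventually_at_right_field intro!: exI[of _ 1]) (meson less_trans)
  qed
  moreover have "eventually (\<lambda>q. ?R q > 0) (at_right 0)"
    using R by (auto simp: eventually_at_right_field intro!: exI[of _ 1])
  ultimately have "filterlim ?R (at_right 0) (at_right 0)"
    by (rule tendsto_imp_filterlim_at_right)
  from filterlim_compose[OF phi_tendsto_0 this]
  have "((\<lambda>q. phi m \<sigma> \<nu> (?R q)) \<longlongrightarrow> m) (at_right 0)" .
  moreover have "eventually (\<lambda>q. phi m \<sigma> \<nu> (?R q) = q / ?R q) (at_right 0)"
  proof -
    have "phi m \<sigma> \<nu> (?R q) = q / ?R q" if "q > 0" for q
      using R[OF that] levy_exponent_eq_phi[of "?R q"] by (simp add: field_simps)
    then show ?thesis by (auto simp: eventually_at_right_field intro!: exI[of _ 1])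
  qed
  ultimately show ?thesis by (rule Lim_transform_eventually)
qed

end

end

end

theorem proposition3p5:
  fixes M :: "'a measure"
    and X V :: "real \<Rightarrow> 'a \<Rightarrow> real"
    and Y :: "real \<Rightarrow> 'a \<Rightarrow> ereal"
    and e :: "'a \<Rightarrow> ereal"
    and c \<sigma> \<beta> m :: real
    and \<nu> :: "real measure"
    and \<psi> :: "real \<Rightarrow> real"
  assumes X: "spectrally_negative_levy_process M X"
    and not_drift: "\<not> pure_drift M X"
    and nu: "levy_measure \<nu>"
    and psi: "\<psi> = levy_exponent c \<sigma> \<nu>"
    and X_exponent: "has_laplace_exponent M X \<psi>"
    and psi'0: "(deriv \<psi> \<longlongrightarrow> m) (at_right 0)"
    and m_nonneg: "m \<ge> 0"
    and Y: "killed_subordinator_via M \<beta> V e Y"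
    and Y_exponent:
      "\<And>t \<theta>. \<lbrakk>t > 0; \<theta> > 0\<rbrakk> \<Longrightarrow> killed_laplace_exponent M Y t \<theta> = phi m \<sigma> \<nu> \<theta>"
    and Y_indep:
      "prob_space.indep_set M
         (sigma_sets (space M) (process_sigma M {0..} V \<union> rv_sigma M e))
         (process_sigma M {0..} (first_passage X))"
  shows "killed_subordinator M (time_change (first_passage X) Y)
    \<and> ((\<lambda>q. q / right_inverse_exponent \<psi> q) \<longlongrightarrow> m) (at_right 0)
    \<and> eta \<psi> 0 = m
    \<and> (\<forall>t>0. \<forall>q\<ge>0.
         killed_laplace_exponent M (time_change (first_passage X) Y) t q = eta \<psi> q)"
proof -
  interpret X: spectrally_negative_levy_process M X by (rule X)
  have V: "subordinator M V" using Y by (simp add: killed_subordinator_via_def)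
  have deriv: "(deriv (levy_exponent c \<sigma> \<nu>) \<longlongrightarrow> m) (at_right 0)" using psi'0 by (simp add: psi)
  \<comment> \<open>Without Gaussian part and jumps the exponent would be linear, and
    \<open>X\<close> a pure drift.\<close>
  have nondegenerate: "\<not> (\<sigma> = 0 \<and> (AE y in \<nu>. False))"
  proof
    assume *: "\<sigma> = 0 \<and> (AE y in \<nu>. False)"
    then have "AE y in \<nu>. indicator {0<..} y *\<^sub>R (exp (- \<theta> * y) - 1 + \<theta> * y * indicator {..<1} y) = 0" for \<theta> :: real
      by (auto elim: eventually_mono)
    then have "\<psi> = (\<lambda>\<theta>. c * \<theta>)"
      using * by (auto simp: psi levy_exponent_def[abs_def] set_lebesgue_integral_def fun_eq_iff intro!: integral_eq_zero_AE)
    then show False using X.linear_exponent_imp_pure_drift X_exponent not_drift by simp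
  qed
  note ctxt = nu deriv m_nonneg nondegenerate
  have pos: "\<forall>\<theta>>0. \<psi> \<theta> > 0" using levy_exponent_pos[OF ctxt] by (simp add: psi)
  have surj: "\<forall>q>0. \<exists>\<theta>>0. \<psi> \<theta> = q" using levy_exponent_surj[OF ctxt] unfolding psi by metis
  interpret S: subordinated_passage M X V \<psi> \<beta> e Y
    by (intro subordinated_passage.intro subordinated_passage_axioms.intro X V X_exponent pos surj Y Y_indep)
  have ratio: "((\<lambda>q. q / right_inverse_exponent \<psi> q) \<longlongrightarrow> m) (at_right 0)"
    using exponent_ratio_tendsto[OF ctxt] by (simp add: psi)
  have eta0: "eta \<psi> 0 = m"
    unfolding eta_def using tendsto_Lim[OF trivial_limit_at_right_real ratio] by simp
  have Y_transform: "(\<integral>\<omega>. (if Y t \<omega> = \<infinity> then 0 else exp (- \<theta> * real_of_ereal (Y t \<omega>))) \<partial>M) = exp (- t * phi m \<sigma> \<nu> \<theta>)"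
    (is "?I = _") if "0 < t" "0 < \<theta>" for t \<theta>
  proof -
    have phi: "phi m \<sigma> \<nu> \<theta> > 0" using phi_pos[OF ctxt that(2)] .
    have eq: "- (1 / t) * ln ?I = phi m \<sigma> \<nu> \<theta>"
      using Y_exponent[OF that] by (simp add: killed_laplace_exponent_def)
    \<comment> \<open>The default \<open>ln 0 = 0\<close> would make the exponent \<open>0\<close>,
      which positivity of \<open>phi\<close> rules out.\<close>
    then have "?I \<noteq> 0" using phi by (metis ln_0 mult_zero_right less_irrefl)
    moreover have "0 \<le> ?I" by (intro integral_nonneg_AE AE_I2) auto
    ultimately have "0 < ?I" by (metis order_less_le)
    then have "?I = exp (ln ?I)" by (simp only: exp_ln)
    also have "ln ?I = - t * phi m \<sigma> \<nu> \<theta>" using eq that by (simp add: field_simps)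
    finally show ?thesis .
  qed
  \<comment> \<open>The exponent of \<open>Y\<close> is given for \<open>\<theta> > 0\<close>;
    letting \<open>\<theta>\<close> tend to \<open>0\<close> on both sides identifies the survival
    probability.\<close>
  have survival: "(\<integral>\<omega>. (if Y t \<omega> = \<infinity> then 0 else 1) \<partial>M) = exp (- t * m)" if t: "0 < t" for t
  proof (rule tendsto_unique)
    show "((\<lambda>\<theta>. exp (- t * phi m \<sigma> \<nu> \<theta>)) \<longlongrightarrow> exp (- t * m)) (at_right 0)"
      by (intro tendsto_intros phi_tendsto_0[OF nu deriv])
    have "eventually (\<lambda>\<theta>. (\<integral>\<omega>. (if Y t \<omega> = \<infinity> then 0 else exp (- \<theta> * real_of_ereal (Y t \<omega>))) \<partial>M) = exp (- t * phi m \<sigma> \<nu> \<theta>)) (at_right 0)"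
      using Y_transform[OF t] by (auto simp: eventually_at_right_field intro!: exI[of _ 1])
    then show "((\<lambda>\<theta>. exp (- t * phi m \<sigma> \<nu> \<theta>)) \<longlongrightarrow> (\<integral>\<omega>. (if Y t \<omega> = \<infinity> then 0 else 1) \<partial>M)) (at_right 0)"
      by (rule Lim_transform_eventually[OF S.killed_transform_0(2)[OF less_imp_le[OF t]]])
  qed simp
  have "killed_laplace_exponent M (time_change (first_passage X) Y) t q = eta \<psi> q" if t: "0 < t" and q: "0 \<le> q" for t q
  proof (cases "q = 0")
    case True
    then show ?thesis
      unfolding killed_laplace_exponent_def True S.killed_transform_0(1)[OF less_imp_le[OF t]] survival[OF t] eta0
      using t by simp
  next
    case False
    then obtain \<theta> where \<theta>: "0 < \<theta>" "\<psi> \<theta> = q" using surj q by (metis less_le)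
    then have "right_inverse_exponent \<psi> q = \<theta>"
      using right_inverse_exponent_eq[OF ctxt \<theta>(1)] by (simp add: psi)
    moreover have "q = \<theta> * phi m \<sigma> \<nu> \<theta>"
      using levy_exponent_eq_phi[OF nu deriv \<theta>(1)] \<theta>(2) by (simp add: psi)
    ultimately have "eta \<psi> q = phi m \<sigma> \<nu> \<theta>" using False \<theta>(1) by (simp add: eta_def)
    moreover have "killed_laplace_exponent M (time_change (first_passage X) Y) t q = phi m \<sigma> \<nu> \<theta>"
      unfolding killed_laplace_exponent_def \<theta>(2)[symmetric] S.killed_transform_time_change[OF \<theta>(1) less_imp_le[OF t]]
        Y_transform[OF t \<theta>(1)]
      using t by simp
    ultimately show ?thesis by simp
  qed
  moreover have "killed_subordinator M (time_change (first_passage X) Y)"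
    unfolding killed_subordinator_def using S.killed_subordinator_time_change by blast
  ultimately show ?thesis using ratio eta0 by blast
qed

end
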